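(* For every integer $d\geq 1$ there exists a centrally symmetric PL $d$-sphere $S_d$ with no induced centrally symmetric $4$-cycle and with $f_0(S_d)=3F_{d+1}+7F_d+3F_{d-1}-4$ vertices. Consequently, for every $d\geq 1$ there exists a PL triangulation $\Delta_d$ of the real projective space $\mathbb{R}P^d$ with $f_0(\Delta_d)=\frac{3}{2}F_{d+1}+\frac{7}{2}F_d+\frac{3}{2}F_{d-1}-2$ vertices.
   Context: $F_n$ denotes the $n$-th Fibonacci number: $F_0=0$, $F_1=1$, $F_n=F_{n-1}+F_{n-2}$ for $n\geq 2$. All complexes are abstract simplicial complexes; $f_0(\Delta)$ is the number of vertices of $\Delta$. A simplicial complex $\Delta$ is centrally symmetric (cs) if its vertex set carries a free involution $\sigma$ which maps faces to faces and induces a free involution on the set of non-empty faces. An induced cs $4$-cycle of a cs complex $\Delta$ is an induced subcomplex $C$ of $\Delta$ (i.e. $C$ contains every face of $\Delta$ whose vertices lie in $C$) that is isomorphic to a $4$-cycle and satisfies $\sigma(C)=C$. A PL $d$-sphere is a simplicial complex PL homeomorphic to the boundary of the $(d+1)$-simplex; a PL $d$-ball is one PL homeomorphic to the $d$-simplex; a PL $d$-manifold is a $d$-dimensional simplicial complex in which the link of every non-empty face $F$ is a PL $(d-|F|)$-ball or sphere. A PL triangulation of a closed manifold $M$ is a PL manifold whose geometric realization is homeomorphic to $M$. *)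

theory Defs
  imports "HOL-Analysis.Analysis" "HOL-Number_Theory.Fib"
begin

section \<open>Abstract simplicial complexes\<close>

text \<open>A complex is given by its set of faces, which includes the empty face; its vertex set
  is the union of the faces.\<close>

definition asc :: "'a set set \<Rightarrow> bool" where
  "asc K \<longleftrightarrow> finite K \<and> {} \<in> K \<and> (\<forall>F\<in>K. finite F) \<and> (\<forall>F\<in>K. \<forall>G. G \<subseteq> F \<longrightarrow> G \<in> K)"

definition verts :: "'a set set \<Rightarrow> 'a set" where
  "verts K = \<Union>K"

definition f0 :: "'a set set \<Rightarrow> nat" where
  "f0 K = card (verts K)"

definition dimension :: "'a set set \<Rightarrow> int" where
  "dimension K = int (Max (card ` K)) - 1"

definition link :: "'a set \<Rightarrow> 'a set set \<Rightarrow> 'a set set" where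
  "link F K = {G \<in> K. F \<inter> G = {} \<and> F \<union> G \<in> K}"

definition asc_isomorphic :: "'a set set \<Rightarrow> 'b set set \<Rightarrow> bool" where
  "asc_isomorphic K L \<longleftrightarrow> (\<exists>h. bij_betw h (verts K) (verts L) \<and> (`) h ` K = L)"

definition full_simplex :: "int \<Rightarrow> nat set set" where
  "full_simplex k = Pow {..<nat (k + 1)}"

definition simplex_boundary :: "int \<Rightarrow> nat set set" where
  "simplex_boundary k = full_simplex k - {{..<nat (k + 1)}}"

section \<open>Central symmetry\<close>

definition centrally_symmetric :: "'a set set \<Rightarrow> ('a \<Rightarrow> 'a) \<Rightarrow> bool" where
  "centrally_symmetric K \<sigma> \<longleftrightarrow> asc K \<and>
     (\<forall>v\<in>verts K. \<sigma> v \<in> verts K \<and> \<sigma> (\<sigma> v) = v \<and> \<sigma> v \<noteq> v) \<and>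
     (\<forall>F\<in>K. \<sigma> ` F \<in> K \<and> (F \<noteq> {} \<longrightarrow> \<sigma> ` F \<noteq> F))"

definition induced_subcomplex :: "'a set set \<Rightarrow> 'a set set \<Rightarrow> bool" where
  "induced_subcomplex C K \<longleftrightarrow> asc C \<and> C \<subseteq> K \<and> (\<forall>F\<in>K. F \<subseteq> verts C \<longrightarrow> F \<in> C)"

definition four_cycle :: "nat set set" where
  "four_cycle = {{}, {0}, {1}, {2}, {3}, {0,1}, {1,2}, {2,3}, {3,0}}"

definition induced_cs_four_cycle :: "'a set set \<Rightarrow> 'a set set \<Rightarrow> ('a \<Rightarrow> 'a) \<Rightarrow> bool" where
  "induced_cs_four_cycle C K \<sigma> \<longleftrightarrow>
     induced_subcomplex C K \<and> asc_isomorphic C four_cycle \<and> (`) \<sigma> ` C = C"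

section \<open>Geometric realization and piecewise linear homeomorphism\<close>

text \<open>Points are given by their barycentric coordinates. All complexes are finite, so the
  product topology is the usual topology of the realization.\<close>

definition realization :: "'a set set \<Rightarrow> ('a \<Rightarrow> real) set" where
  "realization K = {x. (\<forall>v. 0 \<le> x v) \<and> {v. x v \<noteq> 0} \<in> K \<and> (\<Sum>v | x v \<noteq> 0. x v) = 1}"

definition realization_space :: "'a set set \<Rightarrow> ('a \<Rightarrow> real) topology" where
  "realization_space K = subtopology (powertop_real UNIV) (realization K)"

text \<open>The vertex \<open>v\<close>, as a point of the realization, is \<open>indicator {v}\<close>. A map is linear on
  every closed simplex iff it is the barycentric extension of its values at the vertices.\<close>

definition simplexwise_linear :: "'a set set \<Rightarrow> (('a \<Rightarrow> real) \<Rightarrow> ('b \<Rightarrow> real)) \<Rightarrow> bool" where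
  "simplexwise_linear K f \<longleftrightarrow>
     (\<forall>x\<in>realization K. f x = (\<lambda>b. \<Sum>v\<in>verts K. x v * f (indicator {v}) b))"

text \<open>A subdivision of \<open>K\<close> is given by an abstract complex \<open>J\<close> and an identification \<open>\<phi>\<close> of its
  realization with that of \<open>K\<close> which embeds each closed simplex of \<open>J\<close> linearly in a closed
  simplex of \<open>K\<close>: the simplices of the subdivision are the \<open>\<phi>\<close>-images of those of \<open>J\<close>.\<close>

definition subdivision ::
  "'a set set \<Rightarrow> 'b set set \<Rightarrow> (('a \<Rightarrow> real) \<Rightarrow> ('b \<Rightarrow> real)) \<Rightarrow> bool" where
  "subdivision J K \<phi> \<longleftrightarrow> asc J \<and>
     homeomorphic_map (realization_space J) (realization_space K) \<phi> \<and>
     simplexwise_linear J \<phi> \<and>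
     (\<forall>F\<in>J. \<exists>G\<in>K. \<phi> ` realization (Pow F) \<subseteq> realization (Pow G))"

text \<open>A map is piecewise linear if it is linear on every simplex of some subdivision. As
  complexes are finite, taking \<open>J\<close> on natural numbers is no restriction.\<close>

definition piecewise_linear :: "'a set set \<Rightarrow> (('a \<Rightarrow> real) \<Rightarrow> ('b \<Rightarrow> real)) \<Rightarrow> bool" where
  "piecewise_linear K f \<longleftrightarrow>
     (\<exists>(J :: nat set set) \<phi>. subdivision J K \<phi> \<and> simplexwise_linear J (f \<circ> \<phi>))"

definition pl_homeomorphic :: "'a set set \<Rightarrow> 'b set set \<Rightarrow> bool" where
  "pl_homeomorphic K L \<longleftrightarrow>
     (\<exists>f. homeomorphic_map (realization_space K) (realization_space L) f \<and> piecewise_linear K f)"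

section \<open>PL spheres, balls and manifolds\<close>

text \<open>The complex whose only face is the empty one, which is the link of a facet, is the sphere
  of dimension \<open>-1\<close>.\<close>

definition pl_sphere :: "int \<Rightarrow> 'a set set \<Rightarrow> bool" where
  "pl_sphere k K \<longleftrightarrow> -1 \<le> k \<and> asc K \<and> pl_homeomorphic K (simplex_boundary (k + 1))"

definition pl_ball :: "int \<Rightarrow> 'a set set \<Rightarrow> bool" where
  "pl_ball k K \<longleftrightarrow> 0 \<le> k \<and> asc K \<and> pl_homeomorphic K (full_simplex k)"

definition pl_manifold :: "int \<Rightarrow> 'a set set \<Rightarrow> bool" where
  "pl_manifold k K \<longleftrightarrow> asc K \<and> dimension K = k \<and>
     (\<forall>F\<in>K. F \<noteq> {} \<longrightarrow> pl_ball (k - int (card F)) (link F K) \<or>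
                       pl_sphere (k - int (card F)) (link F K))"

definition pl_triangulation :: "int \<Rightarrow> 'b topology \<Rightarrow> 'a set set \<Rightarrow> bool" where
  "pl_triangulation k M K \<longleftrightarrow> pl_manifold k K \<and> realization_space K homeomorphic_space M"

section \<open>Real projective space\<close>

definition antipodal_pair :: "(nat \<Rightarrow> real) \<Rightarrow> (nat \<Rightarrow> real) set" where
  "antipodal_pair x = {x, (\<lambda>i. - x i)}"

definition real_projective_space :: "nat \<Rightarrow> (nat \<Rightarrow> real) set topology" where
  "real_projective_space d = topology (\<lambda>U. U \<subseteq> antipodal_pair ` topspace (nsphere d) \<and>
     openin (nsphere d) {x \<in> topspace (nsphere d). antipodal_pair x \<in> U})"

lemma openin_real_projective_space:
  "openin (real_projective_space d) U \<longleftrightarrow> U \<subseteq> antipodal_pair ` topspace (nsphere d) \<and>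
     openin (nsphere d) {x \<in> topspace (nsphere d). antipodal_pair x \<in> U}"
proof -
  let ?X = "nsphere d"
  let ?P = "\<lambda>U. U \<subseteq> antipodal_pair ` topspace ?X \<and>
     openin ?X {x \<in> topspace ?X. antipodal_pair x \<in> U}"
  have int: "?P (S \<inter> T)" if "?P S" "?P T" for S T
  proof -
    have "{x \<in> topspace ?X. antipodal_pair x \<in> S \<inter> T} =
      {x \<in> topspace ?X. antipodal_pair x \<in> S} \<inter> {x \<in> topspace ?X. antipodal_pair x \<in> T}"
      by auto
    with that show ?thesis by auto
  qed
  have un: "?P (\<Union>\<K>)" if "\<forall>K\<in>\<K>. ?P K" for \<K>
  proof -
    have "{x \<in> topspace ?X. antipodal_pair x \<in> \<Union>\<K>} =
      (\<Union>K\<in>\<K>. {x \<in> topspace ?X. antipodal_pair x \<in> K})"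
      by auto
    with that show ?thesis by auto
  qed
  have "istopology ?P"
    unfolding istopology_def using int un by blast
  then show ?thesis
    unfolding real_projective_space_def by (subst topology_inverse') auto
qed

lemma quotient_map_real_projective_space:
  "quotient_map (nsphere d) (real_projective_space d) antipodal_pair"
proof -
  have *: "openin (real_projective_space d) (antipodal_pair ` topspace (nsphere d))"
    unfolding openin_real_projective_space
    by (auto intro: back_subst[of "openin (nsphere d)", OF openin_topspace])
  then have "topspace (real_projective_space d) = antipodal_pair ` topspace (nsphere d)"
    by (metis openin_real_projective_space openin_subset openin_topspace subset_antisym)
  then show ?thesis
    unfolding quotient_map_def by (auto simp: openin_real_projective_space)
qed

end

theory Submission
  imports Defs
begin

text \<open>The sphere is built as \<open>S\<^sub>d = B\<^sub>d \<union> -B\<^sub>d\<close> with \<open>B\<^sub>d \<inter> -B\<^sub>d = S\<^bsub>d-1\<^esub>\<close>. To get \<open>B\<^bsub>d+1\<^esub>\<close>, cone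
  over \<open>S\<^sub>d\<close>, subdivide the edges from the apex to one vertex of each antipodal pair of \<open>S\<^bsub>d-1\<^esub>\<close>, and split
  the apex into one vertex over \<open>B\<^sub>d\<close> and one over \<open>-B\<^sub>d\<close>. Afterwards no vertex is adjacent to two
  antipodal vertices, and the numbers of antipodal pairs satisfy
  \<open>b\<^bsub>d+1\<^esub> = b\<^sub>d + b\<^bsub>d-1\<^esub> + 2\<close>.

  Instead of realizations we use the cones over them: a positively homogeneous piecewise linear map
  is a continuous selection of finitely many linear functionals in each coordinate, so that
  composition and gluing are immediate. Explicit maps of this kind identify the cone over \<open>S\<^sub>d\<close>
  equivariantly with \<open>\<real>\<^bsup>d+1\<^esup>\<close>. Radial projection gives the homeomorphism of the antipodal quotient
  with projective space; the directional derivative at a vertex identifies the cone over its link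
  with \<open>\<real>\<^sup>d\<close>, so all links are spheres. Sign patterns of the functionals cut the cones into cells, and
  the order complex of the cells is the subdivision on which such a map is simplexwise linear.\<close>

section \<open>Piecewise linear functions on cones\<close>

text \<open>That no vertex has two antipodal neighbours is stronger than the absence of induced cs
  4-cycles, and it is what the induction can carry. It serves both claims: in an invariant 4-cycle
  antipodes are opposite corners, so a third corner sees both of them; and in the quotient it keeps
  the star of a vertex embedded, so that the orbits of faces form a complex with the links of the
  sphere. The plain cone over \<open>S_d\<close> fails because its apex sees every antipodal pair.
  After the split, an apex sees only pairs inside \<open>B_d\<close> or inside \<open>-B_d\<close>,
  and these are the pairs of \<open>S_(d-1)\<close>; a midpoint on one edge for each such pair cuts
  off one of its members. This costs \<open>b_(d-1)\<close> midpoints and two apices, up to sign.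
  The start \<open>b_0 = 1\<close>, \<open>b_(-1) = 0\<close> gives 6 vertices for
  \<open>S_1\<close> and 12 for \<open>S_2\<close>. The delicate point is a model in which
  \<open>B_(d+1)\<close> is exactly a half space, with an explicit inverse. The two apices can be
  told apart there because the equatorial model already has \<open>B_d\<close> and
  \<open>-B_d\<close> as its half spaces.\<close>

definition face_cone :: "'a set set \<Rightarrow> ('a \<Rightarrow> real) set" where
  "face_cone K = {x. (\<forall>v. 0 \<le> x v) \<and> {v. x v \<noteq> 0} \<in> K}"

definition coords :: "'a set \<Rightarrow> ('a \<Rightarrow> real) set" where
  "coords I = {x. {v. x v \<noteq> 0} \<subseteq> I}"

definition lin :: "(('a \<Rightarrow> real) \<Rightarrow> real) \<Rightarrow> bool" where
  "lin g \<longleftrightarrow> (\<forall>a b x y. g (\<lambda>v. a * x v + b * y v) = a * g x + b * g y)"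

definition pl_fun :: "('a \<Rightarrow> real) set \<Rightarrow> (('a \<Rightarrow> real) \<Rightarrow> real) \<Rightarrow> bool" where
  "pl_fun X h \<longleftrightarrow> continuous_on X h \<and>
     (\<exists>G. finite G \<and> (\<forall>g\<in>G. lin g) \<and> (\<forall>x\<in>X. \<exists>g\<in>G. h x = g x))"

definition pl_map :: "('a \<Rightarrow> real) set \<Rightarrow> (('a \<Rightarrow> real) \<Rightarrow> 'b \<Rightarrow> real) \<Rightarrow> bool" where
  "pl_map X F \<longleftrightarrow> (\<forall>b. pl_fun X (\<lambda>x. F x b))"

definition pl_iso :: "('a \<Rightarrow> real) set \<Rightarrow> ('b \<Rightarrow> real) set \<Rightarrow>
    (('a \<Rightarrow> real) \<Rightarrow> 'b \<Rightarrow> real) \<Rightarrow> (('b \<Rightarrow> real) \<Rightarrow> 'a \<Rightarrow> real) \<Rightarrow> bool" where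
  "pl_iso X Y F F' \<longleftrightarrow> pl_map X F \<and> pl_map Y F' \<and> F ` X \<subseteq> Y \<and> F' ` Y \<subseteq> X \<and>
     (\<forall>x\<in>X. F' (F x) = x) \<and> (\<forall>y\<in>Y. F (F' y) = y)"

lemma linD: "lin g \<Longrightarrow> g (\<lambda>v. a * x v + b * y v) = a * g x + b * g y"
  by (simp add: lin_def)

lemma lin_zero: "lin g \<Longrightarrow> g (\<lambda>v. 0) = 0"
  using linD[of g 0 undefined 0 undefined] by simp

lemma lin_scale: "lin g \<Longrightarrow> g (\<lambda>v. a * x v) = a * g x"
  using linD[of g a x 0 x] by simp

lemma lin_add: "lin g \<Longrightarrow> g (\<lambda>v. x v + y v) = g x + g y"
  using linD[of g 1 x 1 y] by simp

lemma lin_sum: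
  assumes "lin g" "finite A"
  shows "g (\<lambda>v. \<Sum>a\<in>A. f a v) = (\<Sum>a\<in>A. g (f a))"
  using assms(2)
proof induction
  case (insert a A)
  have "g (\<lambda>v. f a v + (\<Sum>a\<in>A. f a v)) = g (f a) + g (\<lambda>v. \<Sum>a\<in>A. f a v)"
    by (rule lin_add[OF assms(1)])
  then show ?case using insert by simp
qed (use lin_zero[OF assms(1)] in simp)

lemma lin_expand:
  assumes "lin g" "finite V" "x \<in> coords V"
  shows "g x = (\<Sum>v\<in>V. x v * g (indicator {v}))"
proof -
  have "x = (\<lambda>w. \<Sum>v\<in>V. x v * indicator {v} w)"
  proof
    fix w
    have "(\<Sum>v\<in>V. x v * indicator {v} w) = (\<Sum>v\<in>V. if v = w then x v else 0)"
      by (intro sum.cong) (auto simp: indicator_def)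
    also have "\<dots> = x w"
      using assms by (auto simp: coords_def)
    finally show "x w = (\<Sum>v\<in>V. x v * indicator {v} w)" by simp
  qed
  then have "g x = g (\<lambda>w. \<Sum>v\<in>V. x v * indicator {v} w)" by (rule arg_cong)
  also have "\<dots> = (\<Sum>v\<in>V. x v * g (indicator {v}))"
  proof -
    have "g (\<lambda>w. \<Sum>v\<in>V. x v * indicator {v} w) = (\<Sum>v\<in>V. g (\<lambda>w. x v * indicator {v} w))"
      by (rule lin_sum[OF assms(1,2)])
    moreover have "g (\<lambda>w. x v * indicator {v} w) = x v * g (indicator {v})" for v
      by (rule lin_scale[OF assms(1)])
    ultimately show ?thesis by simp
  qed
  finally show ?thesis .
qed

lemma continuous_on_coord: "continuous_on X (\<lambda>x::'a \<Rightarrow> real. x v)"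
  by (rule continuous_on_subset[OF continuous_on_product_coordinates subset_UNIV])

lemma lin_continuous:
  assumes "lin g" "finite V" "X \<subseteq> coords V"
  shows "continuous_on X g"
proof -
  have "continuous_on X (\<lambda>x. \<Sum>v\<in>V. x v * g (indicator {v}))"
    by (intro continuous_intros continuous_on_coord)
  moreover have "continuous_on X g = continuous_on X (\<lambda>x. \<Sum>v\<in>V. x v * g (indicator {v}))"
    using assms by (intro continuous_on_cong) (auto intro: lin_expand)
  ultimately show ?thesis by simp
qed

lemma lin_coord: "lin (\<lambda>x. x v)"
  by (simp add: lin_def)

lemma lin_combination:
  assumes "\<And>i. i \<in> I \<Longrightarrow> lin (g i)"
  shows "lin (\<lambda>x. \<Sum>i\<in>I. c i * g i x)"
  unfolding lin_def
proof (intro allI)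
  fix a b x y
  have "(\<Sum>i\<in>I. c i * g i (\<lambda>v. a * x v + b * y v)) = (\<Sum>i\<in>I. a * (c i * g i x) + b * (c i * g i y))"
  proof (rule sum.cong[OF refl])
    fix i assume "i \<in> I"
    then have "g i (\<lambda>v. a * x v + b * y v) = a * g i x + b * g i y"
      by (rule linD[OF assms])
    then show "c i * g i (\<lambda>v. a * x v + b * y v) = a * (c i * g i x) + b * (c i * g i y)"
      by (simp add: algebra_simps)
  qed
  then show "(\<Sum>i\<in>I. c i * g i (\<lambda>v. a * x v + b * y v)) =
      a * (\<Sum>i\<in>I. c i * g i x) + b * (\<Sum>i\<in>I. c i * g i y)"
    by (simp add: sum.distrib sum_distrib_left)
qed

lemma pl_funI:
  assumes "continuous_on X h" "finite G" "\<And>g. g \<in> G \<Longrightarrow> lin g"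
    "\<And>x. x \<in> X \<Longrightarrow> \<exists>g\<in>G. h x = g x"
  shows "pl_fun X h"
  using assms by (auto simp: pl_fun_def)

lemma pl_fun_cong: "(\<And>x. x \<in> X \<Longrightarrow> f x = g x) \<Longrightarrow> pl_fun X f \<longleftrightarrow> pl_fun X g"
  unfolding pl_fun_def by (simp cong: continuous_on_cong)

lemma pl_fun_coord: "pl_fun X (\<lambda>x. x v)"
  by (rule pl_funI[where G="{\<lambda>x. x v}"]) (auto simp: lin_coord continuous_on_coord)

lemma pl_fun_zero: "pl_fun X (\<lambda>x. 0)"
  by (rule pl_funI[where G="{\<lambda>x. 0}"]) (auto simp: lin_def)

lemma lin_linear:
  assumes "lin f" "lin g"
  shows "lin (\<lambda>x. c * f x + d * g x)"
  unfolding lin_def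
proof (intro allI)
  fix a b x y
  show "c * f (\<lambda>v. a * x v + b * y v) + d * g (\<lambda>v. a * x v + b * y v) =
    a * (c * f x + d * g x) + b * (c * f y + d * g y)"
    using linD[OF assms(1), of a x b y] linD[OF assms(2), of a x b y] by (simp add: algebra_simps)
qed

lemma pl_fun_continuous: "pl_fun X h \<Longrightarrow> continuous_on X h"
  by (simp add: pl_fun_def)

text \<open>Linear combinations, minima and maxima all reduce to this: pointwise the value is one of
  finitely many combinations of the selected functionals, and only continuity remains to be
  checked.\<close>

lemma pl_fun_select2:
  assumes "pl_fun X f" "pl_fun X g" "continuous_on X h"
    "\<And>x. x \<in> X \<Longrightarrow> h x \<in> {f x, g x, c * f x + d * g x}"
  shows "pl_fun X h"
proof -
  obtain A where A: "finite A" "\<And>a. a \<in> A \<Longrightarrow> lin a" "\<And>x. x \<in> X \<Longrightarrow> \<exists>a\<in>A. f x = a x"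
    using assms(1) unfolding pl_fun_def by blast
  obtain B where B: "finite B" "\<And>a. a \<in> B \<Longrightarrow> lin a" "\<And>x. x \<in> X \<Longrightarrow> \<exists>a\<in>B. g x = a x"
    using assms(2) unfolding pl_fun_def by blast
  let ?G = "A \<union> B \<union> (\<lambda>(a,b). \<lambda>x. c * a x + d * b x) ` (A \<times> B)"
  show ?thesis
  proof (rule pl_funI[where G="?G"])
    show "finite ?G" using A B by auto
    show "lin k" if "k \<in> ?G" for k
      using that A(2) B(2) by (auto intro: lin_linear)
    fix x assume x: "x \<in> X"
    obtain a b where ab: "a \<in> A" "f x = a x" "b \<in> B" "g x = b x"
      using A(3)[OF x] B(3)[OF x] by blast
    have "(\<lambda>x. c * a x + d * b x) \<in> ?G" "a \<in> ?G" "b \<in> ?G"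
      using ab by force+
    then show "\<exists>k\<in>?G. h x = k x"
      using assms(4)[OF x] ab by (metis (no_types, lifting) empty_iff insert_iff)
  qed (fact assms(3))
qed

lemma pl_fun_linear:
  assumes "pl_fun X f" "pl_fun X g"
  shows "pl_fun X (\<lambda>x. c * f x + d * g x)"
proof (rule pl_fun_select2[OF assms, where c=c and d=d])
  show "continuous_on X (\<lambda>x. c * f x + d * g x)"
    by (intro continuous_intros pl_fun_continuous assms)
qed simp

lemma pl_fun_add: "pl_fun X f \<Longrightarrow> pl_fun X g \<Longrightarrow> pl_fun X (\<lambda>x. f x + g x)"
  using pl_fun_linear[of X f g 1 1] by simp

lemma pl_fun_diff: "pl_fun X f \<Longrightarrow> pl_fun X g \<Longrightarrow> pl_fun X (\<lambda>x. f x - g x)"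
  using pl_fun_linear[of X f g 1 "-1"] by simp

lemma pl_fun_scale: "pl_fun X f \<Longrightarrow> pl_fun X (\<lambda>x. c * f x)"
  using pl_fun_linear[of X f f c 0] by simp

lemma pl_fun_scale_right: "pl_fun X f \<Longrightarrow> pl_fun X (\<lambda>x. f x * c)"
  using pl_fun_scale[of X f c] by (simp add: mult.commute)

lemma pl_fun_divide: "pl_fun X f \<Longrightarrow> pl_fun X (\<lambda>x. f x / c)"
  using pl_fun_scale[of X f "1 / c"] by simp

lemma pl_fun_uminus: "pl_fun X f \<Longrightarrow> pl_fun X (\<lambda>x. - f x)"
  using pl_fun_scale[of X f "-1"] by simp

lemma pl_fun_min:
  assumes "pl_fun X f" "pl_fun X g"
  shows "pl_fun X (\<lambda>x. min (f x) (g x))"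
proof (rule pl_fun_select2[OF assms])
  show "continuous_on X (\<lambda>x. min (f x) (g x))"
    by (intro continuous_intros pl_fun_continuous assms)
qed (auto simp: min_def)

lemma pl_fun_max:
  assumes "pl_fun X f" "pl_fun X g"
  shows "pl_fun X (\<lambda>x. max (f x) (g x))"
proof (rule pl_fun_select2[OF assms])
  show "continuous_on X (\<lambda>x. max (f x) (g x))"
    by (intro continuous_intros pl_fun_continuous assms)
qed (auto simp: max_def)

lemma pl_fun_abs:
  assumes "pl_fun X f"
  shows "pl_fun X (\<lambda>x. \<bar>f x\<bar>)"
proof -
  have "(\<lambda>x. \<bar>f x\<bar>) = (\<lambda>x. max (f x) (- f x))" by auto
  then show ?thesis using pl_fun_max[OF assms pl_fun_uminus[OF assms]] by simp
qed

lemma pl_fun_sum: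
  assumes "\<And>i. i \<in> I \<Longrightarrow> pl_fun X (f i)"
  shows "pl_fun X (\<lambda>x. \<Sum>i\<in>I. f i x)"
  using assms by (induction I rule: infinite_finite_induct) (auto intro: pl_fun_zero pl_fun_add)

lemma pl_fun_compose:
  assumes h: "pl_fun Y h" and F: "\<And>b. pl_fun X (\<lambda>x. F x b)"
    and XY: "\<And>x. x \<in> X \<Longrightarrow> F x \<in> Y" and Y: "Y \<subseteq> coords W" and W: "finite W"
  shows "pl_fun X (\<lambda>x. h (F x))"
proof -
  obtain G where G: "finite G" "\<And>a. a \<in> G \<Longrightarrow> lin a" "\<And>x. x \<in> Y \<Longrightarrow> \<exists>a\<in>G. h x = a x"
    using h unfolding pl_fun_def by blast
  have "\<exists>A. finite A \<and> (\<forall>a\<in>A. lin a) \<and> (\<forall>x\<in>X. \<exists>a\<in>A. F x b = a x)" for b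
    using F[of b] unfolding pl_fun_def by blast
  then obtain A where A: "\<And>b. finite (A b)" "\<And>a b. a \<in> A b \<Longrightarrow> lin a"
    "\<And>x b. x \<in> X \<Longrightarrow> \<exists>a\<in>A b. F x b = a x"
    by metis
  \<comment> \<open>One candidate for each functional \<open>g\<close> of the outer function and
    each choice \<open>s\<close> of a functional for every inner coordinate in the finite set
    \<open>W\<close>.\<close>
  let ?K = "(\<lambda>(g,s). \<lambda>x. \<Sum>w\<in>W. g (indicator {w}) * s w x) ` (G \<times> PiE W A)"
  show ?thesis
  proof (rule pl_funI[where G="?K"])
    show "continuous_on X (\<lambda>x. h (F x))"
      by (rule continuous_on_compose2[OF pl_fun_continuous[OF h]])
        (use XY F in \<open>auto intro!: continuous_on_coordinatewise_then_product pl_fun_continuous\<close>)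
    show "finite ?K" using G(1) A(1) W by (auto intro!: finite_PiE)
    show "lin k" if "k \<in> ?K" for k
      using that A(2) by (auto intro!: lin_combination simp: PiE_iff)
    fix x assume x: "x \<in> X"
    obtain g where g: "g \<in> G" "h (F x) = g (F x)" using G(3) XY x by blast
    obtain s where s: "\<And>b. s b \<in> A b" "\<And>b. F x b = s b x" using A(3)[OF x] by metis
    have eq: "h (F x) = (\<Sum>w\<in>W. g (indicator {w}) * restrict s W w x)"
      using lin_expand[OF G(2)[OF g(1)] W, of "F x"] Y XY[OF x] g(2) s(2)
      by (auto simp: mult.commute cong: sum.cong)
    have mem: "(\<lambda>x. \<Sum>w\<in>W. g (indicator {w}) * restrict s W w x) \<in> ?K"
      by (rule image_eqI[where x="(g, restrict s W)"]) (use g(1) s in auto)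
    show "\<exists>k\<in>?K. h (F x) = k x"
      by (rule bexI[where x="\<lambda>x. \<Sum>w\<in>W. g (indicator {w}) * restrict s W w x"], rule eq, rule mem)
  qed
qed

lemma pl_fun_Un:
  assumes "pl_fun X f" "pl_fun Y f" "closed X" "closed Y"
  shows "pl_fun (X \<union> Y) f"
proof -
  obtain A where A: "finite A" "\<And>a. a \<in> A \<Longrightarrow> lin a" "\<And>x. x \<in> X \<Longrightarrow> \<exists>a\<in>A. f x = a x"
    using assms(1) unfolding pl_fun_def by blast
  obtain B where B: "finite B" "\<And>a. a \<in> B \<Longrightarrow> lin a" "\<And>x. x \<in> Y \<Longrightarrow> \<exists>a\<in>B. f x = a x"
    using assms(2) unfolding pl_fun_def by blast
  show ?thesis
  proof (rule pl_funI[where G="A \<union> B"])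
    show "continuous_on (X \<union> Y) f"
      using assms by (intro continuous_on_closed_Un pl_fun_continuous)
    show "\<exists>g\<in>A \<union> B. f x = g x" if "x \<in> X \<union> Y" for x
      using that A(3)[of x] B(3)[of x] by blast
  qed (use A(1,2) B(1,2) in auto)
qed

lemma pl_map_compose:
  assumes "pl_map Y H" "pl_map X F" "\<And>x. x \<in> X \<Longrightarrow> F x \<in> Y" "Y \<subseteq> coords W" "finite W"
  shows "pl_map X (\<lambda>x. H (F x))"
  using assms unfolding pl_map_def by (auto intro: pl_fun_compose)

lemma pl_iso_sym: "pl_iso X Y F F' \<Longrightarrow> pl_iso Y X F' F"
  by (auto simp: pl_iso_def)

lemma pl_iso_trans:
  assumes "pl_iso X Y F F'" "pl_iso Y Z H H'" "Y \<subseteq> coords W" "finite W"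
  shows "pl_iso X Z (\<lambda>x. H (F x)) (\<lambda>z. F' (H' z))"
  using assms unfolding pl_iso_def
  by (auto simp: image_subset_iff intro!: pl_map_compose[where Y=Y and W=W])

text \<open>Along a ray the quotient of \<open>h (c x)\<close> by \<open>c\<close> is continuous in
  \<open>c\<close> and takes values in the finite set of the \<open>g x\<close>, so it is
  constant.\<close>

lemma pl_fun_homogeneous:
  assumes h: "pl_fun X h" and X: "\<And>c. c > 0 \<Longrightarrow> (\<lambda>v. c * x v) \<in> X" and c: "c > 0"
  shows "h (\<lambda>v. c * x v) = c * h x"
proof -
  obtain G where G: "finite G" "\<And>a. a \<in> G \<Longrightarrow> lin a" "\<And>x. x \<in> X \<Longrightarrow> \<exists>a\<in>G. h x = a x"
    using h unfolding pl_fun_def by blast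
  define f where "f c = h (\<lambda>v. c * x v) / c" for c :: real
  have "continuous_on {0<..} f"
    unfolding f_def
    by (intro continuous_intros continuous_on_compose2[OF pl_fun_continuous[OF h]])
      (auto intro!: X continuous_on_coordinatewise_then_product continuous_intros)
  moreover have "f ` {0<..} \<subseteq> (\<lambda>g. g x) ` G"
  proof
    fix y assume "y \<in> f ` {0<..}"
    then obtain d where d: "d > 0" "y = f d" by auto
    obtain g where "g \<in> G" "h (\<lambda>v. d * x v) = g (\<lambda>v. d * x v)" using G(3)[OF X[OF d(1)]] by blast
    moreover from this have "g (\<lambda>v. d * x v) = d * g x" by (intro lin_scale G(2))
    ultimately show "y \<in> (\<lambda>g. g x) ` G" using d by (auto simp: f_def)
  qed
  then have "finite (f ` {0<..})" using G(1) by (meson finite_imageI finite_subset)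
  ultimately have "f constant_on {0<..}"
    by (intro continuous_finite_range_constant) auto
  then have "f c = f 1" using c unfolding constant_on_def by (metis greaterThan_iff zero_less_one)
  then show ?thesis using c by (simp add: f_def field_simps)
qed

text \<open>When \<open>H\<close> is closed under negation, the sign condition places
  \<open>y\<close> in the closure of the cell of \<open>x\<close>. The segment condition is there
  because the cone over a complex is rarely convex.\<close>

definition agrees_below :: "('a \<Rightarrow> real) set \<Rightarrow> (('a \<Rightarrow> real) \<Rightarrow> real) set \<Rightarrow> (('a \<Rightarrow> real) \<Rightarrow> real) \<Rightarrow>
    ('a \<Rightarrow> real) \<Rightarrow> (('a \<Rightarrow> real) \<Rightarrow> real) \<Rightarrow> bool" where
  "agrees_below X H h x g \<longleftrightarrow>
     (\<forall>y\<in>X. (\<forall>t. 0 \<le> t \<longrightarrow> t \<le> 1 \<longrightarrow> (\<lambda>v. (1 - t) * x v + t * y v) \<in> X) \<longrightarrow>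
         (\<forall>k\<in>H. 0 < k y \<longrightarrow> 0 < k x) \<longrightarrow> h y = g y)"

lemma agrees_belowD:
  assumes "agrees_below X H h x g" "y \<in> X"
    "\<And>t. 0 \<le> t \<Longrightarrow> t \<le> 1 \<Longrightarrow> (\<lambda>v. (1 - t) * x v + t * y v) \<in> X" "\<And>k. k \<in> H \<Longrightarrow> 0 < k y \<Longrightarrow> 0 < k x"
  shows "h y = g y"
  using assms by (simp add: agrees_below_def)

definition linear_on_cells ::
    "('a \<Rightarrow> real) set \<Rightarrow> (('a \<Rightarrow> real) \<Rightarrow> real) set \<Rightarrow> (('a \<Rightarrow> real) \<Rightarrow> real) \<Rightarrow> bool" where
  "linear_on_cells X H h \<longleftrightarrow> finite H \<and> (\<forall>k\<in>H. lin k) \<and> (\<forall>x\<in>X. \<exists>g. lin g \<and> agrees_below X H h x g)"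

text \<open>The functional \<open>k - g\<close> cannot change sign along the segment from \<open>x\<close> to \<open>y\<close>, so a continuous
  selection that starts with \<open>g\<close> cannot switch to another functional.\<close>

lemma pl_fun_linear_on_cells:
  assumes h: "pl_fun X h" and XV: "X \<subseteq> coords V" "finite V"
  shows "\<exists>H. linear_on_cells X H h"
proof -
  obtain G where G: "finite G" "\<And>a. a \<in> G \<Longrightarrow> lin a" "\<And>x. x \<in> X \<Longrightarrow> \<exists>a\<in>G. h x = a x"
    using h unfolding pl_fun_def by blast
  define H where "H = (\<lambda>(k, g) x. k x - g x) ` (G \<times> G)"
  have finH: "finite H" using G(1) by (simp add: H_def)
  have linH: "lin k" if "k \<in> H" for k
    using that G(2) lin_linear[of _ _ 1 "-1"] by (auto simp: H_def)
  have "\<exists>g. lin g \<and> agrees_below X H h x g" if x: "x \<in> X" for x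
  proof -
    obtain g where g: "g \<in> G" "h x = g x" using G(3)[OF x] by blast
    have "h y = g y" if y: "y \<in> X" and seg: "\<And>t. 0 \<le> t \<Longrightarrow> t \<le> 1 \<Longrightarrow> (\<lambda>v. (1 - t) * x v + t * y v) \<in> X"
      and Hxy: "\<And>k. k \<in> H \<Longrightarrow> 0 < k y \<Longrightarrow> 0 < k x" for y
    proof -
      define p where "p t = (\<lambda>v. (1 - t) * x v + t * y v)" for t :: real
      define f where "f t = h (p t) - g (p t)" for t
      have pX: "p t \<in> X" if "0 \<le> t" "t \<le> 1" for t using seg that by (simp add: p_def)
      have contp: "continuous_on {0..1} p"
        unfolding p_def by (intro continuous_on_coordinatewise_then_product continuous_intros)
      have contf: "continuous_on {0..1} f"
        unfolding f_def
        by (intro continuous_intros continuous_on_compose2[OF pl_fun_continuous[OF h] contp]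
            continuous_on_compose2[OF lin_continuous[OF G(2)[OF g(1)] XV(2,1)] contp]) (auto intro: pX)
      define D where "D = (\<lambda>k. \<bar>k x - g x\<bar>) ` {k \<in> G. k x \<noteq> g x}"
      define \<delta> where "\<delta> = Min (insert 1 D)"
      have \<delta>: "\<delta> > 0" "\<And>k. k \<in> G \<Longrightarrow> k x \<noteq> g x \<Longrightarrow> \<delta> \<le> \<bar>k x - g x\<bar>"
        using G(1) by (auto simp: \<delta>_def D_def)
      \<comment> \<open>\<open>\<delta>\<close> is at most the distance at \<open>x\<close> between
        \<open>g\<close> and any functional of \<open>G\<close> with another value there. As signs
        are preserved, this distance shrinks at most linearly along the segment, so
        \<open>f t\<close> is either zero or bounded away from zero: it cannot leave zero
        continuously before \<open>t = 1\<close>.\<close>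
      have gap: "f t = 0 \<or> (1 - t) * \<delta> \<le> \<bar>f t\<bar>" if t: "0 \<le> t" "t \<le> 1" for t
      proof -
        obtain k where k: "k \<in> G" "h (p t) = k (p t)" using G(3)[OF pX[OF t]] by blast
        have lp: "k (p t) = (1 - t) * k x + t * k y" "g (p t) = (1 - t) * g x + t * g y"
          unfolding p_def using G(2) k(1) g(1) by (auto intro!: linD)
        have kH: "(\<lambda>x. k x - g x) \<in> H" "(\<lambda>x. g x - k x) \<in> H" using k(1) g(1) by (auto simp: H_def)
        have s: "k y - g y > 0 \<Longrightarrow> k x - g x > 0" "g y - k y > 0 \<Longrightarrow> g x - k x > 0"
          using Hxy[OF kH(1)] Hxy[OF kH(2)] by auto
        have ft: "f t = (1 - t) * (k x - g x) + t * (k y - g y)"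
          using k(2) lp by (simp add: f_def algebra_simps)
        show ?thesis
        proof (cases "k x = g x")
          case True
          then show ?thesis using s ft by (smt (verit) mult_eq_0_iff)
        next
          case False
          have d: "\<delta> \<le> \<bar>k x - g x\<bar>" using \<delta>(2) k(1) False by blast
          have "(1 - t) * \<delta> \<le> \<bar>f t\<bar>"
          proof (cases "k x > g x")
            case True
            then have "k y - g y \<ge> 0" using s(2) by linarith
            then have "t * (k y - g y) \<ge> 0" using t by simp
            moreover have "(1 - t) * \<delta> \<le> (1 - t) * (k x - g x)"
              using d True t by (intro mult_left_mono) auto
            ultimately show ?thesis unfolding ft by linarith
          next
            case False
            then have "g y - k y \<ge> 0" using s(1) by linarith
            then have "t * (g y - k y) \<ge> 0" using t by simp
            moreover have "(1 - t) * \<delta> \<le> (1 - t) * (g x - k x)"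
              using d False t by (intro mult_left_mono) auto
            ultimately show ?thesis unfolding ft by (simp add: algebra_simps)
          qed
          then show ?thesis by blast
        qed
      qed
      have f0: "f 0 = 0" using g(2) by (simp add: f_def p_def)
      have fz: "f s = 0" if s: "0 \<le> s" "s < 1" for s
      proof (rule ccontr)
        assume ne: "f s \<noteq> 0"
        define m where "m = (1 - s) * \<delta> / 2"
        have m: "0 < m" "m < (1 - s) * \<delta>" using s \<delta>(1) by (auto simp: m_def)
        have "m \<le> \<bar>f s\<bar>" using gap[of s] ne s m by linarith
        moreover have "continuous_on {0..s} (\<lambda>t. \<bar>f t\<bar>)"
          using contf s by (intro continuous_intros continuous_on_subset[OF contf]) auto
        ultimately obtain t where t: "0 \<le> t" "t \<le> s" "\<bar>f t\<bar> = m"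
          using IVT'[of "\<lambda>t. \<bar>f t\<bar>" 0 m s] f0 m(1) s by auto
        then have "(1 - t) * \<delta> \<le> m" using gap[of t] m s by auto
        moreover have "(1 - s) * \<delta> \<le> (1 - t) * \<delta>" using t \<delta>(1) by (intro mult_right_mono) auto
        ultimately show False using m by linarith
      qed
      \<comment> \<open>The bound degenerates at \<open>t = 1\<close>, so the endpoint needs
        continuity once more.\<close>
      have "f 1 = 0"
      proof (rule ccontr)
        assume ne: "f 1 \<noteq> 0"
        then obtain t where "0 \<le> t" "t \<le> 1" "\<bar>f t\<bar> = \<bar>f 1\<bar> / 2"
          using IVT'[of "\<lambda>t. \<bar>f t\<bar>" 0 "\<bar>f 1\<bar> / 2" 1] f0 contf
          by (auto intro!: continuous_intros)
        then show False using fz[of t] ne by (cases "t = 1") auto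
      qed
      then show ?thesis by (simp add: f_def p_def)
    qed
    then have "agrees_below X H h x g" unfolding agrees_below_def by (intro ballI impI) simp
    then show ?thesis using G(2) g(1) by blast
  qed
  then show ?thesis unfolding linear_on_cells_def using finH linH by (intro exI[of _ H]) simp
qed

section \<open>Cones and realizations\<close>

lemma asc_subset: "asc K \<Longrightarrow> F \<in> K \<Longrightarrow> G \<subseteq> F \<Longrightarrow> G \<in> K"
  by (auto simp: asc_def)

lemma finite_verts: "asc K \<Longrightarrow> finite (verts K)"
  by (auto simp: asc_def verts_def)

lemma cone_nonneg: "x \<in> face_cone K \<Longrightarrow> 0 \<le> x v"
  by (simp add: face_cone_def)

lemma cone_coords: "face_cone K \<subseteq> coords (verts K)"
  by (auto simp: face_cone_def coords_def verts_def)

lemma cone_zero_outside: "x \<in> face_cone K \<Longrightarrow> v \<notin> verts K \<Longrightarrow> x v = 0"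
  using cone_coords by (fastforce simp: coords_def)

lemma zero_in_cone: "asc K \<Longrightarrow> (\<lambda>v. 0) \<in> face_cone K"
  by (auto simp: face_cone_def asc_def)

lemma cone_scale: "x \<in> face_cone K \<Longrightarrow> c > 0 \<Longrightarrow> (\<lambda>v. c * x v) \<in> face_cone K"
  by (auto simp: face_cone_def)

lemma cone_support_subset:
  assumes "asc K" "x \<in> face_cone K" "\<And>v. 0 \<le> y v" "\<And>v. x v = 0 \<Longrightarrow> y v = 0"
  shows "y \<in> face_cone K"
proof -
  have "{v. y v \<noteq> 0} \<subseteq> {v. x v \<noteq> 0}" using assms(4) by auto
  then show ?thesis using assms(1-3) unfolding face_cone_def by (auto intro: asc_subset)
qed

lemma cone_segment:
  assumes "asc K" "x \<in> face_cone K" "y \<in> face_cone K" "\<And>v. x v = 0 \<Longrightarrow> y v = 0" "0 \<le> t" "t \<le> 1"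
  shows "(\<lambda>v. (1 - t) * x v + t * y v) \<in> face_cone K"
proof (rule cone_support_subset[OF assms(1,2)])
  show "0 \<le> (1 - t) * x v + t * y v" for v
    using assms(5,6) cone_nonneg[OF assms(2), of v] cone_nonneg[OF assms(3), of v] by simp
qed (use assms(4) in auto)

lemma closed_cone:
  assumes "asc K"
  shows "closed (face_cone K)"
proof -
  have "face_cone K = (\<Union>F\<in>K. {x. (\<forall>v. 0 \<le> x v) \<and> (\<forall>v. v \<notin> F \<longrightarrow> x v = 0)})" (is "_ = ?R")
  proof
    show "face_cone K \<subseteq> ?R" by (auto simp: face_cone_def)
    show "?R \<subseteq> face_cone K"
    proof
      fix x assume "x \<in> ?R"
      then obtain F where F: "F \<in> K" "\<And>v. 0 \<le> x v" "\<And>v. v \<notin> F \<Longrightarrow> x v = 0" by auto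
      have "{v. x v \<noteq> 0} \<subseteq> F" using F(3) by auto
      then show "x \<in> face_cone K" using F asc_subset[OF assms] by (auto simp: face_cone_def)
    qed
  qed
  moreover have "closed {x::'a \<Rightarrow> real. (\<forall>v. 0 \<le> x v) \<and> (\<forall>v. v \<notin> F \<longrightarrow> x v = 0)}" for F
    by (intro closed_Collect_conj closed_Collect_all closed_Collect_imp closed_Collect_le closed_Collect_eq
        continuous_on_coord continuous_intros) auto
  ultimately show ?thesis using assms by (auto simp: asc_def intro!: closed_UN)
qed

lemma realization_alt:
  assumes "asc K"
  shows "realization K = {x \<in> face_cone K. (\<Sum>v\<in>verts K. x v) = 1}"
proof -
  have "(\<Sum>v | x v \<noteq> 0. x v) = (\<Sum>v\<in>verts K. x v)" if "x \<in> face_cone K" for x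
    using that finite_verts[OF assms] by (intro sum.mono_neutral_left) (auto simp: face_cone_def verts_def)
  then show ?thesis by (auto simp: realization_def face_cone_def)
qed

lemma realization_space_euclidean: "realization_space K = subtopology euclidean (realization K)"
  by (simp add: realization_space_def euclidean_product_topology)

lemma topspace_realization_space [simp]: "topspace (realization_space K) = realization K"
  by (simp add: realization_space_euclidean)

lemma Hausdorff_powertop_real: "Hausdorff_space (powertop_real UNIV)"
  by (simp add: Hausdorff_space_product_topology)

lemma Hausdorff_realization_space: "Hausdorff_space (realization_space K)"
  by (simp add: realization_space_def Hausdorff_space_subtopology Hausdorff_powertop_real)

lemma realization_le_1:
  assumes "asc K" "x \<in> realization K"
  shows "0 \<le> x v" "x v \<le> 1"
proof -
  have x: "x \<in> face_cone K" "(\<Sum>v\<in>verts K. x v) = 1" using assms by (auto simp: realization_alt)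
  show "0 \<le> x v" by (rule cone_nonneg[OF x(1)])
  show "x v \<le> 1"
  proof (cases "v \<in> verts K")
    case True
    then have "x v \<le> (\<Sum>v\<in>verts K. x v)"
      using finite_verts[OF assms(1)] cone_nonneg[OF x(1)] by (intro member_le_sum) auto
    then show ?thesis using x by simp
  qed (use cone_zero_outside[OF x(1)] in auto)
qed

text \<open>A realization is closed in a cube. With Hausdorff targets, compactness turns continuous
  bijections into homeomorphisms and continuous surjections into quotient maps, so no inverse has to
  be shown continuous.\<close>

lemma compact_realization_space:
  fixes K :: "'a set set"
  assumes "asc K"
  shows "compact_space (realization_space K)"
proof -
  have 1: "compactin (powertop_real UNIV) (PiE (UNIV :: 'a set) (\<lambda>_. {0..1}))"
    by (simp add: compactin_PiE)
  have 2: "closedin (powertop_real UNIV) (realization K)"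
  proof -
    have "realization K = face_cone K \<inter> {x. (\<Sum>v\<in>verts K. x v) = 1}" using realization_alt[OF assms] by auto
    moreover have "closed {x::'a \<Rightarrow> real. (\<Sum>v\<in>verts K. x v) = 1}"
      by (intro closed_Collect_eq continuous_intros continuous_on_coord)
    ultimately show ?thesis
      using closed_cone[OF assms] by (simp add: euclidean_product_topology closed_Int flip: closed_closedin)
  qed
  have 3: "realization K \<subseteq> PiE UNIV (\<lambda>_. {0..1})"
    using realization_le_1[OF assms] by (auto simp: PiE_iff)
  have "compactin (powertop_real UNIV) (realization K)"
    by (rule closed_compactin[OF 1 3 2])
  then show ?thesis by (simp add: realization_space_def compact_space_subtopology)
qed

lemma indicator_in_realization:
  assumes "asc J" "v \<in> verts J"
  shows "(indicator {v} :: 'a \<Rightarrow> real) \<in> realization J"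
proof -
  have "{w. (indicator {v} w :: real) \<noteq> 0} = {v}" by (auto simp: indicator_def)
  moreover have "{v} \<in> J" using assms by (auto simp: asc_def verts_def)
  ultimately show ?thesis by (auto simp: realization_def indicator_def)
qed

text \<open>Cells are the classes of points on which the functionals in \<open>H\<close> have the same signs; they are
  ordered by the sets of positive functionals. One point is chosen in every cell and the chains of
  cells span the simplices of the subdivision.\<close>

lemma order_complex:
  fixes K :: "'a set set"
  assumes K: "asc K" and H: "finite H" "\<And>k. k \<in> H \<Longrightarrow> lin k" "\<And>k. k \<in> H \<Longrightarrow> (\<lambda>x. - k x) \<in> H"
    and coordH: "\<And>v. v \<in> verts K \<Longrightarrow> (\<lambda>x. x v) \<in> H"
  obtains J :: "nat set set" and p :: "nat \<Rightarrow> 'a \<Rightarrow> real" where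
    "asc J" "\<forall>i\<in>verts J. p i \<in> face_cone K" "\<forall>i\<in>verts J. (\<Sum>v\<in>verts K. p i v) = 1"
    "bij_betw (\<lambda>c v. \<Sum>i\<in>verts J. c i * p i v) (face_cone J) (face_cone K)"
    "\<forall>T\<in>J. T \<noteq> {} \<longrightarrow> (\<exists>i\<in>T. \<forall>j\<in>T. \<forall>k\<in>H. 0 < k (p j) \<longrightarrow> 0 < k (p i))"
proof -
  let ?V = "verts K"
  have V: "finite ?V" by (rule finite_verts[OF K])
  \<comment> \<open>As \<open>H\<close> is closed under negation, \<open>P x\<close> determines all
    signs at \<open>x\<close>, so the cells correspond to the values of \<open>P\<close>.\<close>
  define P where "P x = {k \<in> H. 0 < k x}" for x
  have PH: "P x \<subseteq> H" for x by (auto simp: P_def)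
  have finP: "finite (P x)" for x using PH H(1) finite_subset by blast
  have P_scale: "P (\<lambda>v. c * x v) = P x" if "c > 0" for c x
  proof -
    have "0 < k (\<lambda>v. c * x v) \<longleftrightarrow> 0 < k x" if "k \<in> H" for k
      using \<open>c > 0\<close> lin_scale[OF H(2)[OF that], of c x] by (simp add: zero_less_mult_iff)
    then show ?thesis unfolding P_def by blast
  qed
  have P_neg: "k x < 0 \<longleftrightarrow> (\<lambda>x. - k x) \<in> P x" if "k \<in> H" for k x
    using H(3)[OF that] by (auto simp: P_def)
  have P_coord: "0 < x v \<longleftrightarrow> (\<lambda>x. x v) \<in> P x" if "v \<in> ?V" for v x
    using coordH[OF that] by (auto simp: P_def)
  define \<C> where "\<C> = P ` (face_cone K - {\<lambda>v. 0})"
  have "\<C> \<subseteq> Pow H" using PH by (auto simp: \<C>_def)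
  then have fin\<C>: "finite \<C>" using H(1) by (meson finite_Pow_iff finite_subset)
  have "\<exists>x. x \<in> face_cone K \<and> (\<Sum>v\<in>?V. x v) = 1 \<and> P x = c" if "c \<in> \<C>" for c
  proof -
    obtain x where x: "x \<in> face_cone K" "x \<noteq> (\<lambda>v. 0)" "P x = c" using \<open>c \<in> \<C>\<close> unfolding \<C>_def by blast
    obtain v where v: "x v \<noteq> 0" using x(2) by blast
    have "v \<in> ?V" using v x(1) cone_zero_outside by metis
    then have s: "(\<Sum>v\<in>?V. x v) > 0"
      using V v cone_nonneg[OF x(1)] by (intro sum_pos2[of _ v]) (auto simp: less_le)
    define r where "r = 1 / (\<Sum>v\<in>?V. x v)"
    have r: "r > 0" using s by (simp add: r_def)
    let ?y = "\<lambda>v. r * x v"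
    have "?y \<in> face_cone K" by (rule cone_scale[OF x(1) r])
    moreover have "P ?y = c" using P_scale[OF r] x(3) by simp
    moreover have "(\<Sum>v\<in>?V. ?y v) = 1" using s by (simp add: r_def flip: sum_divide_distrib)
    ultimately show ?thesis by blast
  qed
  then obtain pt where pt: "\<And>c. c \<in> \<C> \<Longrightarrow> pt c \<in> face_cone K" "\<And>c. c \<in> \<C> \<Longrightarrow> (\<Sum>v\<in>?V. pt c v) = 1"
    "\<And>c. c \<in> \<C> \<Longrightarrow> P (pt c) = c" by metis
  obtain \<iota> :: "(('a \<Rightarrow> real) \<Rightarrow> real) set \<Rightarrow> nat" where \<iota>: "inj_on \<iota> \<C>"
    using fin\<C> finite_imp_inj_to_nat_seg by metis
  define I where "I = \<iota> ` \<C>"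
  define p where "p i = pt (inv_into \<C> \<iota> i)" for i
  have finI: "finite I" using fin\<C> by (simp add: I_def)
  have pK: "p i \<in> face_cone K" and psum: "(\<Sum>v\<in>?V. p i v) = 1" if "i \<in> I" for i
    using that pt \<iota> by (auto simp: I_def p_def)
  have pinj: "i = j" if "i \<in> I" "j \<in> I" "P (p i) = P (p j)" for i j
    using that pt(3) \<iota> by (auto simp: I_def p_def)
  have pex: "\<exists>i\<in>I. P (p i) = P x" if "x \<in> face_cone K" "x \<noteq> (\<lambda>v. 0)" for x
    using that pt(3) \<iota> by (intro bexI[where x="\<iota> (P x)"]) (auto simp: I_def p_def \<C>_def)
  define J where "J = {S. S \<subseteq> I \<and> (\<forall>i\<in>S. \<forall>j\<in>S. P (p i) \<subseteq> P (p j) \<or> P (p j) \<subseteq> P (p i))}"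
  have J: "asc J" unfolding asc_def
  proof (intro conjI ballI allI impI)
    have "J \<subseteq> Pow I" by (auto simp: J_def)
    then show "finite J" using finI by (meson finite_Pow_iff finite_subset)
    show "finite F" if "F \<in> J" for F using that finI by (auto simp: J_def intro: finite_subset)
  qed (unfold J_def, blast+)
  have vJ: "verts J = I"
  proof
    show "I \<subseteq> verts J" by (auto simp: verts_def J_def intro!: exI[of _ "{_}"])
  qed (auto simp: verts_def J_def)
  define \<Phi> where "\<Phi> c = (\<lambda>v. \<Sum>i\<in>I. c i * p i v)" for c
  have top: "\<exists>i\<in>T. \<forall>j\<in>T. P (p j) \<subseteq> P (p i)" if "T \<in> J" "T \<noteq> {}" for T
  proof -
    have "finite T" using that(1) J by (auto simp: asc_def)
    let ?f = "\<lambda>j. card (P (p j))"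
    have fT: "finite (?f ` T)" "?f ` T \<noteq> {}" using \<open>finite T\<close> \<open>T \<noteq> {}\<close> by auto
    obtain i where i1: "i \<in> T" "Max (?f ` T) = ?f i" using Max_in[OF fT] by (elim imageE)
    have i: "?f j \<le> ?f i" if "j \<in> T" for j
      using Max_ge[OF fT(1) imageI[OF that]] unfolding i1(2) .
    have "P (p j) \<subseteq> P (p i)" if "j \<in> T" for j
    proof -
      have "P (p j) \<subseteq> P (p i) \<or> P (p i) \<subseteq> P (p j)" using \<open>T \<in> J\<close> i1(1) that unfolding J_def by blast
      then show ?thesis using card_seteq[OF finP _ i[OF that]] by blast
    qed
    then show ?thesis using i1(1) by blast
  qed
  have k\<Phi>: "k (\<Phi> c) = (\<Sum>i\<in>I. c i * k (p i))" if "k \<in> H" for k c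
  proof -
    have "k (\<Phi> c) = (\<Sum>i\<in>I. k (\<lambda>v. c i * p i v))"
      unfolding \<Phi>_def by (rule lin_sum[OF H(2)[OF that] finI])
    moreover have "k (\<lambda>v. c i * p i v) = c i * k (p i)" for i by (rule lin_scale[OF H(2)[OF that]])
    ultimately show ?thesis by simp
  qed
  \<comment> \<open>A combination of chain points lies in the cell of its largest member. Terms
    cannot cancel: a functional negative at a smaller point has its negation positive there, hence
    also at the largest point.\<close>
  have P\<Phi>: "P (\<Phi> c) = P (p i)" if c: "c \<in> face_cone J" "c i \<noteq> 0" "\<And>j. c j \<noteq> 0 \<Longrightarrow> P (p j) \<subseteq> P (p i)" for c i
  proof -
    have iI: "i \<in> I" using c(1,2) cone_zero_outside vJ by metis
    have c0: "0 \<le> c j" for j using cone_nonneg[OF c(1)] .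
    have "k \<in> P (\<Phi> c)" if k: "k \<in> P (p i)" for k
    proof -
      have kH: "k \<in> H" using k PH by blast
      have nn: "0 \<le> c j * k (p j)" for j
      proof (cases "c j = 0")
        case False
        have "\<not> k (p j) < 0"
        proof
          assume "k (p j) < 0"
          then have "(\<lambda>x. - k x) \<in> P (p i)" using c(3)[OF False] P_neg[OF kH] by blast
          then show False using k by (auto simp: P_def)
        qed
        then show ?thesis using c0 by simp
      qed simp
      have "0 < c i * k (p i)" using k c0[of i] c(2) by (auto simp: P_def)
      then have "0 < k (\<Phi> c)" unfolding k\<Phi>[OF kH] using nn iI finI by (intro sum_pos2[of _ i]) auto
      then show ?thesis using kH by (simp add: P_def)
    qed
    moreover have "k \<in> P (p i)" if k: "k \<in> P (\<Phi> c)" for k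
    proof -
      have kH: "k \<in> H" using k PH by blast
      have "0 < (\<Sum>i\<in>I. c i * k (p i))" using k by (simp add: P_def flip: k\<Phi>[OF kH])
      then obtain j where "j \<in> I" "0 < c j * k (p j)" by (meson not_le sum_nonpos)
      then have "c j \<noteq> 0" "k \<in> P (p j)" using kH c0[of j] by (auto simp: P_def zero_less_mult_iff)
      then show ?thesis using c(3) by blast
    qed
    ultimately show ?thesis by blast
  qed
  have supp_top: "\<exists>i. c i \<noteq> 0 \<and> (\<forall>j. c j \<noteq> 0 \<longrightarrow> P (p j) \<subseteq> P (p i))" if "c \<in> face_cone J" "c \<noteq> (\<lambda>i. 0)" for c
    using top[of "{i. c i \<noteq> 0}"] that by (auto simp: face_cone_def fun_eq_iff)
  have \<Phi>0: "\<Phi> (\<lambda>i. 0) = (\<lambda>v. 0)" by (simp add: \<Phi>_def)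
  have \<Phi>nn: "0 \<le> \<Phi> c v" if "c \<in> face_cone J" for c v
    unfolding \<Phi>_def using cone_nonneg[OF that] cone_nonneg[OF pK] by (auto intro!: sum_nonneg)
  have \<Phi>out: "\<Phi> c v = 0" if "v \<notin> ?V" for c v
    unfolding \<Phi>_def using cone_zero_outside[OF pK that] by simp
  have \<Phi>K: "\<Phi> c \<in> face_cone K" if c: "c \<in> face_cone J" for c
  proof (cases "c = (\<lambda>i. 0)")
    case False
    obtain i where i: "c i \<noteq> 0" "\<And>j. c j \<noteq> 0 \<Longrightarrow> P (p j) \<subseteq> P (p i)" using supp_top[OF c False] by blast
    have iI: "i \<in> I" using c i(1) cone_zero_outside vJ by metis
    show ?thesis
    proof (rule cone_support_subset[OF K pK[OF iI] \<Phi>nn[OF c]])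
      show "\<Phi> c v = 0" if "p i v = 0" for v
      proof (cases "v \<in> ?V")
        case True
        then show ?thesis using P_coord[OF True] P\<Phi>[OF c i] that \<Phi>nn[OF c, of v] by (metis less_le)
      qed (rule \<Phi>out)
    qed
  qed (simp add: \<Phi>0 zero_in_cone[OF K])
  have surj: "\<exists>c\<in>face_cone J. \<Phi> c = x \<and> (\<forall>i. c i \<noteq> 0 \<longrightarrow> P (p i) \<subseteq> P x)" if "x \<in> face_cone K" for x
    using that
  proof (induction "card (P x)" arbitrary: x rule: less_induct)
    case less
    show ?case
    proof (cases "x = (\<lambda>v. 0)")
      case True
      then show ?thesis using \<Phi>0 zero_in_cone[OF J] by (intro bexI[where x="\<lambda>i. 0"]) auto
    next
      case False
      obtain i where i: "i \<in> I" "P (p i) = P x" using pex[OF less.prems False] by blast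
      obtain v where v: "x v \<noteq> 0" using False by blast
      have vV: "v \<in> ?V" using v less.prems cone_zero_outside by metis
      have "0 < x v" using v cone_nonneg[OF less.prems, of v] by simp
      then have ne: "P x \<noteq> {}" using P_coord[OF vV] by blast
      \<comment> \<open>The largest multiple of \<open>p i\<close> that can be subtracted from
        \<open>x\<close> while all functionals positive at \<open>x\<close> stay nonnegative. Some
        \<open>k0\<close> then vanishes, so the remainder lies in a strictly smaller cell and the
        induction hypothesis represents it.\<close>
      define t where "t = Min ((\<lambda>k. k x / k (p i)) ` P x)"
      have t_le: "t \<le> k x / k (p i)" if "k \<in> P x" for k
        unfolding t_def using finP that by auto
      have "t \<in> (\<lambda>k. k x / k (p i)) ` P x" unfolding t_def using finP ne by (intro Min_in) auto
      then obtain k0 where k0: "k0 \<in> P x" "t = k0 x / k0 (p i)" by auto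
      have pos: "0 < k x" "0 < k (p i)" if "k \<in> P x" for k
        using that i(2) by (auto simp: P_def)
      have t0: "0 < t" using k0 pos by simp
      define y where "y = (\<lambda>v. x v - t * p i v)"
      have ky: "k y = k x - t * k (p i)" if "k \<in> H" for k
        using linD[OF H(2)[OF that], of 1 x "-t" "p i"] by (simp add: y_def)
      have ky_nn: "0 \<le> k y" if "k \<in> P x" for k
        using t_le[OF that] pos[OF that] that PH by (subst ky) (auto simp: field_simps)
      have ky_zero: "k y = 0" if "k \<in> H" "k x = 0" for k
      proof -
        have "k \<notin> P x" "(\<lambda>x. - k x) \<notin> P x" using that by (auto simp: P_def)
        then have "k \<notin> P (p i)" "(\<lambda>x. - k x) \<notin> P (p i)" using i(2) by simp_all
        moreover have "\<not> 0 < k (p i)" using calculation(1) that(1) by (simp add: P_def)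
        moreover have "\<not> k (p i) < 0" using calculation(2) P_neg[OF that(1)] by blast
        ultimately show ?thesis using ky[OF that(1)] that(2) by simp
      qed
      have sub: "P y \<subseteq> P x"
      proof
        fix k assume k: "k \<in> P y"
        then have kH: "k \<in> H" "0 < k y" by (auto simp: P_def)
        have "k x \<noteq> 0" using ky_zero[OF kH(1)] kH(2) by auto
        moreover have "\<not> k x < 0"
        proof
          assume "k x < 0"
          then have "(\<lambda>x. - k x) \<in> P x" using P_neg[OF kH(1)] by blast
          then show False using ky_nn[of "\<lambda>x. - k x"] kH(2) by simp
        qed
        ultimately show "k \<in> P x" using kH(1) by (auto simp: P_def)
      qed
      have "k0 y = 0" using k0 pos[OF k0(1)] ky[of k0] PH by auto
      then have "k0 \<notin> P y" by (simp add: P_def)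
      then have psub: "P y \<subset> P x" using sub k0(1) by blast
      have y_coord: "0 \<le> y v \<and> (x v = 0 \<longrightarrow> y v = 0)" for v
      proof (cases "v \<in> ?V")
        case True
        have "0 \<le> y v" if "x v \<noteq> 0"
        proof -
          have "0 < x v" using cone_nonneg[OF less.prems, of v] that by simp
          then show ?thesis using ky_nn[OF iffD1[OF P_coord[OF True]]] by blast
        qed
        moreover have "y v = 0" if "x v = 0" using ky_zero[OF coordH[OF True]] that .
        ultimately show ?thesis by force
      next
        case False
        then show ?thesis
          using cone_zero_outside[OF less.prems False] cone_zero_outside[OF pK[OF i(1)] False] by (simp add: y_def)
      qed
      have yK: "y \<in> face_cone K" by (rule cone_support_subset[OF K less.prems]) (use y_coord in auto)
      obtain c where c: "c \<in> face_cone J" "\<Phi> c = y" "\<And>j. c j \<noteq> 0 \<Longrightarrow> P (p j) \<subseteq> P y"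
        using less.hyps[OF psubset_card_mono[OF finP psub] yK] by blast
      have ci: "c i = 0" using c(3)[of i] i(2) psub by blast
      define c' where "c' = c(i := t)"
      have "{j. c' j \<noteq> 0} = insert i {j. c j \<noteq> 0}" using t0 by (auto simp: c'_def)
      moreover have "insert i {j. c j \<noteq> 0} \<in> J"
        using c(1,3) i sub by (auto simp: face_cone_def J_def)
      ultimately have c'J: "c' \<in> face_cone J" using t0 c(1) by (auto simp: face_cone_def c'_def)
      have "\<Phi> c' v = x v" for v
      proof -
        have "\<Phi> c' v = t * p i v + (\<Sum>j\<in>I - {i}. c j * p j v)"
          unfolding \<Phi>_def using finI i(1)
          by (subst sum.remove[of _ i]) (auto simp: c'_def intro!: sum.cong)
        also have "(\<Sum>j\<in>I - {i}. c j * p j v) = \<Phi> c v"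
          unfolding \<Phi>_def using finI i(1) ci by (subst (2) sum.remove[of _ i]) auto
        finally show ?thesis using c(2) by (simp add: y_def)
      qed
      moreover have "P (p j) \<subseteq> P x" if "c' j \<noteq> 0" for j
        using that c(3)[of j] i(2) sub by (cases "j = i") (auto simp: c'_def)
      ultimately show ?thesis using c'J by blast
    qed
  qed
  have sum\<Phi>: "(\<Sum>v\<in>?V. \<Phi> c v) = (\<Sum>i\<in>I. c i)" for c
    unfolding \<Phi>_def by (subst sum.swap) (simp add: psum flip: sum_distrib_left)
  have \<Phi>eq0: "c = (\<lambda>i. 0)" if "c \<in> face_cone J" "\<Phi> c = (\<lambda>v. 0)" for c
  proof
    fix i
    have "(\<Sum>i\<in>I. c i) = 0" using sum\<Phi>[of c] that(2) by simp
    then have "\<forall>i\<in>I. c i = 0" using finI cone_nonneg[OF that(1)] by (subst (asm) sum_nonneg_eq_0_iff) auto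
    then show "c i = 0" using cone_zero_outside[OF that(1)] vJ by (cases "i \<in> I") auto
  qed
  \<comment> \<open>The coefficient of the top point is unique: removing \<open>c i\<close> from
    both representations moves the first into a smaller cell, whereas the second would stay in the
    top cell if \<open>c' i\<close> were larger than \<open>c i\<close>. The rest is the induction
    hypothesis.\<close>
  have inj_aux: "c = c'"
    if IH: "\<And>d d'. card (P (\<Phi> d)) < card (P (\<Phi> c)) \<Longrightarrow> d \<in> face_cone J \<Longrightarrow> d' \<in> face_cone J \<Longrightarrow> \<Phi> d = \<Phi> d' \<Longrightarrow> d = d'"
      and c: "c \<in> face_cone J" "c' \<in> face_cone J" "\<Phi> c = \<Phi> c'" and i: "c i \<noteq> 0" "\<And>j. c j \<noteq> 0 \<Longrightarrow> P (p j) \<subseteq> P (p i)"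
      and i': "c' i \<noteq> 0" "\<And>j. c' j \<noteq> 0 \<Longrightarrow> P (p j) \<subseteq> P (p i)" and le: "c i \<le> c' i" for c c' i
  proof -
    have iI: "i \<in> I" using c(1) i(1) cone_zero_outside vJ by metis
    define d where "d = c(i := 0)"
    define d' where "d' = c'(i := c' i - c i)"
    have dJ: "d \<in> face_cone J" by (rule cone_support_subset[OF J c(1)]) (use cone_nonneg[OF c(1)] in \<open>auto simp: d_def\<close>)
    have d'J: "d' \<in> face_cone J"
      by (rule cone_support_subset[OF J c(2)]) (use cone_nonneg[OF c(2)] le i' in \<open>auto simp: d'_def\<close>)
    have "\<Phi> d v = \<Phi> c v - c i * p i v" for v
      unfolding \<Phi>_def using finI iI
      by (subst (1 2) sum.remove[of _ i]) (auto simp: d_def intro!: sum.cong)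
    moreover have "\<Phi> d' v = \<Phi> c' v - c i * p i v" for v
      unfolding \<Phi>_def using finI iI
      by (subst (1 2) sum.remove[of _ i]) (auto simp: d'_def algebra_simps intro!: sum.cong)
    ultimately have dd': "\<Phi> d = \<Phi> d'" using c(3) by auto
    have Pc: "P (\<Phi> c) = P (p i)" by (rule P\<Phi>[OF c(1) i])
    have small: "P (\<Phi> d) \<subset> P (p i)"
    proof (cases "d = (\<lambda>i. 0)")
      case True
      have "P (\<Phi> d) = {}" using H(2) by (auto simp: True \<Phi>0 P_def lin_zero)
      moreover have "P (p i) \<noteq> {}"
      proof
        assume e: "P (p i) = {}"
        have "p i v = 0" if "v \<in> ?V" for v
          using e P_coord[OF that, of "p i"] cone_nonneg[OF pK[OF iI], of v] by auto
        then show False using psum[OF iI] by simp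
      qed
      ultimately show ?thesis by blast
    next
      case False
      obtain j where j: "d j \<noteq> 0" "\<And>l. d l \<noteq> 0 \<Longrightarrow> P (p l) \<subseteq> P (p j)" using supp_top[OF dJ False] by blast
      have "j \<noteq> i" "c j \<noteq> 0" using j(1) by (auto simp: d_def split: if_splits)
      moreover have "j \<in> I" using dJ j(1) cone_zero_outside vJ by metis
      ultimately show ?thesis using P\<Phi>[OF dJ j] i(2)[of j] pinj[OF _ iI] by blast
    qed
    have "c i = c' i"
    proof (rule ccontr)
      assume "c i \<noteq> c' i"
      then have "d' i \<noteq> 0" by (simp add: d'_def)
      moreover have "P (p j) \<subseteq> P (p i)" if "d' j \<noteq> 0" for j
        using that i'(2)[of j] by (cases "j = i") (auto simp: d'_def)
      ultimately have "P (\<Phi> d') = P (p i)" by (intro P\<Phi>[OF d'J]) auto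
      then show False using small dd' by simp
    qed
    moreover have "d = d'"
      using IH[OF _ dJ d'J dd'] psubset_card_mono[OF finP small] Pc by simp
    ultimately show ?thesis
      unfolding d_def d'_def by (metis (no_types, lifting) diff_self fun_upd_triv fun_upd_upd)
  qed
  have inj: "c = c'" if "c \<in> face_cone J" "c' \<in> face_cone J" "\<Phi> c = \<Phi> c'" for c c'
    using that
  proof (induction "card (P (\<Phi> c))" arbitrary: c c' rule: less_induct)
    case less
    show ?case
    proof (cases "c = (\<lambda>i. 0) \<or> c' = (\<lambda>i. 0)")
      case True
      then show ?thesis using \<Phi>eq0 \<Phi>0 less.prems by metis
    next
      case False
      obtain i where i: "c i \<noteq> 0" "\<And>j. c j \<noteq> 0 \<Longrightarrow> P (p j) \<subseteq> P (p i)"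
        using supp_top[OF less.prems(1)] False by blast
      obtain i' where i': "c' i' \<noteq> 0" "\<And>j. c' j \<noteq> 0 \<Longrightarrow> P (p j) \<subseteq> P (p i')"
        using supp_top[OF less.prems(2)] False by blast
      have "P (p i) = P (p i')" using P\<Phi>[OF less.prems(1) i] P\<Phi>[OF less.prems(2) i'] less.prems(3) by simp
      moreover have "i \<in> I" "i' \<in> I" using less.prems(1,2) i(1) i'(1) cone_zero_outside vJ by metis+
      ultimately have ii': "i' = i" using pinj by simp
      show ?thesis
      proof (cases "c i \<le> c' i")
        case True
        show ?thesis
          by (rule inj_aux[OF less.hyps less.prems i i'[unfolded ii'] True])
      next
        case False
        have "c' = c"
          by (rule inj_aux[OF less.hyps less.prems(2,1) less.prems(3)[symmetric] i'[unfolded ii'] i])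
            (use False less.prems(3) in auto)
        then show ?thesis by simp
      qed
    qed
  qed
  show ?thesis
  proof (rule that[of J p])
    show "bij_betw (\<lambda>c v. \<Sum>i\<in>verts J. c i * p i v) (face_cone J) (face_cone K)"
      unfolding vJ \<Phi>_def[symmetric] bij_betw_def inj_on_def using inj surj \<Phi>K by blast
    show "\<forall>T\<in>J. T \<noteq> {} \<longrightarrow> (\<exists>i\<in>T. \<forall>j\<in>T. \<forall>k\<in>H. 0 < k (p j) \<longrightarrow> 0 < k (p i))"
      using top unfolding P_def by blast
  qed (use J vJ pK psum in auto)
qed

lemma pl_map_zero:
  assumes "pl_map X F" "(\<lambda>v. 0) \<in> X"
  shows "F (\<lambda>v. 0) = (\<lambda>b. 0)"
proof
  fix b
  obtain G where G: "\<forall>g\<in>G. lin g" "\<forall>x\<in>X. \<exists>g\<in>G. F x b = g x"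
    using assms(1) unfolding pl_map_def pl_fun_def by blast
  obtain g where "g \<in> G" "F (\<lambda>v. 0) b = g (\<lambda>v. 0)" using G(2) assms(2) by blast
  then show "F (\<lambda>v. 0) b = 0" using lin_zero G(1) by auto
qed

lemma pl_iso_bij_betw: "pl_iso X Y F F' \<Longrightarrow> bij_betw F X Y"
  unfolding pl_iso_def by (intro bij_betw_byWitness[where f'=F']) auto

text \<open>Each simplex of the subdivision lies in the closure of one cell.\<close>

lemma pl_map_subdivision:
  fixes K :: "'a set set" and F :: "('a \<Rightarrow> real) \<Rightarrow> 'b \<Rightarrow> real"
  assumes K: "asc K" and F: "pl_map (face_cone K) F" and W: "finite W" "F ` face_cone K \<subseteq> coords W"
  obtains J :: "nat set set" and p :: "nat \<Rightarrow> 'a \<Rightarrow> real" where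
    "asc J" "\<forall>i\<in>verts J. p i \<in> face_cone K" "\<forall>i\<in>verts J. (\<Sum>v\<in>verts K. p i v) = 1"
    "bij_betw (\<lambda>c v. \<Sum>i\<in>verts J. c i * p i v) (face_cone J) (face_cone K)"
    "\<forall>T\<in>J. \<exists>G\<in>K. \<forall>i\<in>T. \<forall>v. p i v \<noteq> 0 \<longrightarrow> v \<in> G"
    "\<forall>c\<in>face_cone J. F (\<lambda>v. \<Sum>i\<in>verts J. c i * p i v) = (\<lambda>b. \<Sum>i\<in>verts J. c i * F (p i) b)"
proof -
  let ?V = "verts K"
  have V: "finite ?V" by (rule finite_verts[OF K])
  have "\<exists>H. linear_on_cells (face_cone K) H (\<lambda>x. F x b)" for b
    by (rule pl_fun_linear_on_cells[OF _ cone_coords V]) (use F in \<open>simp add: pl_map_def\<close>)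
  then obtain H where H: "\<And>b. linear_on_cells (face_cone K) (H b) (\<lambda>x. F x b)" by metis
  have H12: "finite (H b)" "\<And>k. k \<in> H b \<Longrightarrow> lin k" for b
    using H[of b] by (auto simp: linear_on_cells_def)
  \<comment> \<open>Adding the vertex coordinates makes the support constant on a cell, so that
    every cell lies in one face of \<open>K\<close>.\<close>
  define H0 where "H0 = (\<Union>b\<in>W. H b) \<union> (\<lambda>v x. x v) ` ?V"
  define H1 where "H1 = H0 \<union> (\<lambda>k x. - k x) ` H0"
  have H0: "finite H0" "\<And>k. k \<in> H0 \<Longrightarrow> lin k"
    using H12 W(1) V by (auto simp: H0_def lin_coord)
  have lin_neg: "lin (\<lambda>x. - k x)" if "lin k" for k :: "('a \<Rightarrow> real) \<Rightarrow> real"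
    using lin_linear[OF that that, of "-1" 0] by simp
  have H1a: "finite H1" using H0(1) by (simp add: H1_def)
  have H1b: "lin k" if "k \<in> H1" for k
    using that H0(2) lin_neg unfolding H1_def by (elim UnE imageE) (simp_all only:)
  have H1c: "(\<lambda>x. - k x) \<in> H1" if "k \<in> H1" for k
    using that unfolding H1_def
  proof (elim UnE imageE)
    fix k' assume k': "k = (\<lambda>x. - k' x)" "k' \<in> H0"
    have "(\<lambda>x. - k x) = k'" by (simp add: k'(1))
    then show "(\<lambda>x. - k x) \<in> H0 \<union> (\<lambda>k x. - k x) ` H0" using k'(2) by simp
  qed blast
  have H1d: "(\<lambda>x. x v) \<in> H1" if "v \<in> ?V" for v
    using that unfolding H1_def H0_def by blast
  note H1 = H1a H1b H1c H1d
  obtain J :: "nat set set" and p where J0: "asc J" "\<forall>i\<in>verts J. p i \<in> face_cone K"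
    "\<forall>i\<in>verts J. (\<Sum>v\<in>verts K. p i v) = 1"
    "bij_betw (\<lambda>c v. \<Sum>i\<in>verts J. c i * p i v) (face_cone J) (face_cone K)"
    "\<forall>T\<in>J. T \<noteq> {} \<longrightarrow> (\<exists>i\<in>T. \<forall>j\<in>T. \<forall>k\<in>H1. 0 < k (p j) \<longrightarrow> 0 < k (p i))"
    by (rule order_complex[OF K H1])
  note J = J0(1) bspec[OF J0(2)] bspec[OF J0(3)] J0(4) bspec[OF J0(5), THEN mp]
  have finJ: "finite (verts J)" by (rule finite_verts[OF J(1)])
  have TJ: "i \<in> verts J" if "i \<in> T" "T \<in> J" for i T using that by (auto simp: verts_def)
  have zero: "p j v = 0" if "i \<in> verts J" "j \<in> verts J" "\<forall>k\<in>H1. 0 < k (p j) \<longrightarrow> 0 < k (p i)" "p i v = 0" for i j v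
  proof (cases "v \<in> ?V")
    case True
    then have "\<not> 0 < p j v" using that(3,4) H1(4)[OF True] by force
    then show ?thesis using cone_nonneg[OF J(2)[OF that(2)], of v] by simp
  qed (rule cone_zero_outside[OF J(2)[OF that(2)]])
  have cell: "\<exists>G\<in>K. \<forall>i\<in>T. \<forall>v. p i v \<noteq> 0 \<longrightarrow> v \<in> G" if T: "T \<in> J" for T
  proof (cases "T = {}")
    case True
    then show ?thesis using K by (auto simp: asc_def)
  next
    case False
    obtain i where i: "i \<in> T" "\<forall>j\<in>T. \<forall>k\<in>H1. 0 < k (p j) \<longrightarrow> 0 < k (p i)" using J(5)[OF T False] by blast
    have "{v. p i v \<noteq> 0} \<in> K" using J(2)[OF TJ[OF i(1) T]] by (simp add: face_cone_def)
    moreover have "v \<in> {v. p i v \<noteq> 0}" if "j \<in> T" "p j v \<noteq> 0" for j v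
      using zero[OF TJ[OF i(1) T] TJ[OF that(1) T]] i(2) that by auto
    ultimately show ?thesis by blast
  qed
  let ?\<Phi> = "\<lambda>c v. \<Sum>i\<in>verts J. c i * p i v"
  have linear: "F (?\<Phi> c) b = (\<Sum>i\<in>verts J. c i * F (p i) b)" if c: "c \<in> face_cone J" for c b
  proof (cases "c = (\<lambda>i. 0)")
    case True
    then show ?thesis using pl_map_zero[OF F zero_in_cone[OF K]] by simp
  next
    case False
    have \<Phi>K: "?\<Phi> c \<in> face_cone K" using J(4) c by (auto simp: bij_betw_def)
    let ?T = "{i. c i \<noteq> 0}"
    have T: "?T \<in> J" "?T \<noteq> {}" using c False by (auto simp: face_cone_def)
    obtain i where i: "i \<in> ?T" "\<forall>j\<in>?T. \<forall>k\<in>H1. 0 < k (p j) \<longrightarrow> 0 < k (p i)"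
      using J(5)[OF T] by blast
    have iJ: "i \<in> verts J" by (rule TJ[OF i(1) T(1)])
    have pi: "p i \<in> face_cone K" by (rule J(2)[OF iJ])
    show ?thesis
    proof (cases "b \<in> W")
      case True
      \<comment> \<open>A single functional, attached to the top point of the simplex, computes
        coordinate \<open>b\<close> of \<open>F\<close> at all vertices of the simplex and at their
        combination; linearity follows.\<close>
      obtain g where g: "lin g" "agrees_below (face_cone K) (H b) (\<lambda>x. F x b) (p i) g"
        using H[of b] pi unfolding linear_on_cells_def by blast
      have Hb: "k \<in> H1" if "k \<in> H b" for k using that True by (auto simp: H1_def H0_def)
      have gp: "F (p j) b = g (p j)" if "c j \<noteq> 0" for j
      proof (rule agrees_belowD[OF g(2)])
        have jT: "j \<in> ?T" using that by simp
        have jJ: "j \<in> verts J" by (rule TJ[OF jT T(1)])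
        show pj: "p j \<in> face_cone K" by (rule J(2)[OF jJ])
        show "(\<lambda>v. (1 - t) * p i v + t * p j v) \<in> face_cone K" if "0 \<le> t" "t \<le> 1" for t
          using zero[OF iJ jJ] i(2) jT by (intro cone_segment[OF K pi pj _ that]) auto
        show "0 < k (p i)" if "k \<in> H b" "0 < k (p j)" for k
          using i(2) jT Hb[OF that(1)] that(2) by blast
      qed
      have sumg: "g (?\<Phi> c) = (\<Sum>j\<in>verts J. c j * g (p j))" if "lin g" for g
      proof -
        have "g (?\<Phi> c) = (\<Sum>j\<in>verts J. g (\<lambda>v. c j * p j v))" by (rule lin_sum[OF that finJ])
        moreover have "g (\<lambda>v. c j * p j v) = c j * g (p j)" for j by (rule lin_scale[OF that])
        ultimately show ?thesis by simp
      qed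
      have "F (?\<Phi> c) b = g (?\<Phi> c)"
      proof (rule agrees_belowD[OF g(2) \<Phi>K])
        show "(\<lambda>v. (1 - t) * p i v + t * ?\<Phi> c v) \<in> face_cone K" if "0 \<le> t" "t \<le> 1" for t
        proof (rule cone_segment[OF K pi \<Phi>K _ that])
          fix v assume v: "p i v = 0"
          have "c j * p j v = 0" if "j \<in> verts J" for j
            using zero[OF iJ that _ v] i(2) by (cases "c j = 0") auto
          then show "?\<Phi> c v = 0" by (rule sum.neutral[OF ballI])
        qed
        fix k assume k: "k \<in> H b" "0 < k (?\<Phi> c)"
        then have "0 < (\<Sum>j\<in>verts J. c j * k (p j))" using sumg[OF H12(2)[OF k(1)]] by simp
        then obtain j where "0 < c j * k (p j)" by (meson not_le sum_nonpos)
        then have "c j \<noteq> 0" "0 < k (p j)" using cone_nonneg[OF c, of j] by (auto simp: zero_less_mult_iff)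
        then show "0 < k (p i)" using i(2) Hb[OF k(1)] by blast
      qed
      also have "\<dots> = (\<Sum>j\<in>verts J. c j * F (p j) b)"
        unfolding sumg[OF g(1)] by (intro sum.cong refl) (use gp in fastforce)
      finally show ?thesis .
    next
      case False
      then have "F x b = 0" if "x \<in> face_cone K" for x using that W(2) by (auto simp: coords_def)
      then show ?thesis using \<Phi>K J(2) by simp
    qed
  qed
  have cells: "\<forall>T\<in>J. \<exists>G\<in>K. \<forall>i\<in>T. \<forall>v. p i v \<noteq> 0 \<longrightarrow> v \<in> G"
    by (intro ballI cell)
  have lins: "\<forall>c\<in>face_cone J. F (?\<Phi> c) = (\<lambda>b. \<Sum>i\<in>verts J. c i * F (p i) b)"
    by (intro ballI ext) (rule linear)
  show ?thesis
    by (rule that[of J p]) (fact J0(1) J0(2) J0(3) J0(4) cells lins)+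
qed

text \<open>As the \<open>q i\<close> have coordinate sum 1, the map preserves coordinate sums, so
  the bijection of cones restricts to the realizations; compactness supplies the rest.\<close>

lemma homeomorphic_map_realization:
  assumes J: "asc J" and L: "asc L" and bij: "bij_betw (\<lambda>c v. \<Sum>i\<in>verts J. c i * q i v) (face_cone J) (face_cone L)"
    and q: "\<And>i. i \<in> verts J \<Longrightarrow> (\<Sum>v\<in>verts L. q i v) = 1"
  shows "homeomorphic_map (realization_space J) (realization_space L) (\<lambda>c v. \<Sum>i\<in>verts J. c i * q i v)"
proof -
  let ?\<Phi> = "\<lambda>c v. \<Sum>i\<in>verts J. c i * q i v"
  have s: "(\<Sum>v\<in>verts L. ?\<Phi> c v) = (\<Sum>i\<in>verts J. c i)" for c
    by (subst sum.swap) (simp add: q flip: sum_distrib_left)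
  have img: "?\<Phi> ` realization J = realization L"
  proof
    show "?\<Phi> ` realization J \<subseteq> realization L"
      using bij s unfolding realization_alt[OF J] realization_alt[OF L] bij_betw_def by auto
    show "realization L \<subseteq> ?\<Phi> ` realization J"
    proof
      fix y assume y: "y \<in> realization L"
      then obtain c where "c \<in> face_cone J" "y = ?\<Phi> c"
        using bij unfolding realization_alt[OF L] bij_betw_def by blast
      moreover from this have "(\<Sum>i\<in>verts J. c i) = 1" using y s[of c] by (simp add: realization_alt[OF L])
      ultimately show "y \<in> ?\<Phi> ` realization J" by (auto simp: realization_alt[OF J])
    qed
  qed
  show ?thesis
  proof (rule continuous_imp_homeomorphic_map)
    have "continuous_on (realization J) ?\<Phi>"
      by (intro continuous_on_coordinatewise_then_product continuous_intros continuous_on_coord)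
    then show "continuous_map (realization_space J) (realization_space L) ?\<Phi>"
      using img by (auto simp: realization_space_euclidean)
    show "inj_on ?\<Phi> (topspace (realization_space J))"
      using bij by (auto simp: bij_betw_def realization_alt[OF J] inj_on_def)
  qed (use img compact_realization_space[OF J] Hausdorff_realization_space in auto)
qed

text \<open>A positively homogeneous piecewise linear homeomorphism of cones need not preserve the sum of the
  coordinates; rescaling the images of the vertices of the subdivision repairs this.\<close>

theorem pl_iso_imp_pl_homeomorphic:
  fixes K :: "'a set set" and L :: "'b set set"
  assumes K: "asc K" and L: "asc L" and iso: "pl_iso (face_cone K) (face_cone L) F F'"
  shows "pl_homeomorphic K L"
proof -
  have F: "pl_map (face_cone K) F" "F ` face_cone K \<subseteq> face_cone L" "\<And>x. x \<in> face_cone K \<Longrightarrow> F' (F x) = x"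
    and F': "pl_map (face_cone L) F'"
    using iso by (auto simp: pl_iso_def)
  have FW: "F ` face_cone K \<subseteq> coords (verts L)" using F(2) cone_coords by blast
  obtain J :: "nat set set" and p where J0: "asc J" "\<forall>i\<in>verts J. p i \<in> face_cone K"
    "\<forall>i\<in>verts J. (\<Sum>v\<in>verts K. p i v) = 1"
    "bij_betw (\<lambda>c v. \<Sum>i\<in>verts J. c i * p i v) (face_cone J) (face_cone K)"
    "\<forall>T\<in>J. \<exists>G\<in>K. \<forall>i\<in>T. \<forall>v. p i v \<noteq> 0 \<longrightarrow> v \<in> G"
    "\<forall>c\<in>face_cone J. F (\<lambda>v. \<Sum>i\<in>verts J. c i * p i v) = (\<lambda>b. \<Sum>i\<in>verts J. c i * F (p i) b)"
    by (rule pl_map_subdivision[OF K F(1) finite_verts[OF L] FW])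
  note J = J0(1) and p = bspec[OF J0(2)] bspec[OF J0(3)] and bij = J0(4) and cell = bspec[OF J0(5)]
    and lin = bspec[OF J0(6)]
  let ?\<Phi> = "\<lambda>c v. \<Sum>i\<in>verts J. c i * p i v"
  define l where "l i = (\<Sum>b\<in>verts L. F (p i) b)" for i
  have l: "l i > 0" if i: "i \<in> verts J" for i
  proof -
    have FpL: "F (p i) \<in> face_cone L" using F(2) p(1)[OF i] by blast
    have "F (p i) \<noteq> (\<lambda>b. 0)"
    proof
      assume "F (p i) = (\<lambda>b. 0)"
      then have "p i = (\<lambda>v. 0)"
        using F(3)[OF p(1)[OF i]] pl_map_zero[OF F' zero_in_cone[OF L]] by simp
      then show False using p(2)[OF i] by simp
    qed
    then obtain b where b: "F (p i) b \<noteq> 0" by blast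
    then have "b \<in> verts L" using cone_zero_outside[OF FpL] by blast
    then show ?thesis unfolding l_def
      using b finite_verts[OF L] cone_nonneg[OF FpL] by (intro sum_pos2[of _ b]) (auto simp: less_le)
  qed
  define q where "q i b = F (p i) b / l i" for i b
  let ?\<Psi> = "\<lambda>c b. \<Sum>i\<in>verts J. c i * q i b"
  \<comment> \<open>Normalizing the images of the vertices amounts to rescaling the coordinates
    beforehand: the new map is \<open>F\<close> after the subdivision map after \<open>r\<close>,
    and \<open>r\<close> is a bijection of the cone over \<open>J\<close>.\<close>
  define r where "r c = (\<lambda>i. if i \<in> verts J then c i / l i else 0)" for c
  have rJ: "r c \<in> face_cone J" if "c \<in> face_cone J" for c
    by (rule cone_support_subset[OF J that])
      (use cone_nonneg[OF that] l in \<open>auto simp: r_def intro: divide_nonneg_pos\<close>)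
  have \<Psi>r: "?\<Psi> c = F (?\<Phi> (r c))" if "c \<in> face_cone J" for c
    unfolding lin[OF rJ[OF that]] by (auto simp: r_def q_def intro!: sum.cong)
  have bij_r: "bij_betw r (face_cone J) (face_cone J)"
  proof (rule bij_betw_byWitness[where f'="\<lambda>c i. c i * l i"])
    show "\<forall>c\<in>face_cone J. (\<lambda>i. r c i * l i) = c"
      using l cone_zero_outside by (fastforce simp: r_def fun_eq_iff)
    show "\<forall>c\<in>face_cone J. r (\<lambda>i. c i * l i) = c"
      using l cone_zero_outside by (fastforce simp: r_def fun_eq_iff)
    show "r ` face_cone J \<subseteq> face_cone J" using rJ by blast
    show "(\<lambda>c i. c i * l i) ` face_cone J \<subseteq> face_cone J"
    proof (intro image_subsetI)
      fix c assume c: "c \<in> face_cone J"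
      have "0 \<le> c i * l i" for i
        using cone_nonneg[OF c, of i] cone_zero_outside[OF c, of i] l[of i] by (cases "i \<in> verts J") auto
      then show "(\<lambda>i. c i * l i) \<in> face_cone J" by (rule cone_support_subset[OF J c]) auto
    qed
  qed
  have "bij_betw (F \<circ> (?\<Phi> \<circ> r)) (face_cone J) (face_cone L)"
    by (intro bij_betw_trans[OF bij_betw_trans[OF bij_r bij]] pl_iso_bij_betw[OF iso])
  then have bij\<Psi>: "bij_betw ?\<Psi> (face_cone J) (face_cone L)"
    by (subst bij_betw_cong[where g="F \<circ> (?\<Phi> \<circ> r)"]) (auto simp: \<Psi>r)
  have q1: "(\<Sum>b\<in>verts L. q i b) = 1" if "i \<in> verts J" for i
    using l[OF that] by (simp add: q_def l_def flip: sum_divide_distrib)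
  have hom\<Phi>: "homeomorphic_map (realization_space J) (realization_space K) ?\<Phi>"
    by (rule homeomorphic_map_realization[OF J K bij p(2)])
  have hom\<Psi>: "homeomorphic_map (realization_space J) (realization_space L) ?\<Psi>"
    by (rule homeomorphic_map_realization[OF J L bij\<Psi> q1])
  have surj: "?\<Phi> ` realization J = realization K"
    using homeomorphic_imp_surjective_map[OF hom\<Phi>] by (simp only: topspace_realization_space)
  obtain g where "homeomorphic_maps (realization_space J) (realization_space K) ?\<Phi> g"
    using hom\<Phi> unfolding homeomorphic_map_maps by (elim exE)
  then have g: "homeomorphic_map (realization_space K) (realization_space J) g"
    "\<And>c. c \<in> realization J \<Longrightarrow> g (?\<Phi> c) = c"
    unfolding homeomorphic_maps_map topspace_realization_space by simp_all
  have ind: "?\<Phi> (indicator {i}) = p i" "?\<Psi> (indicator {i}) = q i" if "i \<in> verts J" for i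
    using that finite_verts[OF J] by (auto simp: indicator_def fun_eq_iff if_distrib[of "\<lambda>x. x * _"] cong: if_cong)
  have sub: "subdivision J K ?\<Phi>"
    unfolding subdivision_def
  proof (intro conjI ballI)
    show "simplexwise_linear J ?\<Phi>"
      unfolding simplexwise_linear_def by (intro ballI ext sum.cong refl) (simp add: fun_cong[OF ind(1)])
    fix T assume T: "T \<in> J"
    obtain G where G: "G \<in> K" "\<forall>i\<in>T. \<forall>v. p i v \<noteq> 0 \<longrightarrow> v \<in> G" using cell[OF T] by blast
    have "?\<Phi> c \<in> realization (Pow G)" if c: "c \<in> realization (Pow T)" for c
    proof -
      have cT: "c i = 0" if "i \<notin> T" for i using c that by (auto simp: realization_def)
      have "{i. c i \<noteq> 0} \<in> J" using c asc_subset[OF J T] by (auto simp: realization_def)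
      then have "c \<in> realization J" using c by (simp add: realization_def)
      then have "?\<Phi> c \<in> realization K" 
        using imageI[of c "realization J" ?\<Phi>] unfolding surj by simp
      moreover have "v \<in> G" if "?\<Phi> c v \<noteq> 0" for v
      proof -
        have "\<exists>i\<in>verts J. c i * p i v \<noteq> 0"
          using sum.neutral[of "verts J" "\<lambda>i. c i * p i v"] that by auto
        then obtain i where "c i * p i v \<noteq> 0" by (elim bexE)
        then show ?thesis using cT[of i] G(2) by (cases "i \<in> T") auto
      qed
      ultimately show ?thesis by (auto simp: realization_def)
    qed
    then show "\<exists>G\<in>K. ?\<Phi> ` realization (Pow T) \<subseteq> realization (Pow G)" using G(1) by blast
  qed (use J hom\<Phi> in auto)
  \<comment> \<open>The witness is not \<open>F\<close> but the normalized map read through the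
    subdivision; its pullback to \<open>J\<close> is simplexwise linear by construction.\<close>
  have "homeomorphic_map (realization_space K) (realization_space L) (?\<Psi> \<circ> g)"
    by (rule homeomorphic_map_compose[OF g(1) hom\<Psi>])
  moreover have "simplexwise_linear J ((?\<Psi> \<circ> g) \<circ> ?\<Phi>)"
    unfolding simplexwise_linear_def
  proof
    have e: "((?\<Psi> \<circ> g) \<circ> ?\<Phi>) c = ?\<Psi> c" if "c \<in> realization J" for c
      unfolding o_def g(2)[OF that] ..
    fix c assume c: "c \<in> realization J"
    show "((?\<Psi> \<circ> g) \<circ> ?\<Phi>) c = (\<lambda>b. \<Sum>v\<in>verts J. c v * ((?\<Psi> \<circ> g) \<circ> ?\<Phi>) (indicator {v}) b)"
      unfolding e[OF c]
      by (intro ext sum.cong refl) (simp only: e[OF indicator_in_realization[OF J]] ind(2))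
  qed
  ultimately show ?thesis
    unfolding pl_homeomorphic_def piecewise_linear_def using sub by blast
qed

section \<open>Directional derivatives and links\<close>

lemma coords_zero: "x \<in> coords V \<Longrightarrow> v \<notin> V \<Longrightarrow> x v = 0"
  by (auto simp: coords_def)

lemma coordsI: "(\<And>v. v \<notin> V \<Longrightarrow> x v = 0) \<Longrightarrow> x \<in> coords V"
  by (auto simp: coords_def)

lemma lin_bound:
  assumes "lin k" "finite V" "y \<in> coords V"
  shows "\<bar>k y\<bar> \<le> (\<Sum>v\<in>V. \<bar>k (indicator {v})\<bar>) * (\<Sum>v\<in>V. \<bar>y v\<bar>)"
proof -
  have "\<bar>k y\<bar> = \<bar>\<Sum>v\<in>V. y v * k (indicator {v})\<bar>" by (simp only: lin_expand[OF assms])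
  also have "\<dots> \<le> (\<Sum>v\<in>V. \<bar>y v * k (indicator {v})\<bar>)" by (rule sum_abs)
  also have "\<dots> \<le> (\<Sum>v\<in>V. \<bar>y v\<bar> * (\<Sum>v\<in>V. \<bar>k (indicator {v})\<bar>))"
    unfolding abs_mult using assms(2) by (intro sum_mono mult_left_mono member_le_sum) auto
  finally show ?thesis by (simp add: sum_distrib_right mult.commute)
qed

text \<open>For \<open>t\<close> large compared with the norm of \<open>y\<close>, the sign of
  \<open>k (t z + y)\<close> is that of \<open>k z\<close> if this is nonzero, and that of
  \<open>k y\<close> otherwise; it does not depend on \<open>t\<close>. So all these points, and
  \<open>z\<close> itself, lie in the closure of one cell. There one functional represents
  \<open>h\<close>, and both sides are its value at \<open>y\<close>.\<close>

lemma pl_fun_eventually_affine: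
  assumes h: "pl_fun X h" and XV: "X \<subseteq> coords V" "finite V" and YV: "Y \<subseteq> coords V"
    and X0: "\<forall>y\<in>Y. \<forall>s\<ge>0. \<forall>t\<ge>0. (\<lambda>v. t * z v + s * y v) \<in> X"
  shows "\<exists>C\<ge>0. \<forall>y\<in>Y. \<forall>t t'. C * (\<Sum>v\<in>V. \<bar>y v\<bar>) \<le> t \<longrightarrow> C * (\<Sum>v\<in>V. \<bar>y v\<bar>) \<le> t' \<longrightarrow>
     h (\<lambda>v. t * z v + y v) - t * h z = h (\<lambda>v. t' * z v + y v) - t' * h z"
proof -
  note X = X0[rule_format]
  obtain H where H: "linear_on_cells X H h" using pl_fun_linear_on_cells[OF h XV] by blast
  have finH: "finite H" and linH: "\<And>k. k \<in> H \<Longrightarrow> lin k" using H by (auto simp: linear_on_cells_def)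
  define c where "c k = (\<Sum>v\<in>V. \<bar>k (indicator {v} :: 'a \<Rightarrow> real)\<bar>)" for k :: "('a \<Rightarrow> real) \<Rightarrow> real"
  have c0: "0 \<le> c k" for k by (simp add: c_def sum_nonneg)
  \<comment> \<open>\<open>c k\<close> bounds \<open>k\<close> in the l1 norm, so
    \<open>t * k z\<close> dominates \<open>k y\<close> once \<open>t\<close> exceeds
    \<open>c k / \<bar>k z\<bar>\<close> times the norm of \<open>y\<close>. Functionals with
    \<open>k z = 0\<close> contribute 0 by the convention for division. The extra 1 makes the
    domination strict.\<close>
  define C where "C = (\<Sum>k\<in>H. c k / \<bar>k z\<bar>) + 1"
  have C: "c k / \<bar>k z\<bar> + 1 \<le> C" if "k \<in> H" for k
    unfolding C_def using finH that c0 by (intro add_right_mono member_le_sum) auto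
  have C0: "0 < C" unfolding C_def using c0 by (intro add_nonneg_pos sum_nonneg) auto
  have main: "h (\<lambda>v. t * z v + y v) - t * h z = h (\<lambda>v. t' * z v + y v) - t' * h z"
    if y: "y \<in> Y" and tt: "C * (\<Sum>v\<in>V. \<bar>y v\<bar>) \<le> t" "C * (\<Sum>v\<in>V. \<bar>y v\<bar>) \<le> t'" for y t t'
  proof -
    let ?n = "\<Sum>v\<in>V. \<bar>y v\<bar>"
    have n0: "0 \<le> ?n" by (simp add: sum_nonneg)
    have yV: "y \<in> coords V" using y YV by (rule subsetD[rotated])
    show ?thesis
    proof (cases "?n = 0")
      \<comment> \<open>Strict domination needs a positive norm. For \<open>y = 0\<close> the claim
        is homogeneity, with the factor 0 treated apart.\<close>
      case True
      have "y v = 0" for v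
      proof (cases "v \<in> V")
        case True
        then show ?thesis using \<open>?n = 0\<close> XV(2) by (simp add: sum_nonneg_eq_0_iff)
      qed (rule coords_zero[OF yV])
      then have y0: "y = (\<lambda>v. 0)" by auto
      have "h (\<lambda>v. s * z v + y v) = s * h z" if "0 \<le> s" for s
      proof (cases "s = 0")
        case True
        obtain G where G: "\<forall>g\<in>G. lin g" "\<forall>x\<in>X. \<exists>g\<in>G. h x = g x" using h unfolding pl_fun_def by blast
        have "(\<lambda>v. 0) \<in> X" using X[OF y, of 0 0] by simp
        then obtain g where g: "g \<in> G" "h (\<lambda>v. 0) = g (\<lambda>v. 0)" using G(2) by blast
        then show ?thesis using True G(1) lin_zero[of g] y0 by simp
      next
        case False
        have "h (\<lambda>v. s * z v) = s * h z"
          by (rule pl_fun_homogeneous[OF h]) (use X[OF y, of 0] that False in auto)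
        then show ?thesis using y0 by simp
      qed
      moreover have "0 \<le> t" "0 \<le> t'" using tt True by auto
      ultimately show ?thesis by simp
    next
      case False
      then have n: "0 < ?n" using n0 by linarith
      have t0: "0 \<le> t" "0 \<le> t'" using tt C0 n0 by (meson mult_nonneg_nonneg less_imp_le order_trans)+
      have dom: "\<bar>k y\<bar> < s * \<bar>k z\<bar>" if k: "k \<in> H" "k z \<noteq> 0" and s: "C * ?n \<le> s" for k s
      proof -
        have "\<bar>k y\<bar> \<le> c k * ?n" unfolding c_def by (rule lin_bound[OF linH[OF k(1)] XV(2) yV])
        also have "\<dots> < (c k / \<bar>k z\<bar> + 1) * ?n * \<bar>k z\<bar>" using n k(2) by (simp add: field_simps)
        also have "\<dots> \<le> C * ?n * \<bar>k z\<bar>" using C[OF k(1)] n by (intro mult_right_mono) auto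
        also have "\<dots> \<le> s * \<bar>k z\<bar>" using s by (intro mult_right_mono) auto
        finally show ?thesis .
      qed
      define x where "x s = (\<lambda>v. s * z v + y v)" for s
      have kx: "k (x s) = s * k z + k y" if "k \<in> H" for k s
        using linD[OF linH[OF that], of s z 1 y] by (simp add: x_def)
      have xX: "x s \<in> X" if "0 \<le> s" for s using X[OF y, of 1 s] that by (simp add: x_def)
      have zX: "z \<in> X" using X[OF y, of 0 1] by simp
      obtain g where g: "lin g" "agrees_below X H h (x t) g"
        using H xX[OF t0(1)] unfolding linear_on_cells_def by blast
      have seg: "(\<lambda>v. (1 - r) * x t v + r * (a * z v + b * y v)) \<in> X"
        if "0 \<le> r" "r \<le> 1" "0 \<le> a" "0 \<le> b" for r a b
      proof -
        have "(\<lambda>v. (1 - r) * x t v + r * (a * z v + b * y v)) =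
          (\<lambda>v. ((1 - r) * t + r * a) * z v + ((1 - r) + r * b) * y v)"
          by (auto simp: x_def algebra_simps)
        then show ?thesis using X[OF y, of "(1 - r) + r * b" "(1 - r) * t + r * a"] that t0 by simp
      qed
      have gz: "h z = g z"
      proof (rule agrees_belowD[OF g(2) zX])
        show "(\<lambda>v. (1 - r) * x t v + r * z v) \<in> X" if "0 \<le> r" "r \<le> 1" for r
          using seg[OF that, of 1 0] by simp
        show "0 < k (x t)" if "k \<in> H" "0 < k z" for k
          using dom[OF that(1) _ tt(1)] that(2) kx[OF that(1), of t] by auto
      qed
      have gx: "h (x s) = g (x s)" if s: "C * ?n \<le> s" "0 \<le> s" for s
      proof (rule agrees_belowD[OF g(2) xX[OF s(2)]])
        show "(\<lambda>v. (1 - r) * x t v + r * x s v) \<in> X" if "0 \<le> r" "r \<le> 1" for r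
          using seg[OF that s(2), of 1] by (simp add: x_def)
        show "0 < k (x t)" if k: "k \<in> H" "0 < k (x s)" for k
        proof (cases "k z = 0")
          case True
          then show ?thesis using k(2) unfolding kx[OF k(1)] by simp
        next
          case False
          have "k z > 0"
          proof (rule ccontr)
            assume "\<not> k z > 0"
            then have "s * k z = - (s * \<bar>k z\<bar>)" by simp
            then show False using dom[OF k(1) False s(1)] k(2) unfolding kx[OF k(1)] by linarith
          qed
          then show ?thesis using dom[OF k(1) False tt(1)] unfolding kx[OF k(1)] by auto
        qed
      qed
      have "g (x s) = s * g z + g y" for s
        using linD[OF g(1), of s z 1 y] by (simp add: x_def)
      then show ?thesis using gz gx[OF tt(1) t0(1)] gx[OF tt(2) t0(2)] by (simp add: x_def)
    qed
  qed
  show ?thesis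
  proof (intro exI[of _ C] conjI ballI allI impI)
    show "0 \<le> C" using C0 by simp
  qed (erule (2) main)
qed

lemma pl_map_eventually_affine:
  assumes F: "pl_map X F" and XV: "X \<subseteq> coords V" "finite V" and YV: "Y \<subseteq> coords V"
    and W: "finite W" "F ` X \<subseteq> coords W"
    and X0: "\<forall>y\<in>Y. \<forall>s\<ge>0. \<forall>t\<ge>0. (\<lambda>v. t * z v + s * y v) \<in> X"
  shows "\<exists>C\<ge>0. \<forall>y\<in>Y. \<forall>t t' b. C * (\<Sum>v\<in>V. \<bar>y v\<bar>) \<le> t \<longrightarrow> C * (\<Sum>v\<in>V. \<bar>y v\<bar>) \<le> t' \<longrightarrow>
     F (\<lambda>v. t * z v + y v) b - t * F z b = F (\<lambda>v. t' * z v + y v) b - t' * F z b"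
proof -
  note X = X0[rule_format]
  define Q where "Q b C \<longleftrightarrow> C \<ge> 0 \<and> (\<forall>y\<in>Y. \<forall>t t'. C * (\<Sum>v\<in>V. \<bar>y v\<bar>) \<le> t \<longrightarrow> C * (\<Sum>v\<in>V. \<bar>y v\<bar>) \<le> t' \<longrightarrow>
     F (\<lambda>v. t * z v + y v) b - t * F z b = F (\<lambda>v. t' * z v + y v) b - t' * F z b)" for b C
  have "\<exists>C. Q b C" for b
    unfolding Q_def
    by (rule pl_fun_eventually_affine[OF _ XV YV X0]) (use F in \<open>simp_all add: pl_map_def\<close>)
  then obtain c where Q: "\<And>b. Q b (c b)" by metis
  have c1: "0 \<le> c b" for b using Q[of b] unfolding Q_def by (rule conjunct1)
  have c2: "\<forall>y\<in>Y. \<forall>t t'. c b * (\<Sum>v\<in>V. \<bar>y v\<bar>) \<le> t \<longrightarrow> c b * (\<Sum>v\<in>V. \<bar>y v\<bar>) \<le> t' \<longrightarrow>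
     F (\<lambda>v. t * z v + y v) b - t * F z b = F (\<lambda>v. t' * z v + y v) b - t' * F z b" for b
    using Q[of b] unfolding Q_def by (rule conjunct2)
  note c = c1 c2[rule_format]
  define C where "C = (\<Sum>b\<in>W. c b)"
  have C0: "0 \<le> C" unfolding C_def using c(1) by (simp add: sum_nonneg)
  have main: "F (\<lambda>v. t * z v + y v) b - t * F z b = F (\<lambda>v. t' * z v + y v) b - t' * F z b"
    if y: "y \<in> Y" and tt: "C * (\<Sum>v\<in>V. \<bar>y v\<bar>) \<le> t" "C * (\<Sum>v\<in>V. \<bar>y v\<bar>) \<le> t'" for y t t' b
  proof (cases "b \<in> W")
    case True
    have "c b \<le> C" unfolding C_def using W(1) True c(1) by (intro member_le_sum) auto
    then have "c b * (\<Sum>v\<in>V. \<bar>y v\<bar>) \<le> C * (\<Sum>v\<in>V. \<bar>y v\<bar>)" by (intro mult_right_mono sum_nonneg) auto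
    then show ?thesis by (intro c(2)[OF y]) (use tt in linarith)+
  next
    case False
    have n: "0 \<le> C * (\<Sum>v\<in>V. \<bar>y v\<bar>)" using C0 by (simp add: sum_nonneg)
    have FW: "F x b = 0" if "x \<in> X" for x using W(2) that coords_zero[OF _ False] by blast
    have "0 \<le> t" "0 \<le> t'" using n tt by linarith+
    then have X3: "(\<lambda>v. t * z v + y v) \<in> X" "(\<lambda>v. t' * z v + y v) \<in> X" "z \<in> X"
      using X[OF y, of 1 t] X[OF y, of 1 t'] X[OF y, of 0 1] by simp_all
    show ?thesis using FW[OF X3(1)] FW[OF X3(2)] FW[OF X3(3)] by simp
  qed
  show ?thesis
  proof (intro exI[of _ C] conjI ballI allI impI)
    show "0 \<le> C" using C0 by simp
  qed (erule (2) main)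
qed

lemma asc_link: "asc K \<Longrightarrow> F \<in> K \<Longrightarrow> asc (link F K)"
  unfolding asc_def link_def by (auto intro: finite_subset) (metis Un_mono subset_refl)+

text \<open>With \<open>z\<close> the vertex \<open>v\<close> and \<open>w\<close> its image, \<open>F (t z + y) = t w + D y\<close> for all large \<open>t\<close>;
  the derivative \<open>D\<close>, taken modulo \<open>w\<close>, identifies the cone over the link of \<open>v\<close> with a
  coordinate hyperplane.\<close>

lemma pl_iso_vertex_link:
  fixes K :: "'a set set" and I :: "'b set"
  assumes K: "asc K" and v: "{v} \<in> K" and I: "finite I" and iso: "pl_iso (face_cone K) (coords I) F F'"
  shows "\<exists>j\<in>I. \<exists>E E'. pl_iso (face_cone (link {v} K)) (coords (I - {j})) E E'"
proof -
  let ?V = "verts K" and ?Y = "face_cone (link {v} K)"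
  have V: "finite ?V" by (rule finite_verts[OF K])
  have F: "pl_map (face_cone K) F" "\<And>x. x \<in> face_cone K \<Longrightarrow> F x \<in> coords I" "\<And>x. x \<in> face_cone K \<Longrightarrow> F' (F x) = x"
    and F': "pl_map (coords I) F'" "\<And>u. u \<in> coords I \<Longrightarrow> F' u \<in> face_cone K" "\<And>u. u \<in> coords I \<Longrightarrow> F (F' u) = u"
    using iso by (auto simp: pl_iso_def)
  define z where "z = (indicator {v} :: 'a \<Rightarrow> real)"
  have zv: "z v = 1" "\<And>u. u \<noteq> v \<Longrightarrow> z u = 0" by (auto simp: z_def)
  have "{u. z u \<noteq> 0} = {v}" using zv by force
  then have zK: "z \<in> face_cone K" using v by (auto simp: face_cone_def z_def)
  define w where "w = F z"
  have wI: "w \<in> coords I" using F(2)[OF zK] by (simp add: w_def)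
  have F'w: "F' w = z" using F(3)[OF zK] by (simp add: w_def)
  have "w \<noteq> (\<lambda>b. 0)"
  proof
    assume "w = (\<lambda>b. 0)"
    moreover have "F' (\<lambda>b. 0) = (\<lambda>v. 0)" by (rule pl_map_zero[OF F'(1)]) (simp add: coords_def)
    ultimately show False using F'w zv(1) by (metis zero_neq_one)
  qed
  \<comment> \<open>Every vector is congruent modulo \<open>w\<close> to exactly one whose
    coordinate \<open>j\<close> vanishes, so this coordinate hyperplane is a model of the quotient
    by \<open>w\<close>.\<close>
  then obtain j where wj: "w j \<noteq> 0" by blast
  then have jI: "j \<in> I" using coords_zero[OF wI] by blast
  have Y0: "y v = 0" if "y \<in> ?Y" for y
    using that by (auto simp: face_cone_def link_def)
  have YK: "(\<lambda>u. t * z u + s * y u) \<in> face_cone K" if y: "y \<in> ?Y" and st: "0 \<le> s" "0 \<le> t" for y s t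
  proof -
    have "{u. t * z u + s * y u \<noteq> 0} \<subseteq> {v} \<union> {u. y u \<noteq> 0}" using zv by auto
    moreover have "{v} \<union> {u. y u \<noteq> 0} \<in> K" using y by (auto simp: face_cone_def link_def)
    ultimately have "{u. t * z u + s * y u \<noteq> 0} \<in> K" using asc_subset[OF K] by blast
    moreover have "0 \<le> t * z u + s * y u" for u
      using st cone_nonneg[OF y, of u] by (simp add: z_def)
    ultimately show ?thesis by (simp add: face_cone_def)
  qed
  have YV: "?Y \<subseteq> coords ?V" unfolding face_cone_def coords_def link_def verts_def by auto
  have FI: "F ` face_cone K \<subseteq> coords I" using F(2) by (rule image_subsetI)
  have YK': "\<forall>y\<in>?Y. \<forall>s\<ge>0. \<forall>t\<ge>0. (\<lambda>u. t * z u + s * y u) \<in> face_cone K"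
    by (intro ballI allI impI YK)
  obtain C where C1: "0 \<le> C" "\<forall>y\<in>?Y. \<forall>t t' b. C * (\<Sum>u\<in>?V. \<bar>y u\<bar>) \<le> t \<longrightarrow> C * (\<Sum>u\<in>?V. \<bar>y u\<bar>) \<le> t' \<longrightarrow>
     F (\<lambda>u. t * z u + y u) b - t * w b = F (\<lambda>u. t' * z u + y u) b - t' * w b"
    using pl_map_eventually_affine[OF F(1) cone_coords V YV I FI YK'] unfolding w_def by (elim exE conjE)
  note C = C1(1) C1(2)[rule_format]
  let ?U = "coords (I - {j})"
  have UI: "(\<lambda>b. t * w b + s * u b) \<in> coords I" if "u \<in> ?U" for u s t
    using coords_zero[OF that] coords_zero[OF wI] by (intro coordsI) auto
  have UI': "?U \<subseteq> coords I" by (auto simp: coords_def)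
  have F'V: "F' ` coords I \<subseteq> coords ?V" using F'(2) cone_coords by blast
  have UI0: "\<forall>u\<in>?U. \<forall>s\<ge>0. \<forall>t\<ge>0. (\<lambda>b. t * w b + s * u b) \<in> coords I"
    by (intro ballI allI impI UI)
  obtain C' where C1': "0 \<le> C'" "\<forall>u\<in>?U. \<forall>t t' a. C' * (\<Sum>b\<in>I. \<bar>u b\<bar>) \<le> t \<longrightarrow> C' * (\<Sum>b\<in>I. \<bar>u b\<bar>) \<le> t' \<longrightarrow>
     F' (\<lambda>b. t * w b + u b) a - t * F' w a = F' (\<lambda>b. t' * w b + u b) a - t' * F' w a"
    using pl_map_eventually_affine[OF F'(1) subset_refl I UI' V F'V UI0] by (elim exE conjE)
  note C' = C1'(1) C1'(2)[rule_format, unfolded F'w]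
  \<comment> \<open>A threshold beyond which the difference is stable. Being a multiple of the norm
    it is piecewise linear in \<open>y\<close>, and so \<open>D\<close>, evaluated at the threshold,
    is a composition of piecewise linear maps.\<close>
  define \<tau> where "\<tau> y = C * (\<Sum>u\<in>?V. \<bar>y u\<bar>)" for y
  define \<tau>' where "\<tau>' u = C' * (\<Sum>b\<in>I. \<bar>u b\<bar>)" for u
  have \<tau>0: "0 \<le> \<tau> y" "0 \<le> \<tau>' u" for y u
    using C(1) C'(1) by (auto simp: \<tau>_def \<tau>'_def intro!: mult_nonneg_nonneg sum_nonneg)
  define D where "D y = (\<lambda>b. F (\<lambda>u. \<tau> y * z u + y u) b - \<tau> y * w b)" for y
  define D' where "D' u = (\<lambda>a. F' (\<lambda>b. \<tau>' u * w b + u b) a - \<tau>' u * z a)" for u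
  have FD: "F (\<lambda>u. t * z u + y u) = (\<lambda>b. t * w b + D y b)" if "y \<in> ?Y" "\<tau> y \<le> t" for y t
    using C(2)[OF that(1), of t "\<tau> y"] that(2) by (auto simp: D_def \<tau>_def fun_eq_iff algebra_simps)
  have F'D': "F' (\<lambda>b. t * w b + u b) = (\<lambda>a. t * z a + D' u a)" if "u \<in> ?U" "\<tau>' u \<le> t" for u t
    using C'(2)[OF that(1), of t "\<tau>' u"] that(2) by (auto simp: D'_def \<tau>'_def fun_eq_iff algebra_simps)
  have YK1: "(\<lambda>u. t * z u + y u) \<in> face_cone K" if "y \<in> ?Y" "0 \<le> t" for y t
    using YK[OF that(1), of 1 t] that(2) by simp
  have UI1: "(\<lambda>b. t * w b + u b) \<in> coords I" if "u \<in> ?U" for u t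
    using UI[OF that, of t 1] by simp
  define E where "E y = (\<lambda>b. D y b - D y j / w j * w b)" for y
  define E' where "E' u = (\<lambda>a. if a = v then 0 else D' u a)" for u
  have DI: "D y \<in> coords I" if "y \<in> ?Y" for y
    using coords_zero[OF F(2)[OF YK1[OF that \<tau>0(1)[of y]]]] coords_zero[OF wI]
    by (intro coordsI) (simp add: D_def)
  have EU: "E y \<in> ?U" if "y \<in> ?Y" for y
    using coords_zero[OF DI[OF that]] coords_zero[OF wI] wj by (intro coordsI) (auto simp: E_def)
  have E'Y: "E' u \<in> ?Y" if u: "u \<in> ?U" for u
  proof -
    \<comment> \<open>Also large enough for coordinate \<open>v\<close> to be positive: then
      \<open>v\<close> belongs to the support, and the rest of the support is a face of the
      link.\<close>
    define t where "t = max (\<tau>' u) (1 - D' u v)"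
    have G: "(\<lambda>a. t * z a + D' u a) \<in> face_cone K"
      using F'D'[OF u, of t] F'(2)[OF UI1[OF u, of t]] by (simp add: t_def)
    have e: "t * z a + D' u a = E' u a" if "a \<noteq> v" for a using that zv(2) by (simp add: E'_def)
    have "t * z v + D' u v > 0" using zv(1) by (simp add: t_def)
    then have "t * z a + D' u a \<noteq> 0 \<longleftrightarrow> a = v \<or> E' u a \<noteq> 0" for a
      using e[of a] by (cases "a = v") auto
    then have "{a. t * z a + D' u a \<noteq> 0} = {v} \<union> {a. E' u a \<noteq> 0}" by auto
    then have *: "{v} \<union> {a. E' u a \<noteq> 0} \<in> K" using G by (simp add: face_cone_def)
    have "{a. E' u a \<noteq> 0} \<in> K" using asc_subset[OF K *] by blast
    moreover have "0 \<le> E' u a" for a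
      using cone_nonneg[OF G, of a] e[of a] by (cases "a = v") (simp_all add: E'_def)
    moreover have "E' u v = 0" by (simp add: E'_def)
    ultimately show ?thesis using * by (auto simp: face_cone_def link_def)
  qed
  have E'E: "E' (E y) = y" if y: "y \<in> ?Y" for y
  proof -
    define c where "c = D y j / w j"
    \<comment> \<open>\<open>E y\<close> differs from \<open>D y\<close> by \<open>c\<close> times
      \<open>w\<close>, which shifts the parameter by \<open>c\<close>; both \<open>t\<close> and
      \<open>t - c\<close> have to be in the stable range of the respective map.\<close>
    define t where "t = max (\<tau>' (E y)) (\<tau> y + c)"
    have "(\<lambda>b. t * w b + E y b) = (\<lambda>b. (t - c) * w b + D y b)"
      by (auto simp: E_def c_def algebra_simps)
    also have "\<dots> = F (\<lambda>u. (t - c) * z u + y u)"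
      using FD[OF y, of "t - c"] by (simp add: t_def)
    finally have "F' (\<lambda>b. t * w b + E y b) = (\<lambda>u. (t - c) * z u + y u)"
      using F(3)[OF YK1[OF y, of "t - c"]] \<tau>0(1)[of y] by (simp add: t_def)
    moreover have "F' (\<lambda>b. t * w b + E y b) = (\<lambda>a. t * z a + D' (E y) a)"
      using F'D'[OF EU[OF y], of t] by (simp add: t_def)
    ultimately have "t * z a + D' (E y) a = (t - c) * z a + y a" for a by metis
    then show ?thesis using zv(2) Y0[OF y] by (auto simp: E'_def fun_eq_iff) (metis add_cancel_left_left mult_zero_right)
  qed
  have EE': "E (E' u) = u" if u: "u \<in> ?U" for u
  proof -
    define c where "c = D' u v"
    define t where "t = max (\<tau> (E' u)) (\<tau>' u + c)"
    have "(\<lambda>a. t * z a + E' u a) = (\<lambda>a. (t - c) * z a + D' u a)"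
      using zv by (auto simp: E'_def c_def algebra_simps)
    also have "\<dots> = F' (\<lambda>b. (t - c) * w b + u b)"
      using F'D'[OF u, of "t - c"] by (simp add: t_def)
    finally have "F (\<lambda>a. t * z a + E' u a) = (\<lambda>b. (t - c) * w b + u b)"
      using F'(3)[OF UI1[OF u, of "t - c"]] by simp
    moreover have "F (\<lambda>a. t * z a + E' u a) = (\<lambda>b. t * w b + D (E' u) b)"
      using FD[OF E'Y[OF u], of t] by (simp add: t_def)
    ultimately have "t * w b + D (E' u) b = (t - c) * w b + u b" for b by metis
    then have Db: "D (E' u) b = u b - c * w b" for b by (simp add: algebra_simps)
    moreover have "u j = 0" using u by (auto simp: coords_def)
    ultimately show ?thesis using wj by (auto simp: E_def)
  qed
  have pl\<tau>: "pl_fun X \<tau>" for X unfolding \<tau>_def by (intro pl_fun_scale pl_fun_sum pl_fun_abs pl_fun_coord)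
  have pl\<tau>': "pl_fun X \<tau>'" for X unfolding \<tau>'_def by (intro pl_fun_scale pl_fun_sum pl_fun_abs pl_fun_coord)
  have plD: "pl_fun ?Y (\<lambda>y. D y b)" for b
    unfolding D_def
  proof (intro pl_fun_diff pl_fun_scale_right pl\<tau>)
    show "pl_fun ?Y (\<lambda>y. F (\<lambda>u. \<tau> y * z u + y u) b)"
    proof (rule pl_fun_compose[where h="\<lambda>x. F x b", OF _ _ _ cone_coords V])
      show "pl_fun (face_cone K) (\<lambda>x. F x b)" using F(1) by (simp add: pl_map_def)
      show "pl_fun ?Y (\<lambda>y. \<tau> y * z a + y a)" for a
        by (intro pl_fun_add pl_fun_scale_right pl\<tau> pl_fun_coord)
      show "(\<lambda>u. \<tau> y * z u + y u) \<in> face_cone K" if "y \<in> ?Y" for y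
        by (rule YK1[OF that \<tau>0(1)])
    qed
  qed
  have plD': "pl_fun ?U (\<lambda>u. D' u a)" for a
    unfolding D'_def
  proof (intro pl_fun_diff pl_fun_scale_right pl\<tau>')
    show "pl_fun ?U (\<lambda>u. F' (\<lambda>b. \<tau>' u * w b + u b) a)"
    proof (rule pl_fun_compose[where h="\<lambda>x. F' x a", OF _ _ _ subset_refl I])
      show "pl_fun (coords I) (\<lambda>x. F' x a)" using F'(1) by (simp add: pl_map_def)
      show "pl_fun ?U (\<lambda>u. \<tau>' u * w b + u b)" for b
        by (intro pl_fun_add pl_fun_scale_right pl\<tau>' pl_fun_coord)
      show "(\<lambda>b. \<tau>' u * w b + u b) \<in> coords I" if "u \<in> ?U" for u
        by (rule UI1[OF that])
    qed
  qed
  have "pl_map ?Y E" unfolding pl_map_def E_def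
    by (intro allI pl_fun_diff pl_fun_scale_right pl_fun_divide plD)
  moreover have "pl_map ?U E'" unfolding pl_map_def E'_def
  proof
    fix b
    show "pl_fun ?U (\<lambda>u. if b = v then 0 else D' u b)"
      using plD'[of b] by (cases "b = v") (simp_all add: pl_fun_zero)
  qed
  ultimately have "pl_iso ?Y ?U E E'"
    unfolding pl_iso_def using EU E'Y E'E EE' by blast
  then show ?thesis using jI by blast
qed

lemma link_insert: "asc K \<Longrightarrow> v \<notin> F \<Longrightarrow> link (insert v F) K = link F (link {v} K)"
  unfolding link_def by (auto intro: asc_subset)

text \<open>The vertices of \<open>F\<close> are treated one at a time, each costing one coordinate.
  The link of a vertex is again modelled on a coordinate space, so the hypothesis reproduces
  itself.\<close>

lemma pl_iso_face_link:
  fixes K :: "'a set set" and I :: "'b set"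
  assumes "asc K" "F \<in> K" "finite I" "pl_iso (face_cone K) (coords I) H H'"
  shows "\<exists>I' E E'. finite I' \<and> card (I' :: 'b set) + card F = card I \<and> pl_iso (face_cone (link F K)) (coords I') E E'"
proof -
  have "finite F" using assms by (auto simp: asc_def)
  then show ?thesis using assms
  proof (induction F arbitrary: K I H H')
    case empty
    moreover have "link {} K = K" by (auto simp: link_def)
    ultimately show ?case by auto
  next
    case (insert v F)
    have vK: "{v} \<in> K" using asc_subset[OF insert.prems(1,2)] by blast
    obtain j E E' where j: "j \<in> I" "pl_iso (face_cone (link {v} K)) (coords (I - {j})) E E'"
      using pl_iso_vertex_link[OF insert.prems(1) vK insert.prems(3,4)] by blast
    have "F \<in> link {v} K"
      using insert.prems(1,2) insert.hyps(2) by (auto simp: link_def intro: asc_subset)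
    then obtain I' E E' where "finite (I' :: 'b set)" "card I' + card F = card (I - {j})"
      "pl_iso (face_cone (link F (link {v} K))) (coords I') E E'"
      using insert.IH[OF asc_link[OF insert.prems(1) vK] _ _ j(2)] insert.prems(3) by blast
    moreover have "card (I - {j}) + 1 = card I"
      using j(1) insert.prems(3) by (metis Suc_eq_plus1 card.remove)
    ultimately show ?case
      using link_insert[OF insert.prems(1) insert.hyps(2)] insert.hyps
      by (intro exI[of _ I'] exI[of _ E] exI[of _ E']) simp
  qed
qed

section \<open>Recognizing spheres\<close>

lemma asc_image: "asc K \<Longrightarrow> asc ((`) h ` K)"
  unfolding asc_def by (auto simp: subset_image_iff)

lemma verts_image: "verts ((`) h ` K) = h ` verts K"
  by (auto simp: verts_def)

lemma pl_iso_relabel: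
  assumes h: "inj_on h (verts K)"
  shows "\<exists>F F'. pl_iso (face_cone K) (face_cone ((`) h ` K)) F F'"
proof -
  let ?V = "verts K"
  define g where "g = inv_into ?V h"
  have gh: "g (h v) = v" if "v \<in> ?V" for v using h that by (simp add: g_def)
  define F where "F x = (\<lambda>w. if w \<in> h ` ?V then x (g w) else (0::real))" for x :: "_ \<Rightarrow> real"
  define F' where "F' y = (\<lambda>v. if v \<in> ?V then y (h v) else (0::real))" for y :: "_ \<Rightarrow> real"
  have suppF: "{w. F x w \<noteq> 0} = h ` {v. x v \<noteq> 0}" if "x \<in> face_cone K" for x
  proof (intro set_eqI iffI)
    fix w assume "w \<in> {w. F x w \<noteq> 0}"
    then have w: "w \<in> h ` ?V" "x (g w) \<noteq> 0" by (auto simp: F_def split: if_splits)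
    then obtain v where "v \<in> ?V" "w = h v" by blast
    then show "w \<in> h ` {v. x v \<noteq> 0}" using w(2) gh by auto
  next
    fix w assume "w \<in> h ` {v. x v \<noteq> 0}"
    then obtain v where v: "w = h v" "x v \<noteq> 0" by blast
    then have "v \<in> ?V" using cone_zero_outside[OF that, of v] by blast
    then show "w \<in> {w. F x w \<noteq> 0}" using v gh by (simp add: F_def)
  qed
  have FK: "F x \<in> face_cone ((`) h ` K)" if "x \<in> face_cone K" for x
    unfolding face_cone_def using suppF[OF that] that by (auto simp: face_cone_def F_def)
  have F'K: "F' y \<in> face_cone K" if y: "y \<in> face_cone ((`) h ` K)" for y
  proof -
    obtain G where G: "G \<in> K" "{w. y w \<noteq> 0} = h ` G" using y by (auto simp: face_cone_def)
    have GV: "G \<subseteq> ?V" using G(1) by (auto simp: verts_def)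
    have "{v. F' y v \<noteq> 0} = G"
    proof (intro set_eqI)
      fix v
      have "v \<in> ?V \<and> y (h v) \<noteq> 0 \<longleftrightarrow> v \<in> ?V \<and> h v \<in> h ` G" using G(2) by blast
      also have "\<dots> \<longleftrightarrow> v \<in> G" using inj_on_image_mem_iff[OF h _ GV] GV by blast
      finally show "v \<in> {v. F' y v \<noteq> 0} \<longleftrightarrow> v \<in> G" by (auto simp: F'_def split: if_splits)
    qed
    then show ?thesis using G(1) y by (auto simp: face_cone_def F'_def)
  qed
  have "F' (F x) = x" if "x \<in> face_cone K" for x
    using gh cone_zero_outside[OF that] by (auto simp: F_def F'_def)
  moreover have "F (F' y) = y" if "y \<in> face_cone ((`) h ` K)" for y
    using gh cone_zero_outside[OF that] by (auto simp: F_def F'_def verts_image fun_eq_iff)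
  moreover have "pl_map (face_cone K) F" unfolding pl_map_def F_def
  proof
    fix w show "pl_fun (face_cone K) (\<lambda>x. if w \<in> h ` ?V then x (g w) else 0)"
      by (cases "w \<in> h ` ?V") (simp_all add: pl_fun_zero pl_fun_coord)
  qed
  moreover have "pl_map (face_cone ((`) h ` K)) F'" unfolding pl_map_def F'_def
  proof
    fix v show "pl_fun (face_cone ((`) h ` K)) (\<lambda>y. if v \<in> ?V then y (h v) else 0)"
      by (cases "v \<in> ?V") (simp_all add: pl_fun_zero pl_fun_coord)
  qed
  ultimately show ?thesis unfolding pl_iso_def using FK F'K by blast
qed

lemma pl_iso_coords:
  assumes h: "bij_betw h I J"
  shows "\<exists>F F'. pl_iso (coords I) (coords J) F F'"
proof -
  define g where "g = inv_into I h"
  have gh: "g (h v) = v" "h v \<in> J" if "v \<in> I" for v using h that by (auto simp: g_def bij_betw_def)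
  have hg: "h (g w) = w" "g w \<in> I" if "w \<in> J" for w
    using h that unfolding g_def by (auto simp: bij_betw_inv_into_right dest: bij_betwE bij_betw_inv_into)
  define F where "F x = (\<lambda>w. if w \<in> J then x (g w) else (0::real))" for x :: "_ \<Rightarrow> real"
  define F' where "F' y = (\<lambda>v. if v \<in> I then y (h v) else (0::real))" for y :: "_ \<Rightarrow> real"
  have FJ: "F x \<in> coords J" for x by (intro coordsI) (simp add: F_def)
  have F'I: "F' y \<in> coords I" for y by (intro coordsI) (simp add: F'_def)
  have "F' (F x) = x" if "x \<in> coords I" for x
    using gh coords_zero[OF that] by (auto simp: F_def F'_def)
  moreover have "F (F' y) = y" if "y \<in> coords J" for y
    using hg coords_zero[OF that] by (auto simp: F_def F'_def)
  moreover have "pl_map (coords I) F" unfolding pl_map_def F_def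
  proof
    fix w show "pl_fun (coords I) (\<lambda>x. if w \<in> J then x (g w) else 0)"
      by (cases "w \<in> J") (simp_all add: pl_fun_zero pl_fun_coord)
  qed
  moreover have "pl_map (coords J) F'" unfolding pl_map_def F'_def
  proof
    fix v show "pl_fun (coords J) (\<lambda>y. if v \<in> I then y (h v) else 0)"
      by (cases "v \<in> I") (simp_all add: pl_fun_zero pl_fun_coord)
  qed
  ultimately show ?thesis unfolding pl_iso_def using FJ F'I by blast
qed

lemma pl_fun_Min: "pl_fun X (\<lambda>u. Min (insert 0 (u ` {..<n::nat})))"
proof (induction n)
  case (Suc n)
  have "(\<lambda>u::nat \<Rightarrow> real. Min (insert 0 (u ` {..<Suc n}))) = (\<lambda>u. min (u n) (Min (insert 0 (u ` {..<n}))))"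
  proof
    fix u :: "nat \<Rightarrow> real"
    have e: "insert 0 (u ` {..<Suc n}) = insert (u n) (insert 0 (u ` {..<n}))" by (auto simp: lessThan_Suc)
    show "Min (insert 0 (u ` {..<Suc n})) = min (u n) (Min (insert 0 (u ` {..<n})))"
      unfolding e by (rule Min_insert) auto
  qed
  then show ?case using pl_fun_min[OF pl_fun_coord Suc] by simp
qed (simp add: pl_fun_zero)

lemma asc_simplex_boundary:
  assumes "0 \<le> k"
  shows "asc (simplex_boundary k)"
proof -
  have "0 \<in> {..<nat (k + 1)}" using assms by simp
  then have "{} \<noteq> {..<nat (k + 1)}" by blast
  then show ?thesis
    unfolding asc_def simplex_boundary_def full_simplex_def by (auto intro: finite_subset)
qed

text \<open>The cone consists of the nonnegative vectors with \<open>n + 1\<close> coordinates of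
  which at least one is zero. These are the representatives with minimum 0 of the vectors modulo
  \<open>(1, ..., 1)\<close>; the representatives with last coordinate 0 form the coordinate space.
  \<open>F\<close> and \<open>F'\<close> pass between the two.\<close>

lemma pl_iso_simplex_boundary:
  "\<exists>F F'. pl_iso (face_cone (simplex_boundary (int n))) (coords {..<n}) F F'"
proof -
  let ?K = "simplex_boundary (int n)"
  have K: "?K = {S. S \<subset> {..n}}"
    by (auto simp: simplex_boundary_def full_simplex_def nat_add_distrib lessThan_Suc_atMost)
  define m where "m u = Min (insert 0 (u ` {..<n}))" for u :: "nat \<Rightarrow> real"
  have m_le0: "m u \<le> 0" for u by (simp add: m_def)
  have m_le: "m u \<le> u i" if "i < n" for u i using that by (simp add: m_def)
  have m_in: "m u = 0 \<or> (\<exists>i<n. m u = u i)" for u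
    using Min_in[of "insert 0 (u ` {..<n})"] by (auto simp: m_def)
  define F where "F x = (\<lambda>i. if i < n then x i - x n else (0::real))" for x
  define F' where "F' u = (\<lambda>i. if i < n then u i - m u else if i = n then - m u else (0::real))" for u
  have FI: "F x \<in> coords {..<n}" for x by (intro coordsI) (simp add: F_def)
  have F'K: "F' u \<in> face_cone ?K" for u
  proof -
    have "0 \<le> F' u i" for i using m_le0[of u] m_le[of i u] by (simp add: F'_def)
    moreover have "\<exists>i\<le>n. F' u i = 0" using m_in[of u] by (auto simp: F'_def)
    moreover have "F' u i = 0" if "\<not> i \<le> n" for i using that by (simp add: F'_def)
    ultimately show ?thesis unfolding face_cone_def K by force
  qed
  have FF': "F (F' u) = u" if "u \<in> coords {..<n}" for u
    using coords_zero[OF that] by (auto simp: F_def F'_def)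
  have mF: "m (F x) = - x n" if x: "x \<in> face_cone ?K" for x
  proof -
    have x0: "0 \<le> x i" for i by (rule cone_nonneg[OF x])
    have "\<exists>i\<le>n. x i = 0" using x unfolding face_cone_def K by auto
    then obtain i where i: "i \<le> n" "x i = 0" by blast
    have "m (F x) \<le> - x n"
      using m_le0[of "F x"] m_le[of i "F x"] i by (cases "i = n") (auto simp: F_def)
    moreover have "- x n \<le> m (F x)" using m_in[of "F x"] x0 by (auto simp: F_def)
    ultimately show ?thesis by simp
  qed
  have F'F: "F' (F x) = x" if x: "x \<in> face_cone ?K" for x
  proof
    fix i
    have "x i = 0" if "i > n" using x that unfolding face_cone_def K by fastforce
    then show "F' (F x) i = x i" using mF[OF x] by (auto simp: F'_def) (simp add: F_def)
  qed
  have "pl_map (face_cone ?K) F" unfolding pl_map_def F_def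
  proof
    fix i show "pl_fun (face_cone ?K) (\<lambda>x. if i < n then x i - x n else 0)"
      by (cases "i < n") (simp_all add: pl_fun_zero pl_fun_coord pl_fun_diff)
  qed
  moreover have "pl_map (coords {..<n}) F'" unfolding pl_map_def F'_def
  proof
    have pm: "pl_fun (coords {..<n}) m" unfolding m_def by (rule pl_fun_Min)
    fix i show "pl_fun (coords {..<n}) (\<lambda>u. if i < n then u i - m u else if i = n then - m u else 0)"
      by (cases "i < n"; cases "i = n") (simp_all add: pl_fun_zero pl_fun_coord pl_fun_diff pl_fun_uminus pm)
  qed
  ultimately show ?thesis unfolding pl_iso_def using FI F'K FF' F'F by blast
qed

lemma pl_sphereI:
  fixes I :: "'b set"
  assumes K: "asc K" and iso: "pl_iso (face_cone K) (coords I) F F'" and I: "finite I" "int (card I) = k + 1"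
  shows "pl_sphere k K"
proof -
  define n where "n = card I"
  have k: "k + 1 = int n" using I(2) by (simp add: n_def)
  obtain h where h: "bij_betw h I {..<n}"
    using I(1) unfolding n_def by (metis bij_betw_iff_card card_lessThan finite_lessThan)
  obtain H H' where H: "pl_iso (coords I) (coords {..<n}) H H'" using pl_iso_coords[OF h] by blast
  obtain E E' where E: "pl_iso (face_cone (simplex_boundary (int n))) (coords {..<n}) E E'"
    using pl_iso_simplex_boundary by blast
  have "pl_iso (face_cone K) (face_cone (simplex_boundary (int n)))
      (\<lambda>x. E' (H (F x))) (\<lambda>x. F' (H' (E x)))"
    by (rule pl_iso_trans[OF pl_iso_trans[OF iso H subset_refl I(1)] pl_iso_sym[OF E] subset_refl]) simp
  then have "pl_homeomorphic K (simplex_boundary (int n))"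
    by (intro pl_iso_imp_pl_homeomorphic[OF K asc_simplex_boundary]) auto
  then show ?thesis unfolding pl_sphere_def k using K I(2) by simp
qed

section \<open>The construction\<close>

text \<open>The antipodal map is \<open>uminus\<close>. In \<open>next_ball N a B\<close> the equator \<open>symm B\<close> has the vertices
  \<open>\<plusminus>1, \<dots>, \<plusminus>N\<close> and \<open>B \<inter> -B\<close> has the vertices \<open>\<plusminus>1, \<dots>, \<plusminus>a\<close>. In the cone over the equator, the edges from
  the apex to \<open>1, \<dots>, a\<close> are subdivided in this order, with midpoints \<open>N + 1, \<dots>, N + a\<close>; then the
  apex is split into \<open>p = N + a + 1\<close>, which sees \<open>B\<close>, and \<open>q = N + a + 2\<close>, which sees \<open>-B\<close>.\<close>

definition symm :: "int set set \<Rightarrow> int set set" where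
  "symm K = K \<union> (`) uminus ` K"

definition collapse :: "int \<Rightarrow> int \<Rightarrow> int \<Rightarrow> int" where
  "collapse N a v = (if N < v \<and> v \<le> N + a then v - N else v)"

text \<open>The faces are described without performing the subdivisions: dropping the apices and
  moving each midpoint \<open>N + w\<close> back to \<open>w\<close> must give a face of the
  equator. The last clause encodes the order of subdivision. The edge from the apex to
  \<open>v\<close> has disappeared, so \<open>v\<close> is not in the link of the edge that carries
  a later midpoint \<open>N + w\<close>.\<close>

definition next_ball :: "int \<Rightarrow> int \<Rightarrow> int set set \<Rightarrow> int set set" where
  "next_ball N a B = {G. finite G \<and>
     collapse N a ` (G - {N + a + 1, N + a + 2}) \<in> symm B \<and>
     (N + a + 1 \<in> G \<longrightarrow> collapse N a ` (G - {N + a + 1, N + a + 2}) \<in> B) \<and>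
     (N + a + 2 \<in> G \<longrightarrow> collapse N a ` (G - {N + a + 1, N + a + 2}) \<in> (`) uminus ` B) \<and>
     (\<forall>v\<in>G. 1 \<le> v \<and> v \<le> a \<longrightarrow>
        N + a + 1 \<notin> G \<and> N + a + 2 \<notin> G \<and> (\<forall>w. v < w \<and> w \<le> a \<longrightarrow> N + w \<notin> G))}"

lemma uminus_image_mem: "F \<in> (`) uminus ` K \<longleftrightarrow> uminus ` F \<in> (K :: int set set)"
proof
  assume "uminus ` F \<in> K"
  then show "F \<in> (`) uminus ` K" by (intro image_eqI[of _ _ "uminus ` F"]) (auto simp: image_image)
qed (auto simp: image_image)

lemma in_symm: "F \<in> symm K \<longleftrightarrow> F \<in> K \<or> uminus ` F \<in> K"
  unfolding symm_def Un_iff uminus_image_mem ..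

lemma symm_uminus: "F \<in> symm K \<Longrightarrow> uminus ` F \<in> symm K"
  by (auto simp: symm_def image_image)

lemma asc_symm: "asc K \<Longrightarrow> asc (symm K)"
  using asc_image[of K uminus] unfolding symm_def asc_def by blast

lemma uminus_cone: "x \<in> face_cone ((`) uminus ` K) \<longleftrightarrow> (\<lambda>v. x (- v)) \<in> face_cone (K :: int set set)"
proof -
  have e: "{v. x (- v) \<noteq> 0} = uminus ` {v. x v \<noteq> 0}"
    by (auto intro!: image_eqI[of _ _ "- _"])
  have "(\<forall>v. 0 \<le> x v) \<longleftrightarrow> (\<forall>v. 0 \<le> x (- v))" by (metis minus_minus)
  then show ?thesis unfolding face_cone_def mem_Collect_eq e uminus_image_mem by simp
qed

lemma face_cone_Un: "face_cone (K \<union> L) = face_cone K \<union> face_cone L"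
  by (auto simp: face_cone_def)

lemma face_cone_symm: "x \<in> face_cone (symm K) \<longleftrightarrow> x \<in> face_cone K \<or> (\<lambda>v. x (- v)) \<in> face_cone K"
  unfolding symm_def face_cone_Un Un_iff uminus_cone ..

lemma face_cone_symm_uminus: "x \<in> face_cone (symm K) \<Longrightarrow> (\<lambda>v. x (- v)) \<in> face_cone (symm K)"
  unfolding face_cone_symm by auto

text \<open>A supply \<open>k\<close> fills the capacities \<open>x 1\<close>, \<open>x 2\<close>,
  ... in order, each as far as the supply lasts; in the end either the supply or the total capacity
  is exhausted.\<close>

lemma greedy_fill:
  fixes x :: "int \<Rightarrow> real"
  assumes "0 \<le> a" "\<And>v. 0 \<le> x v" "0 \<le> k"
  shows "(\<Sum>v\<in>{1..a}. min (x v) (max 0 (k - (\<Sum>w\<in>{1..<v}. x w)))) = min k (\<Sum>v\<in>{1..a}. x v)"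
  using assms(1)
proof (induction a rule: int_ge_induct)
  case (step i)
  have e: "{1..i + 1} = insert (i + 1) {1..i}" "{1..<i + 1} = {1..i}" using step.hyps by auto
  have "0 \<le> (\<Sum>v\<in>{1..i}. x v)" using assms(2) by (simp add: sum_nonneg)
  moreover have "(\<Sum>v\<in>{1..i + 1}. f v) = f (i + 1) + (\<Sum>v\<in>{1..i}. f v)" for f :: "int \<Rightarrow> real"
    unfolding e(1) by simp
  ultimately show ?case using step.IH assms(2)[of "i + 1"] assms(3) by (simp add: e(2) min_def max_def)
qed (use assms in simp)

text \<open>The induction invariant, with \<open>N\<close> and \<open>a\<close> the numbers of
  antipodal pairs of \<open>symm B\<close> and of its equator. By \<open>vB\<close>, both
  \<open>v\<close> and \<open>- v\<close> can be vertices of \<open>B\<close> only if they are among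
  \<plusminus>1, ..., \<plusminus>a. By \<open>hemi\<close> and \<open>equi\<close>, the cones over
  \<open>B\<close> and its antipode become the two closed half spaces.\<close>

locale hemisphere =
  fixes N a :: int and B :: "int set set" and n :: nat
    and \<Phi> :: "(int \<Rightarrow> real) \<Rightarrow> nat \<Rightarrow> real" and \<Phi>' :: "(nat \<Rightarrow> real) \<Rightarrow> int \<Rightarrow> real"
  assumes a0: "0 \<le> a" and aN: "a \<le> N" and ascB: "asc B"
    and vB: "v \<in> verts B \<Longrightarrow> - a \<le> v \<and> v \<le> N"
    and vS: "verts (symm B) = {-N..N} - {0}"
    and noanti: "{v, w} \<in> symm B \<Longrightarrow> {- v, w} \<notin> symm B"
    and iso: "pl_iso (face_cone (symm B)) (coords {..n}) \<Phi> \<Phi>'"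
    and equi: "x \<in> face_cone (symm B) \<Longrightarrow> \<Phi> (\<lambda>v. x (- v)) = (\<lambda>i. - \<Phi> x i)"
    and hemi: "x \<in> face_cone (symm B) \<Longrightarrow> x \<in> face_cone B \<longleftrightarrow> 0 \<le> \<Phi> x n"
begin

abbreviation "S \<equiv> symm B"
abbreviation "p \<equiv> N + a + 1"
abbreviation "q \<equiv> N + a + 2"
abbreviation "B' \<equiv> next_ball N a B"

section \<open>Combinatorics of the next ball\<close>

lemma ascS: "asc S" by (rule asc_symm[OF ascB])

lemma collapse_id: "v \<le> N \<Longrightarrow> collapse N a v = v"
  by (simp add: collapse_def)

lemma face_bounds:
  assumes "G \<in> S" "v \<in> G"
  shows "v \<noteq> 0" "- N \<le> v" "v \<le> N"
proof -
  have "v \<in> verts S" using assms by (auto simp: verts_def)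
  then show "v \<noteq> 0" "- N \<le> v" "v \<le> N" using vS by auto
qed

lemma next_bounds:
  assumes G: "G \<in> B'" and v: "v \<in> G"
  shows "v \<noteq> 0" "- N \<le> v" "v \<le> q"
proof -
  have "v \<noteq> 0 \<and> - N \<le> v \<and> v \<le> q"
  proof (cases "v = p \<or> v = q")
    case True
    then show ?thesis using a0 aN by auto
  next
    case False
    then have "collapse N a v \<in> collapse N a ` (G - {p, q})" using v by blast
    moreover have "collapse N a ` (G - {p, q}) \<in> S" using G by (simp add: next_ball_def)
    ultimately have "collapse N a v \<noteq> 0" "- N \<le> collapse N a v" "collapse N a v \<le> N"
      using face_bounds by blast+
    then show ?thesis using a0 aN by (auto simp: collapse_def split: if_splits)
  qed
  then show "v \<noteq> 0" "- N \<le> v" "v \<le> q" by auto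
qed

lemma next_ball_small:
  assumes "G \<subseteq> {..N}"
  shows "G \<in> B' \<longleftrightarrow> G \<in> S"
proof -
  have pq: "p \<notin> G" "q \<notin> G" "\<And>w. 0 < w \<Longrightarrow> N + w \<notin> G" using assms a0 by auto
  have "collapse N a ` G = G" using assms by (force simp: collapse_id)
  then have e: "collapse N a ` (G - {p, q}) = G" using pq by simp
  have "finite G" if "G \<in> S" using that ascS by (auto simp: asc_def)
  then show ?thesis unfolding next_ball_def mem_Collect_eq e using pq by auto
qed

lemma asc_next: "asc B'"
  unfolding asc_def
proof (intro conjI ballI allI impI)
  have "B' \<subseteq> Pow {-N..q}" using next_bounds by force
  then show "finite B'" by (rule finite_subset) simp
  have "{} \<in> S" using ascS by (simp add: asc_def)
  then show "{} \<in> B'" by (subst next_ball_small) auto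
  show "finite F" if "F \<in> B'" for F using that by (simp add: next_ball_def)
  fix F G assume F: "F \<in> B'" and G: "G \<subseteq> F"
  have sub: "collapse N a ` (G - {p, q}) \<subseteq> collapse N a ` (F - {p, q})" using G by blast
  have down: "collapse N a ` (G - {p, q}) \<in> K" if "asc K" "collapse N a ` (F - {p, q}) \<in> K" for K
    using asc_subset[OF that sub] .
  have fin: "finite G" using F G by (auto simp: next_ball_def intro: finite_subset)
  show "G \<in> B'"
    using F G down[OF ascS] down[OF ascB] down[OF asc_image[OF ascB]] fin
    unfolding next_ball_def by (auto dest!: subsetD[OF G])
qed

text \<open>In \<open>B'\<close> the vertices of absolute value above \<open>N\<close> occur only
  with positive sign, so a face of both \<open>B'\<close> and its antipode has all its vertices on
  the equator.\<close>

lemma next_inter: "G \<in> B' \<Longrightarrow> uminus ` G \<in> B' \<Longrightarrow> G \<in> S"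
proof -
  assume G: "G \<in> B'" "uminus ` G \<in> B'"
  have "v \<le> N" if "v \<in> G" for v using next_bounds(2)[OF G(2), of "- v"] that by auto
  then show "G \<in> S" using G(1) next_ball_small[of G] by auto
qed

lemma S_next: "G \<in> S \<Longrightarrow> G \<in> B'"
  using next_ball_small[of G] face_bounds(3)[of G] by auto

lemma verts_next: "verts (symm B') = {-q..q} - {0}"
proof -
  have pos: "{v} \<in> B'" if v: "1 \<le> v" "v \<le> q" for v
  proof -
    consider "v \<le> N" | "N < v" "v \<le> N + a" | "v = p" | "v = q" using v by linarith
    then show ?thesis
    proof cases
      case 1
      then have "v \<in> verts S" using v vS by auto
      then have "{v} \<in> S" using ascS by (auto simp: verts_def asc_def)
      then show ?thesis by (rule S_next)
    next
      case 2
      then have "v - N \<in> verts S" using v vS aN by auto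
      then have *: "{v - N} \<in> S" using ascS by (auto simp: verts_def asc_def)
      have "{v} - {p, q} = {v}" "collapse N a v = v - N" using 2 by (auto simp: collapse_def)
      then show ?thesis using * 2 aN unfolding next_ball_def by auto
    next
      case 3
      have "{v} - {p, q} = {}" using 3 by auto
      then show ?thesis using 3 aN a0 ascS ascB unfolding next_ball_def asc_def by auto
    next
      case 4
      have "{v} - {p, q} = {}" using 4 by auto
      then show ?thesis using 4 aN a0 ascS ascB unfolding next_ball_def asc_def by auto
    qed
  qed
  show ?thesis
  proof
    show "verts (symm B') \<subseteq> {-q..q} - {0}"
    proof
      fix v assume "v \<in> verts (symm B')"
      then obtain G where "v \<in> G" "G \<in> symm B'" by (auto simp: verts_def)
      then have G: "v \<in> G" "G \<in> B' \<or> uminus ` G \<in> B'" by (simp_all only: in_symm)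
      from G(2) show "v \<in> {-q..q} - {0}"
      proof
        assume "G \<in> B'"
        then show ?thesis using next_bounds[of G v] G(1) a0 aN by auto
      next
        assume "uminus ` G \<in> B'"
        then show ?thesis using next_bounds[of "uminus ` G" "- v"] G(1) a0 aN by auto
      qed
    qed
    show "{-q..q} - {0} \<subseteq> verts (symm B')"
    proof
      fix v assume v: "v \<in> {-q..q} - {0}"
      have "{v} \<in> symm B'"
      proof (cases "0 < v")
        case True
        then show ?thesis using pos[of v] v by (auto simp: symm_def)
      next
        case False
        then have "{- v} \<in> symm B'" using pos[of "- v"] v by (auto simp: symm_def)
        from symm_uminus[OF this] show ?thesis by simp
      qed
      then show "v \<in> verts (symm B')" by (auto simp: verts_def)
    qed
  qed
qed

text \<open>Both signs of \<open>v\<close> occur in \<open>B'\<close>, so \<open>v\<close> is on the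
  equator. If \<open>w\<close> is an equatorial vertex or a midpoint, collapsing yields the same
  configuration in \<open>S\<close>. If \<open>w\<close> is an apex, \<open>v\<close> and
  \<open>- v\<close> both lie in \<open>B\<close>, hence are among \<plusminus>1, ...,
  \<plusminus>a, and the positive one has lost its edge to the apex.\<close>

lemma noanti_next_ball: "{v, w} \<in> B' \<Longrightarrow> {- v, w} \<notin> B'"
proof
  assume vw: "{v, w} \<in> B'" "{- v, w} \<in> B'"
  have v: "- N \<le> v" "v \<le> N" "v \<noteq> 0"
    using next_bounds[OF vw(1), of v] next_bounds[OF vw(2), of "- v"] by auto
  have w: "- N \<le> w" "w \<le> q" using next_bounds[OF vw(1), of w] by auto
  have apex: False if K: "{v} \<in> K" "{- v} \<in> K" "K = B \<or> K = (`) uminus ` B" and w: "w = p \<or> w = q" for K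
  proof -
    have "{v} \<in> B" "{- v} \<in> B" using K uminus_image_mem[of "{v}" B] uminus_image_mem[of "{- v}" B] by auto
    then have "- a \<le> v" "v \<le> a" using vB[of v] vB[of "- v"] by (force simp: verts_def)+
    moreover have "\<not> (1 \<le> v \<and> v \<le> a)" "\<not> (1 \<le> - v \<and> - v \<le> a)"
      using vw w unfolding next_ball_def by blast+
    ultimately show False using v(3) by linarith
  qed
  have ne: "v \<noteq> p" "v \<noteq> q" "- v \<noteq> p" "- v \<noteq> q" using v a0 by linarith+
  have D2: "{x, y} - {p, q} = {x, y}" if "x \<noteq> p" "x \<noteq> q" "y \<noteq> p" "y \<noteq> q" for x y using that by blast
  have D1: "{x, y} - {p, q} = {x}" if "x \<noteq> p" "x \<noteq> q" "y = p \<or> y = q" for x y using that by blast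
  consider "w \<le> N" | "N < w" "w \<le> N + a" | "w = p" | "w = q" using w by linarith
  then show False
  proof cases
    case 1
    then have *: "{v, w} \<subseteq> {..N}" "{- v, w} \<subseteq> {..N}" using v by auto
    have "{v, w} \<in> S" using vw(1) next_ball_small[OF *(1)] by simp
    moreover have "{- v, w} \<in> S" using vw(2) next_ball_small[OF *(2)] by simp
    ultimately show False using noanti by blast
  next
    case 2
    then have w': "w \<noteq> p" "w \<noteq> q" by linarith+
    have "{v, w} - {p, q} = {v, w}" "{- v, w} - {p, q} = {- v, w}"
      by (rule D2[OF ne(1,2) w'], rule D2[OF ne(3,4) w'])
    moreover have "collapse N a v = v" "collapse N a (- v) = - v" "collapse N a w = w - N"
      using v 2 by (auto simp: collapse_def)
    ultimately have "{v, w - N} \<in> S" "{- v, w - N} \<in> S" using vw by (simp_all add: next_ball_def)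
    then show False using noanti by blast
  next
    case 3
    have "{v, w} - {p, q} = {v}" "{- v, w} - {p, q} = {- v}" "p \<in> {v, w}" "p \<in> {- v, w}"
      using D1[OF ne(1,2)] D1[OF ne(3,4)] 3 by simp_all
    then have "{v} \<in> B" "{- v} \<in> B"
      using vw v collapse_id[of v] collapse_id[of "- v"] unfolding next_ball_def by auto
    then show False using apex 3 by blast
  next
    case 4
    have "{v, w} - {p, q} = {v}" "{- v, w} - {p, q} = {- v}" "q \<in> {v, w}" "q \<in> {- v, w}"
      using D1[OF ne(1,2)] D1[OF ne(3,4)] 4 by simp_all
    then have "{v} \<in> (`) uminus ` B" "{- v} \<in> (`) uminus ` B"
      using vw v collapse_id[of v] collapse_id[of "- v"] unfolding next_ball_def by auto
    then show False using apex 4 by blast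
  qed
qed

text \<open>The two edges may lie on different sides. Reflecting one of them then produces a vertex,
  \<open>v\<close> or \<open>- v\<close>, joined to both \<open>w\<close> and \<open>- w\<close>
  within \<open>B'\<close>, so the previous lemma applies with the roles exchanged.\<close>

lemma noanti_next: "{v, w} \<in> symm B' \<Longrightarrow> {- v, w} \<notin> symm B'"
proof
  assume "{v, w} \<in> symm B'" "{- v, w} \<in> symm B'"
  then have "({v, w} \<in> B' \<or> {- v, - w} \<in> B') \<and> ({- v, w} \<in> B' \<or> {v, - w} \<in> B')"
    unfolding in_symm by simp
  then show False
    using noanti_next_ball[of v w] noanti_next_ball[of v "- w"] noanti_next_ball[of w v]
      noanti_next_ball[of w "- v"] by (auto simp: insert_commute)
qed

section \<open>The cone over the next ball in coordinates\<close>

definition coll :: "(int \<Rightarrow> real) \<Rightarrow> int \<Rightarrow> real" where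
  "coll y = (\<lambda>v. if - N \<le> v \<and> v \<le> N then y v + (if 1 \<le> v \<and> v \<le> a then y (N + v) else 0) else 0)"

definition mass :: "(int \<Rightarrow> real) \<Rightarrow> real" where
  "mass x = (\<Sum>v\<in>{1..a}. x v)"

text \<open>\<open>coll\<close> is the linear extension of \<open>collapse\<close> that forgets
  \<open>p\<close> and \<open>q\<close>. Nonnegativity prevents cancellation when the coordinates of
  \<open>v\<close> and \<open>N + v\<close> are merged.\<close>

lemma support_coll:
  assumes y0: "\<And>v. 0 \<le> y v" and y: "\<And>v. y v \<noteq> 0 \<Longrightarrow> - N \<le> v \<and> v \<le> q"
  shows "{v. coll y v \<noteq> 0} = collapse N a ` ({v. y v \<noteq> 0} - {p, q})"
proof (intro set_eqI iffI)
  fix v assume "v \<in> {v. coll y v \<noteq> 0}"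
  then have v: "- N \<le> v" "v \<le> N" "y v \<noteq> 0 \<or> 1 \<le> v \<and> v \<le> a \<and> y (N + v) \<noteq> 0"
    by (auto simp: coll_def split: if_splits)
  from v(3) show "v \<in> collapse N a ` ({v. y v \<noteq> 0} - {p, q})"
  proof
    assume "y v \<noteq> 0"
    then show ?thesis using v a0 by (intro image_eqI[of _ _ v]) (auto simp: collapse_def)
  next
    assume "1 \<le> v \<and> v \<le> a \<and> y (N + v) \<noteq> 0"
    then show ?thesis by (intro image_eqI[of _ _ "N + v"]) (auto simp: collapse_def)
  qed
next
  fix v assume "v \<in> collapse N a ` ({v. y v \<noteq> 0} - {p, q})"
  then obtain u where u: "v = collapse N a u" "y u \<noteq> 0" "u \<noteq> p" "u \<noteq> q" by blast
  have ub: "- N \<le> u" "u \<le> N + a" using y[OF u(2)] u(3,4) by auto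
  show "v \<in> {v. coll y v \<noteq> 0}"
  proof (cases "u \<le> N")
    case True
    then have "v = u" using u(1) by (simp add: collapse_id)
    then show ?thesis using True ub u(2) y0[of u] y0[of "N + u"] by (auto simp: coll_def add_nonneg_eq_0_iff)
  next
    case False
    then have "v = u - N" using u(1) ub by (simp add: collapse_def)
    then show ?thesis using False ub u(2) y0[of u] y0[of "u - N"] aN by (auto simp: coll_def add_nonneg_eq_0_iff)
  qed
qed

lemma coll_nonneg: "(\<And>v. 0 \<le> y v) \<Longrightarrow> 0 \<le> coll y v"
  by (simp add: coll_def)

lemma cone_next:
  "y \<in> face_cone B' \<longleftrightarrow> (\<forall>v. 0 \<le> y v) \<and> (\<forall>v. y v \<noteq> 0 \<longrightarrow> - N \<le> v \<and> v \<le> q) \<and> coll y \<in> face_cone S \<and>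
     (y p \<noteq> 0 \<longrightarrow> coll y \<in> face_cone B) \<and> (y q \<noteq> 0 \<longrightarrow> coll y \<in> face_cone ((`) uminus ` B)) \<and>
     (\<forall>v. 1 \<le> v \<longrightarrow> v \<le> a \<longrightarrow> y v \<noteq> 0 \<longrightarrow> y p = 0 \<and> y q = 0 \<and> (\<forall>w. v < w \<longrightarrow> w \<le> a \<longrightarrow> y (N + w) = 0))"
    (is "_ \<longleftrightarrow> ?R")
proof (cases "(\<forall>v. 0 \<le> y v) \<and> (\<forall>v. y v \<noteq> 0 \<longrightarrow> - N \<le> v \<and> v \<le> q)")
  case True
  then have y0: "\<And>v. 0 \<le> y v" and yb: "\<And>v. y v \<noteq> 0 \<Longrightarrow> - N \<le> v \<and> v \<le> q" by auto
  let ?G = "{v. y v \<noteq> 0}"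
  have "?G \<subseteq> {-N..q}" using yb by auto
  then have fin: "finite ?G" by (rule finite_subset) simp
  have "{v. coll y v \<noteq> 0} = collapse N a ` (?G - {p, q})"
    by (rule support_coll[OF y0]) (rule yb)
  then have c: "coll y \<in> face_cone K \<longleftrightarrow> collapse N a ` (?G - {p, q}) \<in> K" for K
    using coll_nonneg[of y, OF y0] by (simp add: face_cone_def)
  have "y \<in> face_cone B' \<longleftrightarrow> ?G \<in> B'" using y0 by (simp add: face_cone_def)
  then show ?thesis unfolding c next_ball_def using fin True by auto
next
  case False
  have "y \<notin> face_cone B'"
  proof
    assume "y \<in> face_cone B'"
    then have "\<forall>v. 0 \<le> y v" "{v. y v \<noteq> 0} \<in> B'" by (auto simp: face_cone_def)
    moreover from this(2) have "- N \<le> v \<and> v \<le> q" if "y v \<noteq> 0" for v using next_bounds[of _ v] that by blast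
    ultimately show False using False by blast
  qed
  then show ?thesis using False by blast
qed

lemma plF: "pl_fun (face_cone S) (\<lambda>x. \<Phi> x i)" "pl_fun (coords {..n}) (\<lambda>u. \<Phi>' u v)"
  using iso by (simp_all add: pl_iso_def pl_map_def)

lemma Phi_coords: "x \<in> face_cone S \<Longrightarrow> \<Phi> x \<in> coords {..n}"
  using iso by (auto simp: pl_iso_def)

lemma Phi'_cone: "u \<in> coords {..n} \<Longrightarrow> \<Phi>' u \<in> face_cone S"
  using iso by (auto simp: pl_iso_def)

lemma Phi'_Phi: "x \<in> face_cone S \<Longrightarrow> \<Phi>' (\<Phi> x) = x"
  using iso by (auto simp: pl_iso_def)

lemma Phi_Phi': "u \<in> coords {..n} \<Longrightarrow> \<Phi> (\<Phi>' u) = u"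
  using iso by (auto simp: pl_iso_def)

lemma hemi_uminus:
  assumes "x \<in> face_cone S"
  shows "x \<in> face_cone ((`) uminus ` B) \<longleftrightarrow> \<Phi> x n \<le> 0"
  using hemi[OF face_cone_symm_uminus[OF assms]] equi[OF assms] by (simp add: uminus_cone)

lemma S_zero_outside: "x \<in> face_cone S \<Longrightarrow> v < - N \<or> N < v \<Longrightarrow> x v = 0"
  by (rule cone_zero_outside) (auto simp: vS)

lemma coll_S: "x \<in> face_cone S \<Longrightarrow> coll x = x"
  using S_zero_outside[of x] by (auto simp: coll_def fun_eq_iff)

lemma cone_S_next: "x \<in> face_cone S \<Longrightarrow> x \<in> face_cone B'"
  using S_next by (auto simp: face_cone_def)

section \<open>Half-space coordinates of the next ball and their inverse\<close>

definition up0 :: "(int \<Rightarrow> real) \<Rightarrow> nat \<Rightarrow> real" where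
  "up0 y = (\<lambda>i. \<Phi> (coll y) i + (if i = n then y p - y q else 0))"

definition rim :: "(int \<Rightarrow> real) \<Rightarrow> real" where
  "rim y = (\<Sum>v\<in>{1..a}. y (N + v))"

text \<open>Here \<open>p\<close> and \<open>q\<close> are moved apart along the last coordinate of the equator, and the height
  is measured from the equatorial point below rather than from the point \<open>coll y\<close>.\<close>

definition up :: "(int \<Rightarrow> real) \<Rightarrow> nat \<Rightarrow> real" where
  "up y = (\<lambda>i. if i = Suc n then y p + y q + rim y - mass (coll y) + mass (\<Phi>' (up0 y)) else up0 y i)"

definition trunc :: "(nat \<Rightarrow> real) \<Rightarrow> nat \<Rightarrow> real" where
  "trunc u = (\<lambda>i. if i \<le> n then u i else 0)"

text \<open>For \<open>u = up y\<close> this is the apex mass \<open>y p + y q\<close>. If that mass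
  is 0, the height is \<open>rim y\<close>, at most \<open>mass (coll y)\<close>; otherwise
  \<open>rim y = mass (coll y)\<close>, and the apex mass is the excess over the graph of
  \<open>mass\<close> on the equator.\<close>

definition ht :: "(nat \<Rightarrow> real) \<Rightarrow> real" where
  "ht u = max 0 (u (Suc n) - mass (\<Phi>' (trunc u)))"

text \<open>The share of \<open>p\<close> in the apex mass. As \<open>p\<close> occurs only over
  \<open>B\<close> and \<open>q\<close> only over its antipode, a nonzero coordinate
  \<open>n\<close> of the equatorial point leaves a single apex and pushes the clamped value to
  \<open>ht u\<close> or 0. Where that coordinate is 0, \<open>u n = y p - y q\<close> and the half
  sum is \<open>y p\<close>.\<close>

definition cp :: "(nat \<Rightarrow> real) \<Rightarrow> real" where
  "cp u = min (ht u) (max 0 ((ht u + u n) / 2))"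

definition base0 :: "(nat \<Rightarrow> real) \<Rightarrow> nat \<Rightarrow> real" where
  "base0 u = (\<lambda>i. trunc u i - (if i = n then cp u - (ht u - cp u) else 0))"

definition base :: "(nat \<Rightarrow> real) \<Rightarrow> int \<Rightarrow> real" where
  "base u = \<Phi>' (base0 u)"

text \<open>The top coordinate of \<open>up\<close>, solved for
  \<open>y p + y q + rim y\<close>.\<close>

definition lev :: "(nat \<Rightarrow> real) \<Rightarrow> real" where
  "lev u = u (Suc n) - mass (\<Phi>' (trunc u)) + mass (base u)"

text \<open>The mass at the midpoint \<open>N + v\<close>. Mass left at \<open>v\<close> excludes
  mass at later midpoints and at the apices, so the supply \<open>lev u\<close> has to fill
  \<open>base u 1\<close>, \<open>base u 2\<close>, ... in this order.\<close>

definition fill :: "(nat \<Rightarrow> real) \<Rightarrow> int \<Rightarrow> real" where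
  "fill u v = min (base u v) (max 0 (lev u - (\<Sum>w\<in>{1..<v}. base u w)))"

definition down :: "(nat \<Rightarrow> real) \<Rightarrow> int \<Rightarrow> real" where
  "down u = (\<lambda>v. if v = p then cp u else if v = q then ht u - cp u
     else if N < v \<and> v \<le> N + a then fill u (v - N)
     else if 1 \<le> v \<and> v \<le> a then base u v - fill u v else base u v)"

definition upper :: "(nat \<Rightarrow> real) set" where
  "upper = {u \<in> coords {..Suc n}. 0 \<le> u (Suc n)}"

lemma trunc_coords: "trunc u \<in> coords {..n}"
  by (intro coordsI) (simp add: trunc_def)

lemma base0_coords: "base0 u \<in> coords {..n}"
  by (intro coordsI) (simp add: base0_def trunc_def)

lemma base_S: "base u \<in> face_cone S"
  unfolding base_def by (rule Phi'_cone[OF base0_coords])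

lemma mass_nonneg: "x \<in> face_cone S \<Longrightarrow> 0 \<le> mass x"
  unfolding mass_def by (intro sum_nonneg cone_nonneg)

section \<open>\<open>down\<close> is a left inverse of \<open>up\<close>\<close>

lemma nextD:
  assumes "y \<in> face_cone B'"
  shows "0 \<le> y v" "y v \<noteq> 0 \<Longrightarrow> - N \<le> v \<and> v \<le> q" "coll y \<in> face_cone S"
    "y p \<noteq> 0 \<Longrightarrow> 0 \<le> \<Phi> (coll y) n" "y q \<noteq> 0 \<Longrightarrow> \<Phi> (coll y) n \<le> 0"
    "1 \<le> v \<Longrightarrow> v \<le> a \<Longrightarrow> y v \<noteq> 0 \<Longrightarrow> y p = 0 \<and> y q = 0"
    "1 \<le> v \<Longrightarrow> v \<le> a \<Longrightarrow> y v \<noteq> 0 \<Longrightarrow> v < w \<Longrightarrow> w \<le> a \<Longrightarrow> y (N + w) = 0"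
proof -
  note c = assms[unfolded cone_next]
  show "0 \<le> y v" "y v \<noteq> 0 \<Longrightarrow> - N \<le> v \<and> v \<le> q" and S: "coll y \<in> face_cone S" using c by simp_all
  show "y p \<noteq> 0 \<Longrightarrow> 0 \<le> \<Phi> (coll y) n" using c hemi[OF S] by simp
  show "y q \<noteq> 0 \<Longrightarrow> \<Phi> (coll y) n \<le> 0" using c hemi_uminus[OF S] by simp
  show "1 \<le> v \<Longrightarrow> v \<le> a \<Longrightarrow> y v \<noteq> 0 \<Longrightarrow> y p = 0 \<and> y q = 0" using c by simp
  show "1 \<le> v \<Longrightarrow> v \<le> a \<Longrightarrow> y v \<noteq> 0 \<Longrightarrow> v < w \<Longrightarrow> w \<le> a \<Longrightarrow> y (N + w) = 0" using c by simp
qed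

lemma up0_coords:
  assumes "y \<in> face_cone B'"
  shows "up0 y \<in> coords {..n}"
  using coords_zero[OF Phi_coords[OF nextD(3)[OF assms]]] by (intro coordsI) (simp add: up0_def)

lemma coll_low: "1 \<le> v \<Longrightarrow> v \<le> a \<Longrightarrow> coll y v = y v + y (N + v)"
  using a0 aN by (simp add: coll_def)

lemma rim_le_mass:
  assumes "y \<in> face_cone B'"
  shows "rim y \<le> mass (coll y)"
  unfolding rim_def mass_def using nextD(1)[OF assms] by (intro sum_mono) (simp add: coll_low)

text \<open>A face with an apex contains none of the vertices 1, ..., a, so all the mass that
  collapses to them comes from the midpoints.\<close>

lemma rim_eq_mass:
  assumes "y \<in> face_cone B'" "y p \<noteq> 0 \<or> y q \<noteq> 0"
  shows "rim y = mass (coll y)"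
proof -
  have "y v = 0" if "1 \<le> v" "v \<le> a" for v using nextD(6)[OF assms(1) that] assms(2) by blast
  then show ?thesis unfolding rim_def mass_def by (intro sum.cong) (simp_all add: coll_low)
qed

lemma rim_nonneg: "y \<in> face_cone B' \<Longrightarrow> 0 \<le> rim y"
  unfolding rim_def using nextD(1) by (auto intro: sum_nonneg)

lemma up0_plain:
  assumes "y \<in> face_cone B'" "y p = 0" "y q = 0"
  shows "up0 y = \<Phi> (coll y)" "\<Phi>' (up0 y) = coll y"
proof -
  show "up0 y = \<Phi> (coll y)" using assms(2,3) by (simp add: up0_def fun_eq_iff)
  then show "\<Phi>' (up0 y) = coll y" using Phi'_Phi[OF nextD(3)[OF assms(1)]] by simp
qed

lemma up_upper:
  assumes y: "y \<in> face_cone B'"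
  shows "up y \<in> upper"
proof -
  have "0 \<le> up y (Suc n)"
  proof (cases "y p = 0 \<and> y q = 0")
    case True
    then show ?thesis using up0_plain[OF y] rim_nonneg[OF y] by (simp add: up_def)
  next
    case False
    then have "rim y = mass (coll y)" by (intro rim_eq_mass[OF y]) blast
    then show ?thesis
      using nextD(1)[OF y, of p] nextD(1)[OF y, of q] mass_nonneg[OF Phi'_cone[OF up0_coords[OF y]]]
      by (simp add: up_def)
  qed
  moreover have "up y \<in> coords {..Suc n}"
    using coords_zero[OF up0_coords[OF y]] by (intro coordsI) (simp add: up_def)
  ultimately show ?thesis by (simp add: upper_def)
qed

lemma trunc_up: "y \<in> face_cone B' \<Longrightarrow> trunc (up y) = up0 y"
  using coords_zero[OF up0_coords, of y] by (auto simp: trunc_def up_def fun_eq_iff)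

lemma ht_up:
  assumes y: "y \<in> face_cone B'"
  shows "ht (up y) = y p + y q"
proof -
  have e: "up y (Suc n) - mass (\<Phi>' (trunc (up y))) = y p + y q + rim y - mass (coll y)"
    unfolding trunc_up[OF y] by (simp add: up_def)
  show ?thesis
  proof (cases "y p = 0 \<and> y q = 0")
    case True
    then show ?thesis unfolding ht_def e using rim_le_mass[OF y] by simp
  next
    case False
    then have "rim y = mass (coll y)" by (intro rim_eq_mass[OF y]) blast
    then show ?thesis unfolding ht_def e using nextD(1)[OF y, of p] nextD(1)[OF y, of q] by simp
  qed
qed

lemma cp_up:
  assumes y: "y \<in> face_cone B'"
  shows "cp (up y) = y p"
proof -
  have u: "up y n = \<Phi> (coll y) n + (y p - y q)" by (simp add: up_def up0_def)
  have nn: "0 \<le> y p" "0 \<le> y q" using nextD(1)[OF y] by auto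
  show ?thesis
    unfolding cp_def ht_up[OF y] u
    using nextD(4)[OF y] nextD(5)[OF y] nn by (cases "y p = 0"; cases "y q = 0") (auto simp: min_def max_def field_simps)
qed

lemma base_up:
  assumes y: "y \<in> face_cone B'"
  shows "base (up y) = coll y"
proof -
  have "base0 (up y) = \<Phi> (coll y)"
    unfolding base0_def trunc_up[OF y] ht_up[OF y] cp_up[OF y] by (auto simp: up0_def fun_eq_iff)
  then show ?thesis unfolding base_def using Phi'_Phi[OF nextD(3)[OF y]] by simp
qed

lemma lev_up:
  assumes y: "y \<in> face_cone B'"
  shows "lev (up y) = y p + y q + rim y"
  unfolding lev_def base_up[OF y] trunc_up[OF y] by (simp add: up_def)

text \<open>Three cases. If an earlier vertex keeps mass, the supply is used up before
  \<open>v\<close>. Otherwise, if \<open>y v = 0\<close>, the supply covers the whole capacity at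
  \<open>v\<close>; and if \<open>y v \<noteq> 0\<close>, it runs out there, with exactly
  \<open>y (N + v)\<close> left to spend.\<close>

lemma fill_up:
  assumes y: "y \<in> face_cone B'" and v: "1 \<le> v" "v \<le> a"
  shows "fill (up y) v = y (N + v)"
proof -
  have nn: "0 \<le> y w" for w by (rule nextD(1)[OF y])
  have cl: "coll y v = y v + y (N + v)" by (rule coll_low[OF v])
  have split: "{1..a} = {1..<v} \<union> {v..a}" "{v..a} = insert v {v+1..a}" using v by auto
  have sp: "(\<Sum>w\<in>{1..a}. f w) = (\<Sum>w\<in>{1..<v}. f w) + (f v + (\<Sum>w\<in>{v+1..a}. f w))" for f :: "int \<Rightarrow> real"
    unfolding split(1) by (subst sum.union_disjoint) (auto simp: split(2))
  have nns: "0 \<le> (\<Sum>w\<in>{v+1..a}. y (N + w))" using nn by (simp add: sum_nonneg)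
  let ?P = "\<Sum>w\<in>{1..<v}. coll y w"
  have Pge: "(\<Sum>w\<in>{1..<v}. y (N + w)) \<le> ?P" using nn v by (intro sum_mono) (simp add: coll_low)
  have fe: "fill (up y) v = min (coll y v) (max 0 (y p + y q + rim y - ?P))"
    unfolding fill_def base_up[OF y] lev_up[OF y] ..
  have rim: "rim y = (\<Sum>w\<in>{1..<v}. y (N + w)) + (y (N + v) + (\<Sum>w\<in>{v+1..a}. y (N + w)))"
    unfolding rim_def by (rule sp)
  show ?thesis
  proof (cases "\<exists>w. 1 \<le> w \<and> w < v \<and> y w \<noteq> 0")
    case True
    then obtain w where w: "1 \<le> w" "w < v" "y w \<noteq> 0" by blast
    have wa: "w \<le> a" using w v by simp
    have z: "y (N + w') = 0" if "v \<le> w'" "w' \<le> a" for w'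
      using nextD(7)[OF y w(1) wa w(3), of w'] that w(2) by simp
    have "(\<Sum>w\<in>{v+1..a}. y (N + w)) = 0" using z by (intro sum.neutral) auto
    moreover have "y (N + v) = 0" using z[of v] v by simp
    moreover have "y p = 0" "y q = 0" using nextD(6)[OF y w(1) wa w(3)] by auto
    ultimately have "y p + y q + rim y - ?P \<le> 0" using Pge rim by simp
    then show ?thesis unfolding fe using \<open>y (N + v) = 0\<close> cl nn[of v] by simp
  next
    case False
    then have "?P = (\<Sum>w\<in>{1..<v}. y (N + w))" using v by (intro sum.cong) (auto simp: coll_low)
    then have e: "y p + y q + rim y - ?P = y p + y q + y (N + v) + (\<Sum>w\<in>{v+1..a}. y (N + w))"
      using rim by simp
    show ?thesis
    proof (cases "y v = 0")
      case True
      then show ?thesis unfolding fe e cl using nn[of p] nn[of q] nns nn[of "N + v"] by simp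
    next
      case False
      have "(\<Sum>w\<in>{v+1..a}. y (N + w)) = 0" using nextD(7)[OF y v False] by (intro sum.neutral) auto
      moreover have "y p = 0" "y q = 0" using nextD(6)[OF y v False] by auto
      ultimately show ?thesis unfolding fe e cl using nn[of v] nn[of "N + v"] by simp
    qed
  qed
qed

lemma down_up:
  assumes y: "y \<in> face_cone B'"
  shows "down (up y) = y"
proof
  fix v
  have out: "y v = 0" if "v < - N \<or> q < v" using nextD(2)[OF y, of v] that by linarith
  consider "v = p" | "v = q" | "N < v" "v \<le> N + a" | "1 \<le> v" "v \<le> a" | "v < 1" "- N \<le> v"
    | "a < v" "v \<le> N" | "v < - N \<or> q < v" by linarith
  then show "down (up y) v = y v"
  proof cases
    case 1
    then show ?thesis by (simp add: down_def cp_up[OF y])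
  next
    case 2
    then show ?thesis by (simp add: down_def cp_up[OF y] ht_up[OF y])
  next
    case 3
    then show ?thesis using fill_up[OF y, of "v - N"] by (simp add: down_def)
  next
    case 4
    then show ?thesis using fill_up[OF y 4] base_up[OF y] coll_low[OF 4] aN a0 by (simp add: down_def)
  next
    case 5
    then show ?thesis using base_up[OF y] aN a0 by (simp add: down_def coll_def)
  next
    case 6
    then show ?thesis using base_up[OF y] aN a0 by (simp add: down_def coll_def)
  next
    case 7
    then show ?thesis using out base_up[OF y] aN a0 by (auto simp: down_def coll_def)
  qed
qed

section \<open>\<open>down\<close> maps into the cone and is a right inverse of
  \<open>up\<close>\<close>

lemma ht_nonneg: "0 \<le> ht u" by (simp add: ht_def)

lemma cp_bounds: "0 \<le> cp u" "cp u \<le> ht u" using ht_nonneg[of u] by (simp_all add: cp_def)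

lemma base_plain: "ht u = 0 \<Longrightarrow> base u = \<Phi>' (trunc u) \<and> lev u = u (Suc n)"
proof -
  assume h: "ht u = 0"
  then have "cp u = 0" using cp_bounds[of u] by simp
  then have "base0 u = trunc u" using h by (simp add: base0_def fun_eq_iff)
  then show ?thesis by (simp add: base_def lev_def)
qed

lemma lev_pos: "ht u > 0 \<Longrightarrow> lev u = ht u + mass (base u)"
  by (simp add: ht_def lev_def)

lemma base_nonneg: "0 \<le> base u v" by (rule cone_nonneg[OF base_S])

lemma lev_nonneg: "u \<in> upper \<Longrightarrow> 0 \<le> lev u"
  using base_plain[of u] lev_pos[of u] ht_nonneg[of u] mass_nonneg[OF base_S, of u]
  by (cases "ht u = 0") (auto simp: upper_def)

lemma fill_bounds: "0 \<le> fill u v" "fill u v \<le> base u v"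
  using base_nonneg[of u v] by (simp_all add: fill_def)

lemma Phi_base: "\<Phi> (base u) n = u n - (cp u - (ht u - cp u))"
  unfolding base_def Phi_Phi'[OF base0_coords] by (simp add: base0_def trunc_def)

lemma down_p: "down u p = cp u" and down_q: "down u q = ht u - cp u"
  by (simp_all add: down_def)

lemma down_rim: "1 \<le> v \<Longrightarrow> v \<le> a \<Longrightarrow> down u (N + v) = fill u v"
  by (simp add: down_def)

lemma down_low: "1 \<le> v \<Longrightarrow> v \<le> a \<Longrightarrow> down u v = base u v - fill u v"
  using a0 aN by (simp add: down_def)

lemma down_nonneg: "0 \<le> down u v"
  using cp_bounds[of u] fill_bounds[of u v] fill_bounds[of u "v - N"] base_nonneg[of u v] by (simp add: down_def)

lemma coll_down: "coll (down u) = base u"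
proof
  fix v
  have out: "base u v = 0" if "v < - N \<or> N < v" using S_zero_outside[OF base_S] that by blast
  consider "1 \<le> v" "v \<le> a" | "v < - N \<or> N < v" | "- N \<le> v" "v \<le> N" "\<not> (1 \<le> v \<and> v \<le> a)" by linarith
  then show "coll (down u) v = base u v"
  proof cases
    case 1
    then show ?thesis using coll_low[OF 1] down_low[OF 1] down_rim[OF 1] by simp
  next
    case 2
    then show ?thesis using out by (auto simp: coll_def)
  next
    case 3
    then show ?thesis using a0 by (auto simp: coll_def down_def)
  qed
qed

text \<open>Mass left at \<open>v\<close> means that the supply ran out there. So later midpoints
  receive nothing, and there is no apex mass: if \<open>ht u\<close> were positive, the supply would
  exceed the total capacity \<open>mass (base u)\<close>.\<close>

lemma low_free:
  assumes v: "1 \<le> v" "v \<le> a" and d: "down u v \<noteq> 0"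
  shows "ht u = 0" "v < w \<Longrightarrow> w \<le> a \<Longrightarrow> fill u w = 0"
proof -
  have lt: "lev u - (\<Sum>w\<in>{1..<v}. base u w) < base u v"
    using d base_nonneg[of u v] unfolding down_low[OF v] fill_def by (auto simp: min_def max_def split: if_splits)
  have e: "{1..v} = insert v {1..<v}" using v by auto
  have lt': "lev u < (\<Sum>w\<in>{1..v}. base u w)" using lt unfolding e by simp
  show "ht u = 0"
  proof (rule ccontr)
    assume "ht u \<noteq> 0"
    then have h: "ht u > 0" using ht_nonneg[of u] by linarith
    have "(\<Sum>w\<in>{1..v}. base u w) \<le> mass (base u)"
      unfolding mass_def using v base_nonneg by (intro sum_mono2) auto
    then show False using lt' lev_pos[OF h] h by linarith
  qed
  assume w: "v < w" "w \<le> a"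
  have "(\<Sum>w\<in>{1..v}. base u w) \<le> (\<Sum>w\<in>{1..<w}. base u w)"
    using w base_nonneg by (intro sum_mono2) auto
  then have "lev u - (\<Sum>w\<in>{1..<w}. base u w) \<le> 0" using lt' by linarith
  then show "fill u w = 0" unfolding fill_def using base_nonneg[of u w] by simp
qed

lemma down_next: "down u \<in> face_cone B'"
  unfolding cone_next coll_down
proof (intro conjI allI impI)
  show "0 \<le> down u v" for v by (rule down_nonneg)
  show "- N \<le> v" "v \<le> q" if "down u v \<noteq> 0" for v
  proof -
    have "down u v = 0" if "v < - N \<or> q < v"
      using that S_zero_outside[OF base_S, of v u] a0 aN by (auto simp: down_def)
    then show "- N \<le> v" "v \<le> q" using \<open>down u v \<noteq> 0\<close> by linarith+
  qed
  show "base u \<in> face_cone S" by (rule base_S)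
  \<comment> \<open>If \<open>cp u\<close> is nonzero, it is at most half of
    \<open>ht u + u n\<close>, which says that coordinate \<open>n\<close> of the equatorial point
    is nonnegative. For \<open>q\<close> the clamp gives the reverse inequality.\<close>
  show "base u \<in> face_cone B" if "down u p \<noteq> 0"
    unfolding hemi[OF base_S] Phi_base using that ht_nonneg[of u] unfolding down_p
    by (auto simp: cp_def min_def max_def field_simps split: if_splits)
  show "base u \<in> face_cone ((`) uminus ` B)" if "down u q \<noteq> 0"
    unfolding hemi_uminus[OF base_S] Phi_base using that ht_nonneg[of u] unfolding down_q
    by (auto simp: cp_def min_def max_def field_simps split: if_splits)
  fix v assume v: "1 \<le> v" "v \<le> a" "down u v \<noteq> 0"
  show "down u p = 0" "down u q = 0"
    using low_free(1)[OF v] cp_bounds[of u] unfolding down_p down_q by linarith+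
  show "down u (N + w) = 0" if "v < w" "w \<le> a" for w
    using low_free(2)[OF v that] down_rim[of w u] that v by simp
qed

lemma up_down:
  assumes u: "u \<in> upper"
  shows "up (down u) = u"
proof
  fix i
  have uc: "u \<in> coords {..Suc n}" "0 \<le> u (Suc n)" using u by (auto simp: upper_def)
  have u0: "up0 (down u) = trunc u"
    unfolding up0_def coll_down down_p down_q base_def Phi_Phi'[OF base0_coords] by (auto simp: base0_def)
  have "rim (down u) = (\<Sum>v\<in>{1..a}. fill u v)"
    unfolding rim_def by (intro sum.cong) (simp_all add: down_rim)
  also have "\<dots> = min (lev u) (mass (base u))"
    unfolding fill_def mass_def by (rule greedy_fill[OF a0 base_nonneg lev_nonneg[OF u]])
  finally have r: "rim (down u) = min (lev u) (mass (base u))" .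
  \<comment> \<open>Either \<open>ht u = 0\<close> and the supply fits into the capacity, or the
    capacity is filled and the excess is \<open>ht u\<close>. In both cases nothing of
    \<open>lev u\<close> is lost.\<close>
  have "ht u + rim (down u) = lev u"
  proof (cases "ht u = 0")
    case True
    have "lev u \<le> mass (base u)"
      using base_plain[OF True] True by (simp add: ht_def max_def split: if_splits)
    then show ?thesis using r True by simp
  next
    case False
    then have "ht u > 0" using ht_nonneg[of u] by linarith
    then show ?thesis using r lev_pos[of u] by simp
  qed
  then have "up (down u) (Suc n) = u (Suc n)"
    unfolding up_def u0 coll_down down_p down_q by (simp add: lev_def)
  moreover have "up (down u) i = u i" if "i \<noteq> Suc n"
    using that coords_zero[OF uc(1), of i] unfolding up_def u0 by (simp add: trunc_def)
  ultimately show "up (down u) i = u i" by (cases "i = Suc n") auto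
qed

section \<open>Piecewise linearity of \<open>up\<close> and \<open>down\<close>\<close>

lemma pl_coll: "pl_fun X (\<lambda>y. coll y v)"
proof -
  have "(\<lambda>y. coll y v) = (\<lambda>y. (if - N \<le> v \<and> v \<le> N then 1 else 0) * (y v + (if 1 \<le> v \<and> v \<le> a then 1 else 0) * y (N + v)))"
    by (auto simp: coll_def fun_eq_iff)
  then show ?thesis by (simp only:) (intro pl_fun_scale pl_fun_add pl_fun_coord)
qed

lemma pl_mass:
  assumes "\<And>v. pl_fun X (\<lambda>y. f y v)"
  shows "pl_fun X (\<lambda>y. mass (f y))"
  unfolding mass_def by (intro pl_fun_sum assms)

lemma pl_Phi:
  assumes "\<And>v. pl_fun X (\<lambda>y. f y v)" "\<And>y. y \<in> X \<Longrightarrow> f y \<in> face_cone S"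
  shows "pl_fun X (\<lambda>y. \<Phi> (f y) i)"
  using assms by (rule pl_fun_compose[OF plF(1) _ _ cone_coords finite_verts[OF ascS]])

lemma pl_Phi':
  assumes "\<And>i. pl_fun X (\<lambda>y. f y i)" "\<And>y. y \<in> X \<Longrightarrow> f y \<in> coords {..n}"
  shows "pl_fun X (\<lambda>y. \<Phi>' (f y) v)"
  using assms by (rule pl_fun_compose[OF plF(2) _ _ subset_refl finite_atMost])

lemma pl_if_const:
  assumes "pl_fun X f" "pl_fun X g"
  shows "pl_fun X (\<lambda>x. if P then f x else g x)"
  using assms by (cases P) simp_all

lemma pl_up: "pl_fun (face_cone B') (\<lambda>y. up y i)"
proof -
  have u0: "pl_fun (face_cone B') (\<lambda>y. up0 y i)" for i
    unfolding up0_def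
    by (intro pl_fun_add pl_Phi pl_coll pl_if_const pl_fun_diff pl_fun_coord pl_fun_zero nextD(3))
  have rm: "pl_fun (face_cone B') rim"
    unfolding rim_def by (intro pl_fun_sum pl_fun_coord)
  show ?thesis
    unfolding up_def
    by (intro pl_if_const pl_fun_add pl_fun_diff pl_fun_coord rm pl_mass pl_coll pl_Phi' u0 up0_coords)
qed

lemma pl_down: "pl_fun X (\<lambda>u. down u v)"
proof -
  have t: "pl_fun X (\<lambda>u. trunc u i)" for i
    unfolding trunc_def by (intro pl_if_const pl_fun_coord pl_fun_zero)
  have mt: "pl_fun X (\<lambda>u. mass (\<Phi>' (trunc u)))"
    by (intro pl_mass pl_Phi' t trunc_coords)
  have h: "pl_fun X ht" unfolding ht_def by (intro pl_fun_max pl_fun_zero pl_fun_diff pl_fun_coord mt)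
  have c: "pl_fun X cp" unfolding cp_def
    by (intro pl_fun_min pl_fun_max pl_fun_zero pl_fun_divide pl_fun_add pl_fun_coord h)
  have b0: "pl_fun X (\<lambda>u. base0 u i)" for i
    unfolding base0_def by (intro pl_fun_diff t pl_if_const c h pl_fun_zero)
  have b: "pl_fun X (\<lambda>u. base u v)" for v
    unfolding base_def by (intro pl_Phi' b0 base0_coords)
  have l: "pl_fun X lev" unfolding lev_def by (intro pl_fun_add pl_fun_diff pl_fun_coord mt pl_mass b)
  have f: "pl_fun X (\<lambda>u. fill u v)" for v
    unfolding fill_def by (intro pl_fun_min pl_fun_max pl_fun_zero pl_fun_diff l pl_fun_sum b)
  show ?thesis unfolding down_def by (intro pl_if_const pl_fun_diff c h f b)
qed

section \<open>Odd extension to the whole sphere\<close>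

definition Psi :: "(int \<Rightarrow> real) \<Rightarrow> nat \<Rightarrow> real" where
  "Psi y = (if y \<in> face_cone B' then up y else (\<lambda>i. - up (\<lambda>v. y (- v)) i))"

definition Psi' :: "(nat \<Rightarrow> real) \<Rightarrow> int \<Rightarrow> real" where
  "Psi' u = (if 0 \<le> u (Suc n) then down u else (\<lambda>v. down (\<lambda>i. - u i) (- v)))"

lemma up_S:
  assumes x: "x \<in> face_cone S"
  shows "up x = \<Phi> x"
proof -
  have z: "x p = 0" "x q = 0" "\<And>v. 1 \<le> v \<Longrightarrow> x (N + v) = 0" using S_zero_outside[OF x] a0 aN by auto
  have "rim x = 0" unfolding rim_def using z(3) by (intro sum.neutral) simp
  moreover have "\<Phi>' (up0 x) = x" using up0_plain(2)[OF cone_S_next[OF x] z(1,2)] coll_S[OF x] by simp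
  moreover have "up0 x = \<Phi> x" using up0_plain(1)[OF cone_S_next[OF x] z(1,2)] coll_S[OF x] by simp
  moreover have "\<Phi> x (Suc n) = 0" using coords_zero[OF Phi_coords[OF x]] by simp
  ultimately show ?thesis using z coll_S[OF x] by (intro ext) (simp add: up_def)
qed

lemma both_S:
  assumes "y \<in> face_cone B'" "(\<lambda>v. y (- v)) \<in> face_cone B'"
  shows "y \<in> face_cone S"
proof -
  have e: "{v. y (- v) \<noteq> 0} = uminus ` {v. y v \<noteq> 0}"
    by (auto intro!: image_eqI[of _ _ "- _"])
  have "{v. y v \<noteq> 0} \<in> B'" "uminus ` {v. y v \<noteq> 0} \<in> B'"
    using assms unfolding face_cone_def mem_Collect_eq e by simp_all
  then have "{v. y v \<noteq> 0} \<in> S" by (rule next_inter)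
  then show ?thesis using assms(1) by (simp add: face_cone_def)
qed

lemma up_both:
  assumes "y \<in> face_cone B'" "(\<lambda>v. y (- v)) \<in> face_cone B'"
  shows "up y = (\<lambda>i. - up (\<lambda>v. y (- v)) i)"
proof -
  have y: "y \<in> face_cone S" by (rule both_S[OF assms])
  show ?thesis using up_S[OF y] up_S[OF face_cone_symm_uminus[OF y]] equi[OF y] by simp
qed

text \<open>A point of height 0 has the same image as the equatorial point over its truncation, and
  \<open>up\<close> is injective because \<open>down\<close> inverts it. So only the equator is
  mapped to the hyperplane along which the halves are glued.\<close>

lemma flat_S:
  assumes y: "y \<in> face_cone B'" and h: "up y (Suc n) = 0"
  shows "y \<in> face_cone S"
proof -
  define x where "x = \<Phi>' (trunc (up y))"
  have x: "x \<in> face_cone S" unfolding x_def by (rule Phi'_cone[OF trunc_coords])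
  have "up y \<in> coords {..Suc n}" using up_upper[OF y] by (simp add: upper_def)
  then have "trunc (up y) = up y"
    using h coords_zero[of "up y" "{..Suc n}"] by (auto simp: trunc_def fun_eq_iff le_Suc_eq)
  then have "up x = up y" using up_S[OF x] Phi_Phi'[OF trunc_coords, of "up y"] by (simp add: x_def)
  then have "x = y" using down_up[OF y] down_up[OF cone_S_next[OF x]] by simp
  then show ?thesis using x by simp
qed

lemma Psi_upper: "y \<in> face_cone B' \<Longrightarrow> Psi y = up y"
  by (simp add: Psi_def)

lemma Psi_lower: "(\<lambda>v. y (- v)) \<in> face_cone B' \<Longrightarrow> Psi y = (\<lambda>i. - up (\<lambda>v. y (- v)) i)"
  using up_both[of y] by (simp add: Psi_def)

lemma Psi_neg:
  assumes "y \<notin> face_cone B'" "(\<lambda>v. y (- v)) \<in> face_cone B'"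
  shows "Psi y (Suc n) < 0"
proof -
  have "up (\<lambda>v. y (- v)) (Suc n) \<noteq> 0"
  proof
    assume "up (\<lambda>v. y (- v)) (Suc n) = 0"
    then have "(\<lambda>v. y (- v)) \<in> face_cone S" by (rule flat_S[OF assms(2)])
    from face_cone_symm_uminus[OF this] have "y \<in> face_cone S" by simp
    then show False using assms(1) cone_S_next by blast
  qed
  moreover have "0 \<le> up (\<lambda>v. y (- v)) (Suc n)" using up_upper[OF assms(2)] by (simp add: upper_def)
  ultimately show ?thesis unfolding Psi_lower[OF assms(2)] by simp
qed

lemma Psi_nonneg: "y \<in> face_cone B' \<Longrightarrow> 0 \<le> Psi y (Suc n)"
  using up_upper[of y] by (simp add: Psi_def upper_def)

lemma hemi_next: "y \<in> face_cone (symm B') \<Longrightarrow> y \<in> face_cone B' \<longleftrightarrow> 0 \<le> Psi y (Suc n)"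
  using Psi_nonneg[of y] Psi_neg[of y] unfolding face_cone_symm by force

lemma equi_next:
  assumes "y \<in> face_cone (symm B')"
  shows "Psi (\<lambda>v. y (- v)) = (\<lambda>i. - Psi y i)"
  using assms unfolding face_cone_symm
proof
  assume "y \<in> face_cone B'"
  then show ?thesis using Psi_lower[of "\<lambda>v. y (- v)"] Psi_upper[of y] by simp
next
  assume "(\<lambda>v. y (- v)) \<in> face_cone B'"
  then show ?thesis using Psi_lower[of y] Psi_upper[of "\<lambda>v. y (- v)"] by simp
qed

lemma coords_uminus: "u \<in> coords I \<Longrightarrow> (\<lambda>i. - u i) \<in> coords I"
  by (simp add: coords_def)

lemma Psi_coords:
  assumes "y \<in> face_cone (symm B')"
  shows "Psi y \<in> coords {..Suc n}"
  using assms unfolding face_cone_symm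
proof
  assume "y \<in> face_cone B'"
  then show ?thesis using up_upper[of y] Psi_upper[of y] by (simp add: upper_def)
next
  assume y: "(\<lambda>v. y (- v)) \<in> face_cone B'"
  show ?thesis unfolding Psi_lower[OF y] using up_upper[OF y] by (intro coords_uminus) (simp add: upper_def)
qed

lemma Psi'_cone: "Psi' u \<in> face_cone (symm B')"
  unfolding face_cone_symm using down_next[of u] down_next[of "\<lambda>i. - u i"] by (simp add: Psi'_def)

lemma Psi'_Psi:
  assumes y: "y \<in> face_cone (symm B')"
  shows "Psi' (Psi y) = y"
proof (cases "y \<in> face_cone B'")
  case True
  then show ?thesis using Psi_nonneg[OF True] Psi_upper[OF True] down_up[OF True] by (simp add: Psi'_def)
next
  case False
  then have y': "(\<lambda>v. y (- v)) \<in> face_cone B'" using y by (simp add: face_cone_symm)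
  show ?thesis
    using Psi_neg[OF False y'] Psi_lower[OF y'] down_up[OF y'] by (simp add: Psi'_def)
qed

lemma Psi_Psi':
  assumes u: "u \<in> coords {..Suc n}"
  shows "Psi (Psi' u) = u"
proof (cases "0 \<le> u (Suc n)")
  case True
  then have "u \<in> upper" using u by (simp add: upper_def)
  then show ?thesis using True Psi_upper[OF down_next[of u]] up_down by (simp add: Psi'_def)
next
  case False
  then have "(\<lambda>i. - u i) \<in> upper" using coords_uminus[OF u] by (simp add: upper_def)
  then have ud: "up (down (\<lambda>i. - u i)) = (\<lambda>i. - u i)" by (rule up_down)
  have "(\<lambda>v. Psi' u (- v)) = down (\<lambda>i. - u i)" using False by (simp add: Psi'_def)
  then show ?thesis using Psi_lower[of "Psi' u"] down_next[of "\<lambda>i. - u i"] ud by simp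
qed

lemma pl_Psi: "pl_fun (face_cone (symm B')) (\<lambda>y. Psi y i)"
proof -
  have "pl_fun (face_cone B') (\<lambda>y. Psi y i)"
    using pl_up[of i] by (rule iffD1[OF pl_fun_cong, rotated]) (simp add: Psi_upper)
  moreover have "pl_fun (face_cone ((`) uminus ` B')) (\<lambda>y. Psi y i)"
  proof -
    have "pl_fun (face_cone ((`) uminus ` B')) (\<lambda>y. up (\<lambda>v. y (- v)) i)"
    proof (rule pl_fun_compose[OF pl_up _ _ cone_coords finite_verts[OF asc_next]])
      show "pl_fun (face_cone ((`) uminus ` B')) (\<lambda>y. y (- v))" for v by (rule pl_fun_coord)
      show "(\<lambda>v. y (- v)) \<in> face_cone B'" if "y \<in> face_cone ((`) uminus ` B')" for y
        using that by (simp only: uminus_cone)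
    qed
    then have "pl_fun (face_cone ((`) uminus ` B')) (\<lambda>y. - up (\<lambda>v. y (- v)) i)" by (rule pl_fun_uminus)
    then show ?thesis by (rule iffD1[OF pl_fun_cong, rotated]) (simp add: Psi_lower uminus_cone)
  qed
  ultimately show ?thesis
    unfolding symm_def face_cone_Un
    by (intro pl_fun_Un closed_cone asc_next asc_image)
qed

text \<open>On the hyperplane \<open>down u\<close> is on the equator, where \<open>up\<close> is
  the odd map \<open>\<Phi>\<close>. Hence the two branches of \<open>Psi'\<close> agree there and
  can be glued over the closed half spaces.\<close>

lemma Psi'_flat:
  assumes u: "u \<in> coords {..Suc n}" "u (Suc n) = 0"
  shows "down u = (\<lambda>v. down (\<lambda>i. - u i) (- v))"
proof -
  define x where "x = down u"
  have up: "u \<in> upper" "(\<lambda>i. - u i) \<in> upper" using u coords_uminus[OF u(1)] by (simp_all add: upper_def)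
  have xB: "x \<in> face_cone B'" unfolding x_def by (rule down_next)
  have ux: "up x = u" unfolding x_def by (rule up_down[OF up(1)])
  have xS: "x \<in> face_cone S" by (rule flat_S[OF xB]) (simp add: ux u(2))
  have xS': "(\<lambda>v. x (- v)) \<in> face_cone S" by (rule face_cone_symm_uminus[OF xS])
  have "up (\<lambda>v. x (- v)) = (\<lambda>i. - u i)"
    using up_S[OF xS'] equi[OF xS] up_S[OF xS] ux by simp
  then have "down (\<lambda>i. - u i) = (\<lambda>v. x (- v))" using down_up[OF cone_S_next[OF xS']] by simp
  then show ?thesis by (simp add: x_def)
qed

lemma pl_Psi': "pl_fun (coords {..Suc n}) (\<lambda>u. Psi' u v)"
proof -
  let ?L = "{u \<in> coords {..Suc n}. u (Suc n) \<le> 0}"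
  have "pl_fun upper (\<lambda>u. Psi' u v)"
    using pl_down[of upper v] by (rule iffD1[OF pl_fun_cong, rotated]) (simp add: Psi'_def upper_def)
  moreover have "pl_fun ?L (\<lambda>u. Psi' u v)"
  proof -
    have "pl_fun ?L (\<lambda>u. down (\<lambda>i. - u i) (- v))"
    proof (rule pl_fun_compose[OF pl_down[of "coords {..Suc n}" "- v"] _ _ subset_refl finite_atMost])
      show "pl_fun ?L (\<lambda>u. - u i)" for i by (intro pl_fun_uminus pl_fun_coord)
      show "(\<lambda>i. - u i) \<in> coords {..Suc n}" if "u \<in> ?L" for u
        using that by (intro coords_uminus) simp
    qed
    moreover have "down (\<lambda>i. - u i) (- v) = Psi' u v" if "u \<in> ?L" for u
      using that fun_cong[OF Psi'_flat[of u], of v] by (cases "u (Suc n) = 0") (auto simp: Psi'_def)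
    ultimately show ?thesis by (rule iffD1[OF pl_fun_cong, rotated])
  qed
  moreover have cl: "closed (coords {..Suc n} :: (nat \<Rightarrow> real) set)"
  proof -
    have "coords {..Suc n} = {u :: nat \<Rightarrow> real. \<forall>i. i \<notin> {..Suc n} \<longrightarrow> u i = 0}" by (auto simp: coords_def)
    moreover have "closed {u :: nat \<Rightarrow> real. \<forall>i. i \<notin> {..Suc n} \<longrightarrow> u i = 0}"
      by (intro closed_Collect_all closed_Collect_imp closed_Collect_eq continuous_on_coord continuous_intros) auto
    ultimately show ?thesis by simp
  qed
  moreover have "closed {u :: nat \<Rightarrow> real. 0 \<le> u (Suc n)}" "closed {u :: nat \<Rightarrow> real. u (Suc n) \<le> 0}"
    by (intro closed_Collect_le continuous_on_coord continuous_intros)+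
  then have "closed upper" "closed ?L"
    unfolding upper_def Collect_conj_eq using cl by auto
  moreover have "coords {..Suc n} = upper \<union> ?L" by (auto simp: upper_def)
  ultimately show ?thesis using pl_fun_Un[of upper "\<lambda>u. Psi' u v" ?L] by simp
qed

text \<open>The old equator becomes the intersection of the two new hemispheres, hence the shift of
  the parameters from \<open>N\<close>, \<open>a\<close> to \<open>q\<close>,
  \<open>N\<close>.\<close>

theorem hemisphere_next: "hemisphere q N B' (Suc n) Psi Psi'"
proof
  show "0 \<le> N" "N \<le> q" using a0 aN by auto
  show "asc B'" by (rule asc_next)
  show "- N \<le> v \<and> v \<le> q" if "v \<in> verts B'" for v
  proof -
    obtain G where "G \<in> B'" "v \<in> G" using \<open>v \<in> verts B'\<close> by (auto simp: verts_def)
    then show ?thesis using next_bounds by blast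
  qed
  show "verts (symm B') = {-q..q} - {0}" by (rule verts_next)
  show "{- v, w} \<notin> symm B'" if "{v, w} \<in> symm B'" for v w by (rule noanti_next[OF that])
  show "pl_iso (face_cone (symm B')) (coords {..Suc n}) Psi Psi'"
    unfolding pl_iso_def pl_map_def
    by (intro conjI allI ballI pl_Psi pl_Psi' image_subsetI Psi_coords Psi'_cone Psi'_Psi Psi_Psi')
qed (use equi_next hemi_next in auto)

section \<open>Dimension of the next ball\<close>

lemma collapse_inj:
  assumes "X \<subseteq> {-N..N + a}"
  shows "inj_on (collapse N a) (X - {v \<in> X. 1 \<le> v \<and> v \<le> a \<and> N + v \<in> X})"
proof (rule inj_onI)
  fix u v assume u: "u \<in> X - {v \<in> X. 1 \<le> v \<and> v \<le> a \<and> N + v \<in> X}"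
    and v: "v \<in> X - {v \<in> X. 1 \<le> v \<and> v \<le> a \<and> N + v \<in> X}" and e: "collapse N a u = collapse N a v"
  have False if "u \<in> X" "v \<in> X" "collapse N a u = collapse N a v" "v < u"
    "\<not> (1 \<le> v \<and> v \<le> a \<and> N + v \<in> X)" for u v
  proof -
    have "N < u" "u \<le> N + a" "v = u - N"
      using that assms by (auto simp: collapse_def split: if_splits)
    then have "1 \<le> v" "v \<le> a" "N + v = u" by auto
    then show False using that by simp
  qed
  from this[of u v] this[of v u] show "u = v" using u v e by (cases "u < v"; cases "v < u") auto
qed

text \<open>Collapsing identifies vertices of a face only if it contains \<open>v\<close> and
  \<open>N + v\<close>. The order of subdivision permits this for at most one \<open>v\<close>, and
  for none when an apex is present. With both apices the collapsed face lies in \<open>B\<close> and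
  in its antipode, where faces have one vertex less.\<close>

lemma card_next:
  assumes m: "\<And>G. G \<in> S \<Longrightarrow> card G \<le> Suc m" "\<And>G. G \<in> B \<Longrightarrow> uminus ` G \<in> B \<Longrightarrow> card G \<le> m"
    and G: "G \<in> B'"
  shows "card G \<le> Suc (Suc m)"
proof -
  have fin: "finite G" using G by (simp add: next_ball_def)
  define X where "X = G - {p, q}"
  define F where "F = collapse N a ` X"
  define L where "L = {v \<in> X. 1 \<le> v \<and> v \<le> a \<and> N + v \<in> X}"
  have F: "F \<in> S" "p \<in> G \<Longrightarrow> F \<in> B" "q \<in> G \<Longrightarrow> uminus ` F \<in> B"
    using G by (simp_all add: next_ball_def F_def X_def uminus_image_mem)
  have low: "p \<notin> G \<and> q \<notin> G \<and> (\<forall>w. v < w \<and> w \<le> a \<longrightarrow> N + w \<notin> G)" if "v \<in> G" "1 \<le> v" "v \<le> a" for v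
    using G that unfolding next_ball_def by blast
  have "X \<subseteq> {-N..N + a}"
  proof
    fix v assume v: "v \<in> X"
    then have "- N \<le> v" "v \<le> q" "v \<noteq> p" "v \<noteq> q" using next_bounds[OF G, of v] by (auto simp: X_def)
    then show "v \<in> {-N..N + a}" by auto
  qed
  then have inj: "inj_on (collapse N a) (X - L)" unfolding L_def by (rule collapse_inj)
  have "collapse N a ` (X - L) \<subseteq> F" by (auto simp: F_def)
  then have c1: "card (X - L) \<le> card F"
    using card_image[OF inj] fin by (metis F_def X_def card_mono finite_Diff finite_imageI)
  have finL: "finite L" using fin by (simp add: L_def X_def)
  have L1: "v = w" if "v \<in> L" "w \<in> L" for v w
    using low[of v] low[of w] that unfolding L_def X_def by (cases "v < w"; cases "w < v") auto
  have c2: "card L \<le> 1"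
    using L1 by (metis card_le_Suc0_iff_eq finL One_nat_def)
  have "card X \<le> card (X - L) + card L"
    using fin by (metis (no_types, lifting) L_def X_def card_Diff_subset card_mono finL finite_Diff le_add_diff_inverse2 mem_Collect_eq order_refl subsetI)
  then have cX: "card X \<le> card F + card L" using c1 by simp
  have cG: "card G \<le> card X + card (G \<inter> {p, q})"
    using card_Un_le[of X "G \<inter> {p, q}"] by (simp add: X_def Un_commute Int_Diff_Un flip: Diff_Int_distrib2) (metis Int_Diff_Un Un_commute add.commute card_Un_le)
  show ?thesis
  proof (cases "p \<in> G \<or> q \<in> G")
    case True
    have "L = {}" using True low unfolding L_def X_def by blast
    then have "card X \<le> card F" using cX by simp
    moreover have "card F + card (G \<inter> {p, q}) \<le> Suc (Suc m)"
    proof (cases "p \<in> G \<and> q \<in> G")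
      case True
      then have "card F \<le> m" "G \<inter> {p, q} = {p, q}" using m(2)[OF F(2,3)] by auto
      moreover have "card {p, q} \<le> 2" by (simp add: card_insert_if)
      ultimately show ?thesis by simp
    next
      case False
      then have "G \<inter> {p, q} \<subseteq> {p} \<or> G \<inter> {p, q} \<subseteq> {q}" by blast
      then have "card (G \<inter> {p, q}) \<le> 1"
        by (metis card_mono finite.emptyI finite_insert is_singletonI is_singleton_altdef)
      then show ?thesis using m(1)[OF F(1)] by simp
    qed
    ultimately show ?thesis using cG by simp
  next
    case False
    then have "G \<inter> {p, q} = {}" by blast
    then show ?thesis using cG cX c2 m(1)[OF F(1)] by simp
  qed
qed

text \<open>Replacing each vertex among 1, ..., a by its midpoint makes the face joinable with
  \<open>p\<close>.\<close>

lemma big_face_next: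
  assumes F: "F \<in> B"
  shows "\<exists>G\<in>B'. card G = Suc (card F)"
proof -
  define r where "r v = (if 1 \<le> v \<and> v \<le> a then N + v else v)" for v
  have FS: "F \<in> S" using F by (simp add: symm_def)
  have b: "- N \<le> v" "v \<le> N" if "v \<in> F" for v using face_bounds[OF FS that] by auto
  have cr: "collapse N a (r v) = v" if "v \<in> F" for v
    using b[OF that] by (simp add: r_def collapse_def)
  have injr: "inj_on r F" by (metis cr inj_onI)
  have rb: "r v \<le> N + a" "\<not> (1 \<le> r v \<and> r v \<le> a)" if "v \<in> F" for v
    using b[OF that] a0 aN by (auto simp: r_def)
  define G where "G = insert p (r ` F)"
  have finF: "finite F" using F ascB by (auto simp: asc_def)
  have pq: "p \<notin> r ` F" "q \<notin> r ` F" using rb by fastforce+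
  have "G - {p, q} = r ` F" using pq by (auto simp: G_def)
  moreover have "collapse N a ` r ` F = F" unfolding image_image using cr by force
  ultimately have e: "collapse N a ` (G - {p, q}) = F" by simp
  have "q \<notin> G" using pq by (simp add: G_def)
  moreover have "\<not> (1 \<le> v \<and> v \<le> a)" if "v \<in> G" for v
    using that rb a0 aN by (auto simp: G_def)
  ultimately have "G \<in> B'" unfolding next_ball_def mem_Collect_eq e using F FS finF by (auto simp: G_def)
  moreover have "card G = Suc (card F)" using pq finF card_image[OF injr] by (simp add: G_def)
  ultimately show ?thesis by blast
qed

end

section \<open>The induction and the vertex count\<close>

fun half :: "nat \<Rightarrow> int" where
  "half 0 = 0"
| "half (Suc 0) = 1"
| "half (Suc (Suc n)) = half (Suc n) + half n + 2"

text \<open>These are the balls \<open>B_d\<close>. \<open>half (Suc d)\<close> counts the antipodal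
  pairs of \<open>S_d\<close>, and \<open>half 0\<close> those of the empty equator of
  \<open>S_0\<close>; this explains the shifted index.\<close>

fun hemi_ball :: "nat \<Rightarrow> int set set" where
  "hemi_ball 0 = {{}, {1}}"
| "hemi_ball (Suc d) = next_ball (half (Suc d)) (half d) (hemi_ball d)"

lemma mem_singletons_iff:
  assumes "a \<noteq> b"
  shows "A \<in> {{}, {a}, {b}} \<longleftrightarrow> (\<forall>v. v \<noteq> a \<and> v \<noteq> b \<longrightarrow> v \<notin> A) \<and> (a \<notin> A \<or> b \<notin> A)" (is "_ \<longleftrightarrow> ?R")
proof
  show "A \<in> {{}, {a}, {b}} \<Longrightarrow> ?R" using assms by (elim insertE) auto
  assume R: ?R
  show "A \<in> {{}, {a}, {b}}"
  proof (cases "a \<in> A")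
    case True
    then have "A = {a}" using R by blast
    then show ?thesis by simp
  next
    case False
    have "v = b" if "v \<in> A" for v using R False that by metis
    then have "A \<subseteq> {b}" by blast
    then show ?thesis by (auto simp: subset_singleton_iff)
  qed
qed

text \<open>\<open>S_0\<close> is a pair of points and its cone a pair of rays, identified with the
  line by taking the difference; the inverse takes positive and negative parts.\<close>

lemma hemisphere_0:
  "hemisphere 1 0 {{}, {1}} 0 (\<lambda>x i. if i = 0 then x 1 - x (- 1) else 0)
     (\<lambda>u v. if v = 1 then max 0 (u 0) else if v = - 1 then max 0 (- u 0) else 0)"
    (is "hemisphere 1 0 ?B 0 ?F ?F'")
proof -
  have sB: "symm ?B = {{}, {1}, {- 1}}" by (auto simp: symm_def)
  have cS: "x \<in> face_cone (symm ?B) \<longleftrightarrow>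
      (\<forall>v. 0 \<le> x v) \<and> (\<forall>v. v \<noteq> 1 \<and> v \<noteq> - 1 \<longrightarrow> x v = 0) \<and> (x 1 = 0 \<or> x (- 1) = 0)" for x
  proof -
    have "(1 :: int) \<noteq> - 1" by simp
    note A = mem_singletons_iff[OF this]
    show ?thesis unfolding face_cone_def sB mem_Collect_eq A by simp
  qed
  have cB: "x \<in> face_cone ?B \<longleftrightarrow> (\<forall>v. 0 \<le> x v) \<and> (\<forall>v. v \<noteq> 1 \<longrightarrow> x v = 0)" for x
  proof -
    have A: "A \<in> {{}, {1}} \<longleftrightarrow> (\<forall>v. v \<noteq> 1 \<longrightarrow> v \<notin> A)" for A :: "int set"
      using subset_singleton_iff[of A 1] by auto
    show ?thesis unfolding face_cone_def mem_Collect_eq A by simp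
  qed
  show ?thesis
  proof
    show "asc ?B" by (auto simp: asc_def)
    show "verts (symm ?B) = {- 1..1} - {0}" by (auto simp: sB verts_def)
    show "{- v, w} \<notin> symm ?B" if "{v, w} \<in> symm ?B" for v w
      using that unfolding sB by (auto simp: doubleton_eq_iff)
    show "pl_iso (face_cone (symm ?B)) (coords {..0}) ?F ?F'"
      unfolding pl_iso_def pl_map_def
    proof (intro conjI allI ballI image_subsetI)
      show "pl_fun (face_cone (symm ?B)) (\<lambda>x. ?F x i)" for i
        by (cases "i = 0") (simp_all add: pl_fun_zero pl_fun_diff pl_fun_coord)
      show "pl_fun (coords {..0}) (\<lambda>u. ?F' u v)" for v
        by (cases "v = 1"; cases "v = - 1") (simp_all add: pl_fun_zero pl_fun_max pl_fun_uminus pl_fun_coord)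
      show "?F x \<in> coords {..0}" for x by (intro coordsI) simp
      show "?F' u \<in> face_cone (symm ?B)" for u unfolding cS by auto
      show "?F' (?F x) = x" if x: "x \<in> face_cone (symm ?B)" for x
      proof
        fix v
        have "0 \<le> x 1" "0 \<le> x (- 1)" "x 1 = 0 \<or> x (- 1) = 0" "v \<noteq> 1 \<and> v \<noteq> - 1 \<longrightarrow> x v = 0"
          using x unfolding cS by auto
        then show "?F' (?F x) v = x v" by auto
      qed
      show "?F (?F' u) = u" if "u \<in> coords {..0}" for u
      proof
        fix i show "?F (?F' u) i = u i" using coords_zero[OF that, of i] by (auto simp: max_def)
      qed
    qed
    show "?F (\<lambda>v. x (- v)) = (\<lambda>i. - ?F x i)" for x by (simp add: fun_eq_iff)
    show "x \<in> face_cone ?B \<longleftrightarrow> 0 \<le> ?F x 0" if x: "x \<in> face_cone (symm ?B)" for x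
    proof -
      have "0 \<le> x 1" "0 \<le> x (- 1)" "x 1 = 0 \<or> x (- 1) = 0" "\<forall>v. v \<noteq> 1 \<and> v \<noteq> - 1 \<longrightarrow> x v = 0" "\<forall>v. 0 \<le> x v"
        using x unfolding cS by auto
      then show ?thesis unfolding cB by (metis diff_ge_0_iff_ge order_antisym)
    qed
  qed (auto simp: verts_def)
qed

lemma hemisphere_hemi_ball: "\<exists>\<Phi> \<Phi>'. hemisphere (half (Suc d)) (half d) (hemi_ball d) d \<Phi> \<Phi>'"
proof (induction d)
  case 0
  show ?case unfolding half.simps hemi_ball.simps by (intro exI) (rule hemisphere_0)
next
  case (Suc d)
  then obtain \<Phi> \<Phi>' where "hemisphere (half (Suc d)) (half d) (hemi_ball d) d \<Phi> \<Phi>'" by (elim exE)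
  from hemisphere.hemisphere_next[OF this] show ?case
    unfolding half.simps(3) hemi_ball.simps(2) by (intro exI)
qed

text \<open>The claims are proved together because the bound for faces common to
  \<open>B_(d+1)\<close> and its antipode is the bound for \<open>S_d\<close>.\<close>

lemma card_hemi_ball:
  "(\<forall>G\<in>symm (hemi_ball d). card G \<le> Suc d) \<and> (\<forall>G\<in>hemi_ball d. uminus ` G \<in> hemi_ball d \<longrightarrow> card G \<le> d) \<and>
   (\<exists>G\<in>hemi_ball d. card G = Suc d)"
proof (induction d)
  case 0
  show ?case by (auto simp: symm_def)
next
  case (Suc d)
  obtain \<Phi> \<Phi>' where "hemisphere (half (Suc d)) (half d) (hemi_ball d) d \<Phi> \<Phi>'"
    using hemisphere_hemi_ball by blast
  then interpret hemisphere "half (Suc d)" "half d" "hemi_ball d" d \<Phi> \<Phi>' .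
  have c: "card G \<le> Suc (Suc d)" if "G \<in> hemi_ball (Suc d)" for G
    using card_next[of d G] Suc that by simp
  have "card G \<le> Suc (Suc d)" if "G \<in> symm (hemi_ball (Suc d))" for G
  proof -
    have "card (uminus ` G) = card G" by (intro card_image) simp
    then show ?thesis using c[of G] c[of "uminus ` G"] that unfolding in_symm by auto
  qed
  moreover have "card G \<le> Suc d" if "G \<in> hemi_ball (Suc d)" "uminus ` G \<in> hemi_ball (Suc d)" for G
    using next_inter[of G] that Suc by simp
  moreover obtain F where "F \<in> hemi_ball d" "card F = Suc d" using Suc by blast
  then have "\<exists>G\<in>hemi_ball (Suc d). card G = Suc (Suc d)" using big_face_next[of F] by simp
  ultimately show ?case by blast
qed

text \<open>Each quotient map is constant on the fibres of the other, so each factors through the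
  other.\<close>

lemma homeomorphic_space_quotients:
  assumes f: "quotient_map X Y f" and h: "quotient_map X Z h"
    and eq: "\<And>x y. x \<in> topspace X \<Longrightarrow> y \<in> topspace X \<Longrightarrow> f x = f y \<longleftrightarrow> h x = h y"
  shows "Y homeomorphic_space Z"
proof -
  have "\<exists>g. continuous_map Y Z g \<and> (\<forall>x\<in>topspace X. g (f x) = h x)"
    using quotient_map_lift_exists[OF f quotient_imp_continuous_map[OF h]] eq by metis
  then obtain g where g: "continuous_map Y Z g" "\<forall>x\<in>topspace X. g (f x) = h x" by blast
  have "\<exists>k. continuous_map Z Y k \<and> (\<forall>x\<in>topspace X. k (h x) = f x)"
    using quotient_map_lift_exists[OF h quotient_imp_continuous_map[OF f]] eq by metis
  then obtain k where k: "continuous_map Z Y k" "\<forall>x\<in>topspace X. k (h x) = f x" by blast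
  have "homeomorphic_maps Y Z g k"
    unfolding homeomorphic_maps_def
  proof (intro conjI ballI g(1) k(1))
    fix z assume "z \<in> topspace Y"
    then obtain x where "x \<in> topspace X" "z = f x" using quotient_imp_surjective_map[OF f] by blast
    then show "k (g z) = z" using g(2) k(2) by simp
  next
    fix z assume "z \<in> topspace Z"
    then obtain x where "x \<in> topspace X" "z = h x" using quotient_imp_surjective_map[OF h] by blast
    then show "g (k z) = z" using g(2) k(2) by simp
  qed
  then show ?thesis unfolding homeomorphic_space_def by blast
qed

text \<open>Adding 4 turns both sides into solutions of the Fibonacci recurrence, so the values 6
  and 12 for \<open>n = 0\<close> and \<open>n = 1\<close> decide. The indices are shifted to avoid
  natural number subtraction.\<close>

lemma half_fib: "2 * half (Suc (Suc n)) = 3 * int (fib (n + 2)) + 7 * int (fib (n + 1)) + 3 * int (fib n) - 4"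
proof (induction n rule: fib.induct)
  case (3 n)
  have "2 * half (Suc (Suc (Suc (Suc n)))) = 2 * half (Suc (Suc (Suc n))) + 2 * half (Suc (Suc n)) + 4"
    by simp
  then show ?case unfolding "3.IH" by simp
qed (simp_all add: numeral_2_eq_2)

context hemisphere
begin

section \<open>The quotient by the antipodal map\<close>

definition label :: "int \<Rightarrow> nat" where
  "label v = nat \<bar>v\<bar>"

lemma label_eq: "label u = label v \<longleftrightarrow> u = v \<or> u = - v"
  by (auto simp: label_def)

lemma label_uminus: "label ` uminus ` F = label ` F"
  by (simp add: image_image label_def)

text \<open>The instance \<open>w = v\<close> of \<open>noanti\<close>, with \<open>{v, v}\<close>
  as a degenerate edge.\<close>

lemma no_antipodes:
  assumes "F \<in> S" "v \<in> F"
  shows "- v \<notin> F"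
proof
  assume "- v \<in> F"
  then have "{v, v} \<in> S" "{- v, v} \<in> S" using assms by (auto intro: asc_subset[OF ascS assms(1)])
  then show False using noanti by blast
qed

lemma edges_agree:
  assumes "F \<in> S" "H \<in> S" "v \<in> F" "v \<in> H" "u \<in> F"
  shows "- u \<notin> H"
proof
  assume "- u \<in> H"
  then have "{u, v} \<in> S" "{- u, v} \<in> S"
    using asc_subset[OF ascS assms(1)] asc_subset[OF ascS assms(2)] assms by auto
  then show False using noanti by blast
qed

lemma label_inj: "F \<in> S \<Longrightarrow> inj_on label F"
  using no_antipodes by (intro inj_onI) (auto simp: label_eq)

text \<open>After replacing \<open>H\<close> by its antipode if necessary, \<open>F\<close> and
  \<open>H\<close> share a vertex. By \<open>edges_agree\<close> no vertex of \<open>F\<close> then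
  has its antipode in \<open>H\<close>, so every label is lifted the same way in both. In particular
  a nonempty face of the quotient comes from one antipodal pair of faces only.\<close>

lemma label_lift:
  assumes F: "F \<in> S" "F \<noteq> {}" and H: "H \<in> S" and sub: "label ` F \<subseteq> label ` H"
  shows "F \<subseteq> H \<or> F \<subseteq> uminus ` H"
proof -
  have lift: "F \<subseteq> H" if H: "H \<in> S" and sub: "label ` F \<subseteq> label ` H" and v: "v \<in> F" "v \<in> H" for H v
  proof
    fix u assume u: "u \<in> F"
    then obtain w where "w \<in> H" "label u = label w" using sub by blast
    then show "u \<in> H" using edges_agree[OF F(1) H v u] by (auto simp: label_eq)
  qed
  obtain v where v: "v \<in> F" using F(2) by blast
  then obtain w where w: "w \<in> H" "label v = label w" using sub by blast
  then consider "v \<in> H" | "v \<in> uminus ` H" by (auto simp: label_eq)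
  then show ?thesis
  proof cases
    case 1
    then show ?thesis using lift[OF H sub v] by blast
  next
    case 2
    then show ?thesis using lift[OF symm_uminus[OF H] _ v] sub label_uminus by simp
  qed
qed

definition \<Delta> :: "nat set set" where
  "\<Delta> = (`) label ` S"

lemma asc_Delta: "asc \<Delta>"
  unfolding \<Delta>_def by (rule asc_image[OF ascS])

text \<open>A face through the image of \<open>F\<close> has a lift through \<open>F\<close> itself,
  so the link can be read off in the sphere. Together with \<open>label_inj_link\<close> this makes
  the two links isomorphic.\<close>

lemma link_Delta:
  assumes F: "F \<in> S" "F \<noteq> {}"
  shows "link (label ` F) \<Delta> = (`) label ` link F S"
proof
  show "(`) label ` link F S \<subseteq> link (label ` F) \<Delta>"
  proof
    fix G' assume "G' \<in> (`) label ` link F S"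
    then obtain G where G: "G' = label ` G" "G \<in> S" "F \<inter> G = {}" "F \<union> G \<in> S" by (auto simp: link_def)
    have "label ` F \<inter> label ` G = label ` (F \<inter> G)"
      using inj_on_image_Int[OF label_inj[OF G(4)]] by simp
    then have "label ` F \<inter> label ` G = {}" using G(3) by simp
    moreover have "label ` F \<union> label ` G \<in> \<Delta>" using G(4) by (simp add: \<Delta>_def flip: image_Un)
    ultimately show "G' \<in> link (label ` F) \<Delta>" using G(1,2) by (simp add: link_def \<Delta>_def)
  qed
  show "link (label ` F) \<Delta> \<subseteq> (`) label ` link F S"
  proof
    fix G' assume G': "G' \<in> link (label ` F) \<Delta>"
    then have d: "label ` F \<inter> G' = {}" "label ` F \<union> G' \<in> \<Delta>" by (auto simp: link_def)
    then obtain H0 where H0: "H0 \<in> S" "label ` F \<union> G' = label ` H0" by (auto simp: \<Delta>_def)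
    have "label ` F \<subseteq> label ` H0" using H0(2) by blast
    from label_lift[OF F H0(1) this]
    have "\<exists>H\<in>S. F \<subseteq> H \<and> label ` H = label ` H0"
      using H0(1) symm_uminus[OF H0(1)] label_uminus by metis
    then obtain H where H: "H \<in> S" "F \<subseteq> H" "label ` H = label ` H0" by blast
    have "label ` (H - F) = label ` H - label ` F"
      using inj_on_image_set_diff[OF label_inj[OF H(1)], of H F] H(2) by simp
    also have "label ` H = label ` F \<union> G'" using H(3) H0(2) by simp
    also have "label ` F \<union> G' - label ` F = G'"
      using d(1) by (simp add: Un_Diff Diff_triv Int_commute)
    finally have e: "G' = label ` (H - F)" by simp
    have "H - F \<in> S" using asc_subset[OF ascS H(1)] by blast
    moreover have "F \<union> (H - F) = H" using H(2) by blast
    ultimately have "H - F \<in> link F S" using H(1) by (simp add: link_def)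
    then show "G' \<in> (`) label ` link F S" using e by blast
  qed
qed

lemma label_inj_link:
  assumes F: "F \<in> S" "F \<noteq> {}"
  shows "inj_on label (verts (link F S))"
proof (rule inj_onI)
  fix u w assume "u \<in> verts (link F S)" "w \<in> verts (link F S)" "label u = label w"
  then obtain G H where G: "u \<in> G" "F \<union> G \<in> S" and H: "w \<in> H" "F \<union> H \<in> S"
    by (auto simp: verts_def link_def)
  obtain v where v: "v \<in> F" using F(2) by blast
  have "- u \<notin> F \<union> H" by (rule edges_agree[OF G(2) H(2), of v]) (use v G(1) in auto)
  then show "u = w" using H(1) \<open>label u = label w\<close> by (auto simp: label_eq)
qed

lemma pl_sphere_link_Delta:
  assumes F: "F \<in> S" "F \<noteq> {}"
  shows "pl_sphere (int n - int (card (label ` F))) (link (label ` F) \<Delta>)"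
proof -
  obtain I' :: "nat set" and E E' where I': "finite I'" "card I' + card F = card {..n}"
    "pl_iso (face_cone (link F S)) (coords I') E E'"
    using pl_iso_face_link[OF ascS F(1) finite_atMost iso] by blast
  obtain R R' where R: "pl_iso (face_cone (link F S)) (face_cone ((`) label ` link F S)) R R'"
    using pl_iso_relabel[OF label_inj_link[OF F]] by blast
  have al: "asc (link F S)" by (rule asc_link[OF ascS F(1)])
  have "pl_iso (face_cone ((`) label ` link F S)) (coords I') (\<lambda>x. E (R' x)) (\<lambda>x. R (E' x))"
    by (rule pl_iso_trans[OF pl_iso_sym[OF R] I'(3) cone_coords finite_verts[OF al]])
  then show ?thesis
    unfolding link_Delta[OF F]
  proof (rule pl_sphereI[OF asc_image[OF al] _ I'(1)])
    show "int (card I') = int n - int (card (label ` F)) + 1"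
      using I'(2) card_image[OF label_inj[OF F(1)]] by simp
  qed
qed

lemma pl_manifold_Delta:
  assumes m: "\<And>G. G \<in> S \<Longrightarrow> card G \<le> Suc n" "\<exists>G\<in>S. card G = Suc n"
  shows "pl_manifold (int n) \<Delta>"
proof -
  have c: "card ` \<Delta> = card ` S"
    unfolding \<Delta>_def image_image using card_image[OF label_inj] by force
  have "Suc n \<in> card ` S" using m(2) by force
  then have "Max (card ` S) = Suc n"
    using ascS m(1) by (intro Max_eqI) (auto simp: asc_def)
  then have "dimension \<Delta> = int n" unfolding dimension_def c by simp
  moreover have "pl_sphere (int n - int (card G)) (link G \<Delta>)" if "G \<in> \<Delta>" "G \<noteq> {}" for G
  proof -
    obtain F where "F \<in> S" "G = label ` F" using \<open>G \<in> \<Delta>\<close> by (auto simp: \<Delta>_def)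
    then show ?thesis using pl_sphere_link_Delta[of F] that(2) by blast
  qed
  ultimately show ?thesis unfolding pl_manifold_def using asc_Delta by blast
qed

lemma f0_Delta: "int (f0 \<Delta>) = N"
proof -
  have "label ` ({-N..N} - {0}) = {1..nat N}"
  proof
    show "label ` ({-N..N} - {0}) \<subseteq> {1..nat N}" by (auto simp: label_def)
    show "{1..nat N} \<subseteq> label ` ({-N..N} - {0})"
    proof
      fix k assume "k \<in> {1..nat N}"
      then show "k \<in> label ` ({-N..N} - {0})"
        by (intro image_eqI[of _ _ "int k"]) (auto simp: label_def)
    qed
  qed
  then show ?thesis unfolding f0_def \<Delta>_def verts_image vS using a0 aN by simp
qed

subsection \<open>The sphere and projective space\<close>

lemma Phi_scale: "x \<in> face_cone S \<Longrightarrow> 0 < c \<Longrightarrow> \<Phi> (\<lambda>v. c * x v) = (\<lambda>i. c * \<Phi> x i)"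
  by (intro ext pl_fun_homogeneous[OF plF(1)]) (auto intro: cone_scale)

definition len :: "(int \<Rightarrow> real) \<Rightarrow> real" where
  "len x = sqrt (\<Sum>i\<le>n. (\<Phi> x i)\<^sup>2)"

definition \<theta> :: "(int \<Rightarrow> real) \<Rightarrow> nat \<Rightarrow> real" where
  "\<theta> x = (\<lambda>i. \<Phi> x i / len x)"

lemma realS: "realization S = {x \<in> face_cone S. (\<Sum>v\<in>verts S. x v) = 1}"
  by (rule realization_alt[OF ascS])

lemma len_pos:
  assumes x: "x \<in> realization S"
  shows "0 < len x"
proof -
  have xS: "x \<in> face_cone S" and s: "(\<Sum>v\<in>verts S. x v) = 1" using x by (auto simp: realS)
  have "\<Phi> x \<noteq> (\<lambda>i. 0)"
  proof
    assume z: "\<Phi> x = (\<lambda>i. 0)"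
    have "\<Phi>' (\<lambda>i. 0) = (\<lambda>v. 0)"
      by (rule pl_map_zero[where X="coords {..n}" and F=\<Phi>'])
        (simp add: pl_map_def plF, simp add: coords_def)
    then have "x = (\<lambda>v. 0)" using Phi'_Phi[OF xS] z by simp
    then show False using s by simp
  qed
  then obtain i where i: "\<Phi> x i \<noteq> 0" by blast
  then have "i \<le> n" using coords_zero[OF Phi_coords[OF xS], of i] by auto
  then have "0 < (\<Sum>i\<le>n. (\<Phi> x i)\<^sup>2)" using i by (intro sum_pos2[of _ i]) auto
  then show ?thesis by (simp add: len_def)
qed

lemma topspace_nsphere: "topspace (nsphere n) = {z. (\<Sum>i\<le>n. (z i)\<^sup>2) = 1 \<and> (\<forall>i>n. z i = 0)}"
  by (auto simp: nsphere)

lemma theta_sphere: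
  assumes x: "x \<in> realization S"
  shows "\<theta> x \<in> topspace (nsphere n)"
proof -
  have xS: "x \<in> face_cone S" using x by (simp add: realS)
  have "(\<Sum>i\<le>n. (\<theta> x i)\<^sup>2) = (\<Sum>i\<le>n. (\<Phi> x i)\<^sup>2) / (len x)\<^sup>2"
    by (simp add: \<theta>_def power_divide sum_divide_distrib)
  also have "(len x)\<^sup>2 = (\<Sum>i\<le>n. (\<Phi> x i)\<^sup>2)" by (simp add: len_def sum_nonneg)
  also have "(\<Sum>i\<le>n. (\<Phi> x i)\<^sup>2) / (\<Sum>i\<le>n. (\<Phi> x i)\<^sup>2) = 1"
    using len_pos[OF x] by (simp add: len_def)
  finally show ?thesis
    unfolding topspace_nsphere using coords_zero[OF Phi_coords[OF xS]] by (simp add: \<theta>_def)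
qed

text \<open>By homogeneity of \<open>\<Phi>\<close>, points on one ray of the model come from one
  ray of the cone, and a ray meets the realization in at most one point.\<close>

lemma theta_inj:
  assumes x: "x \<in> realization S" and y: "y \<in> realization S" and e: "\<theta> x = \<theta> y"
  shows "x = y"
proof -
  have xS: "x \<in> face_cone S" "(\<Sum>v\<in>verts S. x v) = 1" using x by (auto simp: realS)
  have yS: "y \<in> face_cone S" "(\<Sum>v\<in>verts S. y v) = 1" using y by (auto simp: realS)
  define c where "c = len x / len y"
  have c: "0 < c" using len_pos[OF x] len_pos[OF y] by (simp add: c_def)
  have "\<Phi> x i = c * \<Phi> y i" for i
    using fun_cong[OF e, of i] len_pos[OF x] len_pos[OF y] by (simp add: \<theta>_def c_def field_simps)
  then have "\<Phi> x = \<Phi> (\<lambda>v. c * y v)" using Phi_scale[OF yS(1) c] by auto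
  then have xy: "x = (\<lambda>v. c * y v)"
    using Phi'_Phi[OF xS(1)] Phi'_Phi[OF cone_scale[OF yS(1) c]] by metis
  have "(\<Sum>v\<in>verts S. x v) = c * (\<Sum>v\<in>verts S. y v)" unfolding xy by (simp add: sum_distrib_left)
  then have "c = 1" using xS(2) yS(2) by simp
  then show ?thesis using xy by simp
qed

lemma theta_surj:
  assumes z: "z \<in> topspace (nsphere n)"
  shows "\<exists>x\<in>realization S. \<theta> x = z"
proof -
  have zc: "z \<in> coords {..n}" using z unfolding topspace_nsphere by (intro coordsI) auto
  have z1: "(\<Sum>i\<le>n. (z i)\<^sup>2) = 1" using z by (simp add: topspace_nsphere)
  define x where "x = \<Phi>' z"
  have xS: "x \<in> face_cone S" unfolding x_def by (rule Phi'_cone[OF zc])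
  have Px: "\<Phi> x = z" unfolding x_def by (rule Phi_Phi'[OF zc])
  define s where "s = (\<Sum>v\<in>verts S. x v)"
  have "s \<noteq> 0"
  proof
    assume "s = 0"
    then have "\<forall>v\<in>verts S. x v = 0"
      unfolding s_def using finite_verts[OF ascS] cone_nonneg[OF xS] by (simp add: sum_nonneg_eq_0_iff)
    then have "x = (\<lambda>v. 0)" using cone_zero_outside[OF xS] by blast
    moreover have "\<Phi> (\<lambda>v. 0) = (\<lambda>i. 0)"
      by (rule pl_map_zero[where X="face_cone S" and F=\<Phi>]) (simp_all add: pl_map_def plF zero_in_cone[OF ascS])
    ultimately have "z = (\<lambda>i. 0)" using Px by simp
    then show False using z1 by simp
  qed
  moreover have "0 \<le> s" unfolding s_def by (intro sum_nonneg cone_nonneg[OF xS])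
  ultimately have s: "0 < 1 / s" by simp
  define y where "y = (\<lambda>v. 1 / s * x v)"
  have yS: "y \<in> face_cone S" unfolding y_def by (rule cone_scale[OF xS s])
  have "(\<Sum>v\<in>verts S. y v) = 1" using s by (simp add: y_def s_def flip: sum_divide_distrib)
  then have yR: "y \<in> realization S" using yS by (simp add: realS)
  have Py: "\<Phi> y = (\<lambda>i. 1 / s * z i)" using Phi_scale[OF xS s] Px by (simp add: y_def)
  have "(\<Sum>i\<le>n. (\<Phi> y i)\<^sup>2) = (1 / s)\<^sup>2" unfolding Py power_mult_distrib
    by (simp add: z1 flip: sum_distrib_left)
  then have "len y = 1 / s" using s by (simp add: len_def real_sqrt_divide)
  then have "\<theta> y = z" unfolding \<theta>_def Py using s by (simp add: fun_eq_iff)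
  then show ?thesis using yR by blast
qed

lemma homeomorphic_theta: "homeomorphic_map (realization_space S) (nsphere n) \<theta>"
proof (rule continuous_imp_homeomorphic_map)
  have cP: "continuous_on (realization S) (\<lambda>x. \<Phi> x i)" for i
    by (rule continuous_on_subset[OF pl_fun_continuous[OF plF(1)]]) (auto simp: realS)
  have ct: "continuous_on (realization S) \<theta>"
    unfolding \<theta>_def
  proof (intro continuous_on_coordinatewise_then_product continuous_on_divide cP)
    show "continuous_on (realization S) len"
      unfolding len_def by (intro continuous_on_real_sqrt continuous_on_sum continuous_on_power cP)
    show "\<forall>x\<in>realization S. len x \<noteq> 0" using len_pos by force
  qed
  have ns: "nsphere n = subtopology euclidean (topspace (nsphere n))"
    unfolding topspace_nsphere by (simp add: nsphere euclidean_product_topology)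
  have "continuous_map (realization_space S) (subtopology euclidean (topspace (nsphere n))) \<theta>"
    unfolding realization_space_euclidean using theta_sphere ct by auto
  then show "continuous_map (realization_space S) (nsphere n) \<theta>" unfolding ns[symmetric] .
  show "Hausdorff_space (nsphere n)"
    unfolding nsphere by (intro Hausdorff_space_subtopology Hausdorff_powertop_real)
  show "\<theta> ` topspace (realization_space S) = topspace (nsphere n)"
    using theta_sphere theta_surj by (auto simp: image_iff)
  show "inj_on \<theta> (topspace (realization_space S))"
    using theta_inj by (auto intro: inj_onI)
qed (rule compact_realization_space[OF ascS])

lemma real_uminus:
  assumes x: "x \<in> realization S"
  shows "(\<lambda>v. x (- v)) \<in> realization S"
proof -
  have "(\<Sum>v\<in>verts S. x (- v)) = (\<Sum>v\<in>verts S. x v)"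
    unfolding vS by (rule sum.reindex_bij_witness[of _ uminus uminus]) auto
  then show ?thesis using x face_cone_symm_uminus[of x B] by (simp add: realS)
qed

lemma theta_uminus:
  assumes x: "x \<in> realization S"
  shows "\<theta> (\<lambda>v. x (- v)) = (\<lambda>i. - \<theta> x i)"
  using equi[of x] x by (simp add: realS \<theta>_def len_def)

lemma antipodal_theta:
  assumes x: "x \<in> realization S" and y: "y \<in> realization S"
  shows "antipodal_pair (\<theta> x) = antipodal_pair (\<theta> y) \<longleftrightarrow> y = x \<or> y = (\<lambda>v. x (- v))"
proof -
  have "antipodal_pair (\<theta> x) = antipodal_pair (\<theta> y) \<longleftrightarrow> \<theta> y = \<theta> x \<or> \<theta> y = (\<lambda>i. - \<theta> x i)"
    by (auto simp: antipodal_pair_def doubleton_eq_iff fun_eq_iff)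
  also have "\<dots> \<longleftrightarrow> y = x \<or> y = (\<lambda>v. x (- v))"
    using theta_inj[OF y x] theta_inj[OF y real_uminus[OF x]] theta_uminus[OF x] by metis
  finally show ?thesis .
qed

text \<open>The barycentric extension of \<open>label\<close>. On the cone over \<open>S\<close> at
  most one of the two terms is nonzero; for \<open>k = 0\<close> the same coordinate is doubled, but
  it is 0 since 0 is not a vertex.\<close>

definition glue :: "(int \<Rightarrow> real) \<Rightarrow> nat \<Rightarrow> real" where
  "glue x = (\<lambda>k. x (int k) + x (- int k))"

lemma support_glue:
  assumes x: "x \<in> face_cone S"
  shows "{k. glue x k \<noteq> 0} = label ` {v. x v \<noteq> 0}"
proof (intro set_eqI iffI)
  fix k assume "k \<in> {k. glue x k \<noteq> 0}"
  then have "x (int k) \<noteq> 0 \<or> x (- int k) \<noteq> 0" by (auto simp: glue_def)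
  then show "k \<in> label ` {v. x v \<noteq> 0}"
  proof
    assume "x (int k) \<noteq> 0"
    then show ?thesis by (intro image_eqI[of _ _ "int k"]) (auto simp: label_def)
  next
    assume "x (- int k) \<noteq> 0"
    then show ?thesis by (intro image_eqI[of _ _ "- int k"]) (auto simp: label_def)
  qed
next
  fix k assume "k \<in> label ` {v. x v \<noteq> 0}"
  then obtain v where v: "k = label v" "x v \<noteq> 0" by blast
  have "0 < x v" using v(2) cone_nonneg[OF x, of v] by simp
  moreover have "int k = v \<or> - int k = v" using v(1) by (auto simp: label_def)
  ultimately have "0 < x (int k) + x (- int k)"
    using cone_nonneg[OF x, of "int k"] cone_nonneg[OF x, of "- int k"] by (auto intro: add_pos_nonneg add_nonneg_pos)
  then show "k \<in> {k. glue x k \<noteq> 0}" by (simp add: glue_def)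
qed

lemma glue_label:
  assumes x: "x \<in> face_cone S" and v: "x v \<noteq> 0"
  shows "glue x (label v) = x v"
proof -
  have "{v. x v \<noteq> 0} \<in> S" using x by (simp add: face_cone_def)
  then have "x (- v) = 0" using no_antipodes[of _ v] v by blast
  then show ?thesis by (cases "0 \<le> v") (auto simp: glue_def label_def)
qed

lemma glue_sum:
  assumes x: "x \<in> face_cone S"
  shows "(\<Sum>k | glue x k \<noteq> 0. glue x k) = (\<Sum>v\<in>verts S. x v)"
proof -
  have F: "{v. x v \<noteq> 0} \<in> S" using x by (simp add: face_cone_def)
  have "(\<Sum>k | glue x k \<noteq> 0. glue x k) = (\<Sum>v | x v \<noteq> 0. glue x (label v))"
    unfolding support_glue[OF x] by (rule sum.reindex[OF label_inj[OF F], unfolded o_def])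
  also have "\<dots> = (\<Sum>v | x v \<noteq> 0. x v)" using glue_label[OF x] by (intro sum.cong) auto
  also have "\<dots> = (\<Sum>v\<in>verts S. x v)"
    using finite_verts[OF ascS] F by (intro sum.mono_neutral_left) (auto simp: verts_def)
  finally show ?thesis .
qed

lemma glue_realization:
  assumes x: "x \<in> realization S"
  shows "glue x \<in> realization \<Delta>"
proof -
  have xS: "x \<in> face_cone S" "(\<Sum>v\<in>verts S. x v) = 1" using x by (auto simp: realS)
  have "{v. x v \<noteq> 0} \<in> S" using xS(1) by (simp add: face_cone_def)
  then have "{k. glue x k \<noteq> 0} \<in> \<Delta>" unfolding support_glue[OF xS(1)] \<Delta>_def by blast
  moreover have "0 \<le> glue x k" for k
    unfolding glue_def by (intro add_nonneg_nonneg cone_nonneg[OF xS(1)])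
  ultimately show ?thesis unfolding realization_def using glue_sum[OF xS(1)] xS(2) by simp
qed

lemma glue_surj:
  assumes z: "z \<in> realization \<Delta>"
  shows "\<exists>x\<in>realization S. glue x = z"
proof -
  have z0: "\<And>k. 0 \<le> z k" and z1: "(\<Sum>k | z k \<noteq> 0. z k) = 1" and "{k. z k \<noteq> 0} \<in> \<Delta>"
    using z by (auto simp: realization_def)
  then obtain F where F: "F \<in> S" "{k. z k \<noteq> 0} = label ` F" by (auto simp: \<Delta>_def)
  define x where "x v = (if v \<in> F then z (label v) else 0)" for v
  have supp: "{v. x v \<noteq> 0} = F" using F(2) by (auto simp: x_def)
  then have xS: "x \<in> face_cone S" using F(1) z0 by (auto simp: face_cone_def x_def)
  have fx: "glue x = z"
  proof
    fix k
    show "glue x k = z k"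
    proof (cases "z k = 0")
      case True
      then have "k \<notin> {k. glue x k \<noteq> 0}" unfolding support_glue[OF xS] supp using F(2) by blast
      then show ?thesis using True by simp
    next
      case False
      then obtain v where v: "v \<in> F" "k = label v" using F(2) by blast
      then have "x v = z k" by (simp add: x_def)
      then show ?thesis using glue_label[OF xS, of v] v False by simp
    qed
  qed
  have "(\<Sum>v\<in>verts S. x v) = 1" using glue_sum[OF xS] z1 unfolding fx by simp
  then show ?thesis using xS fx by (auto simp: realS)
qed

text \<open>The two supports have the same labels, so by \<open>label_lift\<close> the support of
  \<open>x\<close> lies in that of \<open>y\<close> or of its antipode. Labels are injective on a
  face, which forces the coordinates to agree too.\<close>

lemma glue_eq:
  assumes x: "x \<in> realization S" and y: "y \<in> realization S"
  shows "glue x = glue y \<longleftrightarrow> y = x \<or> y = (\<lambda>v. x (- v))"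
proof
  assume e: "glue x = glue y"
  have xS: "x \<in> face_cone S" "(\<Sum>v\<in>verts S. x v) = 1" using x by (auto simp: realS)
  have yS: "y \<in> face_cone S" using y by (simp add: realS)
  have same: "y' = x" if y': "y' \<in> face_cone S" "glue x = glue y'" "{v. x v \<noteq> 0} \<subseteq> {v. y' v \<noteq> 0}" for y'
  proof
    fix v
    show "y' v = x v"
    proof (cases "x v = 0")
      case False
      then show ?thesis using glue_label[OF xS(1) False] glue_label[OF y'(1), of v] y'(2,3) by auto
    next
      case True
      have "y' v = 0"
      proof (rule ccontr)
        assume yv: "y' v \<noteq> 0"
        then have "label v \<in> label ` {v. x v \<noteq> 0}"
          using support_glue[OF xS(1)] support_glue[OF y'(1)] y'(2) by auto
        then obtain u where u: "x u \<noteq> 0" "label v = label u" by blast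
        have "u = - v" using u True by (auto simp: label_eq)
        moreover have "y' u \<noteq> 0" using u(1) y'(3) by blast
        moreover have "{v. y' v \<noteq> 0} \<in> S" using y'(1) by (simp add: face_cone_def)
        ultimately show False using no_antipodes[of _ v] yv by blast
      qed
      then show ?thesis using True by simp
    qed
  qed
  have sx: "{v. x v \<noteq> 0} \<in> S" and sy: "{v. y v \<noteq> 0} \<in> S" using xS(1) yS by (auto simp: face_cone_def)
  have ne: "{v. x v \<noteq> 0} \<noteq> {}"
  proof
    assume "{v. x v \<noteq> 0} = {}"
    then have "\<And>v. x v = 0" by blast
    then show False using xS(2) by simp
  qed
  have "label ` {v. x v \<noteq> 0} \<subseteq> label ` {v. y v \<noteq> 0}"
    using support_glue[OF xS(1)] support_glue[OF yS] e by simp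
  from label_lift[OF sx ne sy this] show "y = x \<or> y = (\<lambda>v. x (- v))"
  proof
    assume "{v. x v \<noteq> 0} \<subseteq> {v. y v \<noteq> 0}"
    then show ?thesis using same[OF yS e] by blast
  next
    assume s: "{v. x v \<noteq> 0} \<subseteq> uminus ` {v. y v \<noteq> 0}"
    have "(\<lambda>v. y (- v)) = x"
    proof (rule same[OF face_cone_symm_uminus[OF yS]])
      show "glue x = glue (\<lambda>v. y (- v))" unfolding e by (simp add: glue_def add.commute)
      show "{v. x v \<noteq> 0} \<subseteq> {v. y (- v) \<noteq> 0}" using s by auto
    qed
    then have "y (- (- v)) = x (- v)" for v by (rule fun_cong)
    then have "y = (\<lambda>v. x (- v))" by auto
    then show ?thesis by blast
  qed
next
  assume "y = x \<or> y = (\<lambda>v. x (- v))"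
  then show "glue x = glue y" by (auto simp: glue_def)
qed

lemma quotient_glue: "quotient_map (realization_space S) (realization_space \<Delta>) glue"
proof (rule continuous_closed_imp_quotient_map)
  have "continuous_on (realization S) glue"
    unfolding glue_def
    by (intro continuous_on_coordinatewise_then_product continuous_on_add continuous_on_coord)
  then show c: "continuous_map (realization_space S) (realization_space \<Delta>) glue"
    unfolding realization_space_euclidean using glue_realization by auto
  show "closed_map (realization_space S) (realization_space \<Delta>) glue"
    by (rule continuous_imp_closed_map[OF c compact_realization_space[OF ascS] Hausdorff_realization_space])
  show "glue ` topspace (realization_space S) = topspace (realization_space \<Delta>)"
    using glue_realization glue_surj by (auto simp: image_iff)
qed

text \<open>Both \<open>glue\<close> and the antipodal quotient after \<open>\<theta>\<close> are
  quotient maps on the realization of the sphere, and the fibres of both are the antipodal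
  pairs.\<close>

lemma homeomorphic_projective_space: "realization_space \<Delta> homeomorphic_space real_projective_space n"
proof -
  let ?X = "realization_space S"
  let ?a = "antipodal_pair \<circ> \<theta>"
  have qa: "quotient_map ?X (real_projective_space n) ?a"
    using homeomorphic_theta quotient_map_real_projective_space unfolding homeomorphic_map_def
    by (intro quotient_map_compose) auto
  have eq: "?a x = ?a y \<longleftrightarrow> glue x = glue y" if "x \<in> topspace ?X" "y \<in> topspace ?X" for x y
    using antipodal_theta[of x y] glue_eq[of x y] that by simp
  show ?thesis by (rule homeomorphic_space_quotients[OF quotient_glue qa]) (simp only: eq)
qed

subsection \<open>Central symmetry\<close>

lemma sphere_complex:
  "\<exists>(T :: nat set set) \<sigma>. centrally_symmetric T \<sigma> \<and> pl_sphere (int n) T \<and>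
     (\<nexists>C. induced_cs_four_cycle C T \<sigma>) \<and> int (f0 T) = 2 * N"
proof -
  let ?e = int_encode
  define T where "T = (`) ?e ` S"
  define \<sigma> where "\<sigma> = (\<lambda>k. ?e (- int_decode k))"
  have se: "\<sigma> (?e v) = ?e (- v)" for v by (simp add: \<sigma>_def)
  have e_eq: "?e u = ?e v \<longleftrightarrow> u = v" for u v by (simp add: inj_eq[OF inj_int_encode])
  have sF: "\<sigma> ` ?e ` F = ?e ` uminus ` F" for F by (simp add: image_image se)
  have T: "asc T" unfolding T_def by (rule asc_image[OF ascS])
  have vT: "verts T = ?e ` verts S" unfolding T_def by (rule verts_image)
  have nofix: "\<sigma> ` F \<noteq> F" if "F \<in> T" "F \<noteq> {}" for F
  proof -
    obtain F0 where F0: "F0 \<in> S" "F = ?e ` F0" using \<open>F \<in> T\<close> by (auto simp: T_def)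
    obtain v where v: "v \<in> F0" using F0(2) \<open>F \<noteq> {}\<close> by blast
    have "- v \<notin> F0" by (rule no_antipodes[OF F0(1) v])
    then have "uminus ` F0 \<noteq> F0" using v by blast
    then show ?thesis unfolding F0(2) sF by (simp add: inj_image_eq_iff[OF inj_int_encode])
  qed
  have cs: "centrally_symmetric T \<sigma>"
    unfolding centrally_symmetric_def
  proof (intro conjI ballI T impI)
    fix v assume "v \<in> verts T"
    then obtain w where w: "w \<in> verts S" "v = ?e w" by (auto simp: vT)
    have "- w \<in> verts S" "w \<noteq> 0" using w(1) unfolding vS by auto
    then show "\<sigma> v \<in> verts T" "\<sigma> (\<sigma> v) = v" "\<sigma> v \<noteq> v" using w(2) by (auto simp: se vT e_eq)
  next
    fix F assume F: "F \<in> T"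
    then obtain F0 where F0: "F0 \<in> S" "F = ?e ` F0" by (auto simp: T_def)
    show "\<sigma> ` F \<in> T" unfolding F0(2) sF T_def using symm_uminus[OF F0(1)] by blast
    show "\<sigma> ` F \<noteq> F" if "F \<noteq> {}" by (rule nofix[OF F that])
  qed
  have inj_e: "inj_on ?e (verts S)" by (rule inj_on_subset[OF inj_int_encode subset_UNIV])
  obtain R R' where R: "pl_iso (face_cone S) (face_cone T) R R'"
    using pl_iso_relabel[OF inj_e] unfolding T_def by blast
  have sphere: "pl_sphere (int n) T"
    by (rule pl_sphereI[OF T pl_iso_trans[OF pl_iso_sym[OF R] iso cone_coords finite_verts[OF ascS]]]) auto
  \<comment> \<open>The antipode of the corner \<open>g 0\<close> is again a corner. It is neither
    \<open>g 0\<close> nor a neighbour of it in the cycle, because a face made of two antipodes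
    would be invariant. So it is \<open>g 2\<close>, and \<open>g 1\<close> has two antipodal
    neighbours.\<close>
  have no4: "\<not> induced_cs_four_cycle C T \<sigma>" for C
  proof
    assume C: "induced_cs_four_cycle C T \<sigma>"
    have CT: "C \<subseteq> T" and iso4: "asc_isomorphic C four_cycle" and sC: "(`) \<sigma> ` C = C"
      using C by (auto simp: induced_cs_four_cycle_def induced_subcomplex_def)
    obtain h where h: "bij_betw h (verts C) (verts four_cycle)" "(`) h ` C = four_cycle"
      using iso4 by (auto simp: asc_isomorphic_def)
    have v4: "verts four_cycle = {0, 1, 2, 3}" by (auto simp: verts_def four_cycle_def)
    define g where "g = inv_into (verts C) h"
    have hg: "h (g i) = i" "g i \<in> verts C" if "i \<in> {0, 1, 2, 3}" for i
      using h(1) that unfolding g_def v4[symmetric]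
      by (auto simp: bij_betw_inv_into_right dest: bij_betwE[OF bij_betw_inv_into])
    have gh: "g (h v) = v" "h v \<in> {0, 1, 2, 3}" if "v \<in> verts C" for v
      using h(1) that unfolding g_def v4[symmetric] by (auto simp: bij_betw_inv_into_left dest: bij_betwE)
    have edge: "{g i, g j} \<in> C" if ij: "{i, j} \<in> four_cycle" for i j
    proof -
      have "{i, j} \<in> (`) h ` C" using ij h(2) by simp
      then obtain G where G: "G \<in> C" "{i, j} = h ` G" by blast
      have "G \<subseteq> verts C" using G(1) by (auto simp: verts_def)
      then have "g ` h ` G = G" unfolding image_image using gh(1) by force
      then have "{g i, g j} = G" unfolding G(2)[symmetric] by simp
      then show ?thesis using G(1) by simp
    qed
    have "{0, 1} \<in> four_cycle" "{1, 2} \<in> four_cycle" "{0, 3} \<in> four_cycle"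
      by (auto simp: four_cycle_def)
    from this[THEN edge] have E: "{g 0, g 1} \<in> C" "{g 1, g 2} \<in> C" "{g 0, g 3} \<in> C" by auto
    have g0: "g 0 \<in> verts C" by (rule hg(2)) simp
    then obtain G where G: "G \<in> C" "g 0 \<in> G" by (auto simp: verts_def)
    have "\<sigma> ` G \<in> C" using G(1) sC by blast
    then have s0: "\<sigma> (g 0) \<in> verts C" using G(2) by (auto simp: verts_def)
    have "g 0 \<in> verts T" using g0 CT by (auto simp: verts_def)
    then obtain w where w: "g 0 = ?e w" by (auto simp: vT)
    have not: "{g 0, \<sigma> (g 0)} \<notin> T"
    proof
      assume "{g 0, \<sigma> (g 0)} \<in> T"
      moreover have "\<sigma> ` {g 0, \<sigma> (g 0)} = {g 0, \<sigma> (g 0)}" unfolding w by (auto simp: se)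
      ultimately show False using nofix by blast
    qed
    have "\<sigma> (g 0) = g (h (\<sigma> (g 0)))" using gh(1)[OF s0] by simp
    moreover have "h (\<sigma> (g 0)) \<in> {0, 1, 2, 3}" by (rule gh(2)[OF s0])
    ultimately consider "\<sigma> (g 0) = g 0" | "\<sigma> (g 0) = g 1" | "\<sigma> (g 0) = g 2" | "\<sigma> (g 0) = g 3" by auto
    then have s2: "\<sigma> (g 0) = g 2"
    proof cases
      case 1
      then show ?thesis using not asc_subset[OF T, of "{g 0, g 1}" "{g 0}"] E(1) CT by auto
    qed (use not E CT in auto)
    have "{?e w, g 1} \<in> T" "{?e (- w), g 1} \<in> T"
      using E(1,2) CT s2 w by (auto simp: se insert_commute)
    moreover define u where "u = int_decode (g 1)"
    moreover have u: "g 1 = ?e u" by (simp add: u_def)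
    moreover have mem: "F \<in> S" if "?e ` F \<in> T" for F
    proof -
      obtain F0 where "F0 \<in> S" "?e ` F = ?e ` F0"
        using \<open>?e ` F \<in> T\<close> unfolding T_def by blast
      then show ?thesis by (simp add: inj_image_eq_iff[OF inj_int_encode])
    qed
    ultimately have "{w, u} \<in> S" "{- w, u} \<in> S"
      using mem[of "{w, u}"] mem[of "{- w, u}"] by auto
    then show False using noanti by blast
  qed
  have "card ({-N..N} - {0}) = nat (2 * N)" using a0 aN by (simp add: card_Diff_subset)
  moreover have "f0 T = card (verts S)" unfolding f0_def vT by (rule card_image[OF inj_e])
  ultimately have "int (f0 T) = 2 * N" unfolding vS using a0 aN by simp
  then show ?thesis using cs sphere no4 by blast
qed

end

theorem theorem1p3:
  fixes d :: nat
  assumes "d \<ge> 1"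
  shows "(\<exists>(S :: nat set set) \<sigma>. centrally_symmetric S \<sigma> \<and> pl_sphere (int d) S \<and>
            (\<nexists>C. induced_cs_four_cycle C S \<sigma>) \<and>
            int (f0 S) = 3 * int (fib (d + 1)) + 7 * int (fib d) + 3 * int (fib (d - 1)) - 4)
       \<and> (\<exists>\<Delta> :: nat set set. pl_triangulation (int d) (real_projective_space d) \<Delta> \<and>
            real (f0 \<Delta>) = 3/2 * real (fib (d + 1)) + 7/2 * real (fib d)
                          + 3/2 * real (fib (d - 1)) - 2)"
proof -
  obtain \<Phi> \<Phi>' where "hemisphere (half (Suc d)) (half d) (hemi_ball d) d \<Phi> \<Phi>'"
    using hemisphere_hemi_ball by blast
  then interpret hemisphere "half (Suc d)" "half d" "hemi_ball d" d \<Phi> \<Phi>' .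
  obtain m where m: "d = Suc m" using assms by (cases d) auto
  have count: "2 * half (Suc d) = 3 * int (fib (d + 1)) + 7 * int (fib d) + 3 * int (fib (d - 1)) - 4"
    using half_fib[of m] by (simp add: m)
  have "pl_manifold (int d) \<Delta>"
    using card_hemi_ball[of d] by (intro pl_manifold_Delta) (auto simp: symm_def)
  then have "pl_triangulation (int d) (real_projective_space d) \<Delta>"
    unfolding pl_triangulation_def using homeomorphic_projective_space by blast
  moreover have "2 * real (f0 \<Delta>) = 3 * real (fib (d + 1)) + 7 * real (fib d) + 3 * real (fib (d - 1)) - 4"
  proof -
    have "2 * int (f0 \<Delta>) = 3 * int (fib (d + 1)) + 7 * int (fib d) + 3 * int (fib (d - 1)) - 4"
      using f0_Delta count by simp
    from arg_cong[OF this, of real_of_int] show ?thesis by simp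
  qed
  ultimately have "\<exists>\<Delta> :: nat set set. pl_triangulation (int d) (real_projective_space d) \<Delta> \<and>
            real (f0 \<Delta>) = 3/2 * real (fib (d + 1)) + 7/2 * real (fib d)
                          + 3/2 * real (fib (d - 1)) - 2"
    by (intro exI[of _ \<Delta>]) simp
  then show ?thesis using sphere_complex unfolding count by (rule conjI[rotated])
qed

end
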